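(* Let $\mathcal{N}$ be the moduli space of stable holomorphic vector bundles of rank $n$ and degree $0$ on $X$ and $\mathcal{K}=\mathrm{Hom}_0(\Gamma,\mathrm{U}(n))/\mathrm{U}(n)$ the $\mathrm{U}(n)$-character variety, and let $\imath:\mathcal{N}\to\mathcal{K}$, $\{E_\rho\}\mapsto[\rho]$, be the Narasimhan–Seshadri map. Then $$\imath^*\omega_G=-4\,\omega_{NAB}.$$ Concretely: for $\mu_1,\mu_2\in\mathcal{H}^{0,1}(X,\mathrm{End}\,E_\rho)$ with Eichler–Shimura periods $\varphi_1,\varphi_2$, one has $\omega_G(\varphi_1-\varphi_1^*,\varphi_2-\varphi_2^* )=-\sqrt{-1}(\langle\mu_1,\mu_2\rangle-\langle\mu_2,\mu_1\rangle)=-4\,\omega_{NAB}(v_1,v_2)$, where $v_1,v_2$ are the real tangent vectors corresponding to the holomorphic tangent vectors $\mu_1,\mu_2$.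
   Context: $X\cong\Gamma\backslash\mathbb{H}$ compact of genus $g>1$, base point $z_0$; by Narasimhan–Seshadri every stable degree-0 rank-$n$ bundle is $E_\rho=\Gamma\backslash(\mathbb{H}\times\mathbb{C}^n)$ for an irreducible $\rho:\Gamma\to\mathrm{U}(n)$, unique up to equivalence; $\mathrm{Hom}_0$ means irreducible representations. The holomorphic tangent space $T_{\{E_\rho\}}\mathcal{N}$ is $\mathcal{H}^{0,1}(X,\mathrm{End}\,E_\rho)$ = antiholomorphic matrix functions $\mu$ on $\mathbb{H}$ with $\mu(\gamma z)\overline{\gamma'(z)}=\rho(\gamma)\mu(z)\rho(\gamma)^{-1}$, and $T_{[\rho]}\mathcal{K}=H^1(\Gamma,\mathfrak{u}(n)_{\mathrm{Ad}\,\rho})$. The differential of $\imath$ sends $\mu$ to the class of $\gamma\mapsto\varphi(\gamma)-\varphi(\gamma)^*$, where $\varphi(\gamma)=\int_{z_0}^{\gamma z_0}\mu\,d\bar z$ are the Eichler–Shimura periods. The Narasimhan–Atiyah–Bott metric is the Hermitian metric $ds^2$ on $\mathcal{N}$ given on tangent spaces by $\langle\mu,\nu\rangle=\sqrt{-1}\iint_F\mathrm{tr}(\mu\nu^* )dz\wedge d\bar z$ ($F$ a fundamental domain), and $\omega_{NAB}=-\tfrac12\operatorname{Im}ds^2$; equivalently $\omega_{NAB}(\partial/\partial\varepsilon_\mu,\partial/\partial\bar\varepsilon_\nu)=\tfrac{\sqrt{-1}}{2}\langle\mu,\nu\rangle$. The Goldman form $\omega_G$ on cocycles for a representation $\sigma$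 is $\omega_G(\chi_1,\chi_2)=\sum_{k=1}^g\mathrm{tr}(\chi_1(\alpha_k)\sigma(R_{k-1})\chi_2(a_k)\sigma(R_{k-1})^{-1})-\mathrm{tr}(\chi_1(\beta_k)\sigma(R_k)\chi_2(b_k)\sigma(R_k)^{-1})$, where $a_k,b_k$ are standard generators with $\prod[a_k,b_k]=1$, $R_k=\prod_{i\le k}[a_i,b_i]$, $R_0=1$, $\alpha_k=R_{k-1}b_k^{-1}R_k^{-1}$, $\beta_k=R_ka_k^{-1}R_{k-1}^{-1}$. *)

theory Defs
  imports "HOL-Complex_Analysis.Complex_Analysis"
begin

definition upper_half_plane :: "complex set" where
  "upper_half_plane = {z. Im z > 0}"

text \<open>Elements of SL(2,R); a Fuchsian group is represented by its preimage in SL(2,R),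
  acting on the upper half plane by Moebius transformations (g and -g act identically).\<close>

definition mob :: "real^2^2 \<Rightarrow> complex \<Rightarrow> complex" where
  "mob g z = (of_real (g$1$1) * z + of_real (g$1$2)) / (of_real (g$2$1) * z + of_real (g$2$2))"

definition SL2R_subgroup :: "(real^2^2) set \<Rightarrow> bool" where
  "SL2R_subgroup G \<longleftrightarrow> (\<forall>g\<in>G. det g = 1) \<and> mat 1 \<in> G \<and>
     (\<forall>g\<in>G. \<forall>h\<in>G. g ** h \<in> G) \<and> (\<forall>g\<in>G. matrix_inv g \<in> G) \<and> (\<forall>g\<in>G. - g \<in> G)"

definition generated_by :: "(real^2^2) set \<Rightarrow> (real^2^2) set \<Rightarrow> bool" where
  "generated_by G S \<longleftrightarrow> S \<subseteq> G \<and>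
     (\<forall>T. S \<subseteq> T \<and> mat 1 \<in> T \<and> - mat 1 \<in> T \<and> (\<forall>g\<in>T. \<forall>h\<in>T. g ** h \<in> T)
          \<and> (\<forall>g\<in>T. matrix_inv g \<in> T) \<longrightarrow> G \<subseteq> T)"

definition comm :: "'a::semiring_1^'n^'n \<Rightarrow> 'a^'n^'n \<Rightarrow> 'a^'n^'n" where
  "comm x y = x ** y ** matrix_inv x ** matrix_inv y"

primrec Rprod :: "(nat \<Rightarrow> real^2^2) \<Rightarrow> (nat \<Rightarrow> real^2^2) \<Rightarrow> nat \<Rightarrow> real^2^2" where
  "Rprod a b 0 = mat 1"
| "Rprod a b (Suc k) = Rprod a b k ** comm (a (Suc k)) (b (Suc k))"

definition alpha_gen :: "(nat \<Rightarrow> real^2^2) \<Rightarrow> (nat \<Rightarrow> real^2^2) \<Rightarrow> nat \<Rightarrow> real^2^2" where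
  "alpha_gen a b k = Rprod a b (k - 1) ** matrix_inv (b k) ** matrix_inv (Rprod a b k)"

definition beta_gen :: "(nat \<Rightarrow> real^2^2) \<Rightarrow> (nat \<Rightarrow> real^2^2) \<Rightarrow> nat \<Rightarrow> real^2^2" where
  "beta_gen a b k = Rprod a b k ** matrix_inv (a k) ** matrix_inv (Rprod a b (k - 1))"

text \<open>Fundamental polygon: the boundary word a_1 b_1 a_1^-1 b_1^-1 ... a_g b_g a_g^-1 b_g^-1.
  Each letter is given as (group element x, edge path from the base vertex v0 to x v0).
  The j-th side of the polygon is the translate by the product w_j of the first j letters
  of the corresponding edge, so the vertices are w_j v0.\<close>

definition polygon_letters ::
  "nat \<Rightarrow> (nat \<Rightarrow> real^2^2) \<Rightarrow> (nat \<Rightarrow> real^2^2) \<Rightarrow> (nat \<Rightarrow> real \<Rightarrow> complex) \<Rightarrow> (nat \<Rightarrow> real \<Rightarrow> complex)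
   \<Rightarrow> ((real^2^2) \<times> (real \<Rightarrow> complex)) list" where
  "polygon_letters g a b ca cb =
     concat (map (\<lambda>k. [(a k, ca k), (b k, cb k),
                       (matrix_inv (a k), mob (matrix_inv (a k)) \<circ> reversepath (ca k)),
                       (matrix_inv (b k), mob (matrix_inv (b k)) \<circ> reversepath (cb k))]) [1..<Suc g])"

fun polygon_sides :: "real^2^2 \<Rightarrow> ((real^2^2) \<times> (real \<Rightarrow> complex)) list \<Rightarrow> (real \<Rightarrow> complex) list" where
  "polygon_sides w [] = []"
| "polygon_sides w ((x, e) # ls) = (mob w \<circ> e) # polygon_sides (w ** x) ls"

fun join_list :: "(real \<Rightarrow> complex) list \<Rightarrow> real \<Rightarrow> complex" where
  "join_list [] = linepath 0 0"
| "join_list [p] = p"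
| "join_list (p # ps) = p +++ join_list ps"

definition polygon_boundary ::
  "nat \<Rightarrow> (nat \<Rightarrow> real^2^2) \<Rightarrow> (nat \<Rightarrow> real^2^2) \<Rightarrow> (nat \<Rightarrow> real \<Rightarrow> complex) \<Rightarrow> (nat \<Rightarrow> real \<Rightarrow> complex)
   \<Rightarrow> real \<Rightarrow> complex" where
  "polygon_boundary g a b ca cb = join_list (polygon_sides (mat 1) (polygon_letters g a b ca cb))"

text \<open>Gamma (given in SL(2,R)) is a cocompact torsion-free Fuchsian group of genus g with standard
  generators a_k, b_k (k = 1..g), compatible with the orientation of H, and F is the associated
  fundamental 4g-gon (positively oriented boundary).\<close>

definition standard_fuchsian ::
  "(real^2^2) set \<Rightarrow> nat \<Rightarrow> (nat \<Rightarrow> real^2^2) \<Rightarrow> (nat \<Rightarrow> real^2^2) \<Rightarrow> complex set \<Rightarrow> bool" where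
  "standard_fuchsian \<Gamma> g a b F \<longleftrightarrow>
     SL2R_subgroup \<Gamma> \<and>
     (\<forall>k\<in>{1..g}. a k \<in> \<Gamma> \<and> b k \<in> \<Gamma>) \<and>
     generated_by \<Gamma> ((a ` {1..g}) \<union> (b ` {1..g})) \<and>
     Rprod a b g \<in> {mat 1, - mat 1} \<and>
     (\<forall>\<gamma>\<in>\<Gamma>. \<forall>z\<in>upper_half_plane. mob \<gamma> z = z \<longrightarrow> \<gamma> = mat 1 \<or> \<gamma> = - mat 1) \<and>
     (\<exists>v0 ca cb. v0 \<in> upper_half_plane \<and>
        (\<forall>k\<in>{1..g}. valid_path (ca k) \<and> path_image (ca k) \<subseteq> upper_half_plane \<and>
            pathstart (ca k) = v0 \<and> pathfinish (ca k) = mob (a k) v0 \<and>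
            valid_path (cb k) \<and> path_image (cb k) \<subseteq> upper_half_plane \<and>
            pathstart (cb k) = v0 \<and> pathfinish (cb k) = mob (b k) v0) \<and>
        (let p = polygon_boundary g a b ca cb in
           valid_path p \<and> simple_path p \<and> pathfinish p = pathstart p \<and>
           F = path_image p \<union> inside (path_image p) \<and>
           (\<forall>w\<in>inside (path_image p). winding_number p w = 1))) \<and>
     F \<subseteq> upper_half_plane \<and>
     (\<Union>\<gamma>\<in>\<Gamma>. mob \<gamma> ` F) = upper_half_plane \<and>
     (\<forall>\<gamma>\<in>\<Gamma>. \<gamma> \<noteq> mat 1 \<and> \<gamma> \<noteq> - mat 1 \<longrightarrow> interior F \<inter> mob \<gamma> ` (interior F) = {})"

definition mat_adj :: "complex^'n^'n \<Rightarrow> complex^'n^'n" where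
  "mat_adj A = transpose (\<chi> i j. cnj (A $ i $ j))"

definition unitary_rep :: "(real^2^2) set \<Rightarrow> (real^2^2 \<Rightarrow> complex^'n^'n) \<Rightarrow> bool" where
  "unitary_rep \<Gamma> \<rho> \<longleftrightarrow>
     (\<forall>\<gamma>\<in>\<Gamma>. \<rho> \<gamma> ** mat_adj (\<rho> \<gamma>) = mat 1) \<and>
     (\<forall>\<gamma>\<in>\<Gamma>. \<forall>\<delta>\<in>\<Gamma>. \<rho> (\<gamma> ** \<delta>) = \<rho> \<gamma> ** \<rho> \<delta>) \<and>
     (\<forall>\<gamma>\<in>\<Gamma>. \<rho> (- \<gamma>) = \<rho> \<gamma>)"

definition complex_subspace :: "(complex^'n) set \<Rightarrow> bool" where
  "complex_subspace V \<longleftrightarrow> 0 \<in> V \<and> (\<forall>x\<in>V. \<forall>y\<in>V. x + y \<in> V) \<and> (\<forall>c. \<forall>x\<in>V. c *s x \<in> V)"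

definition irreducible_rep :: "(real^2^2) set \<Rightarrow> (real^2^2 \<Rightarrow> complex^'n^'n) \<Rightarrow> bool" where
  "irreducible_rep \<Gamma> \<rho> \<longleftrightarrow>
     (\<forall>V. complex_subspace V \<and> (\<forall>\<gamma>\<in>\<Gamma>. \<forall>v\<in>V. \<rho> \<gamma> *v v \<in> V) \<longrightarrow> V = {0} \<or> V = UNIV)"

definition harmonic_01 ::
  "(real^2^2) set \<Rightarrow> (real^2^2 \<Rightarrow> complex^'n^'n) \<Rightarrow> (complex \<Rightarrow> complex^'n^'n) \<Rightarrow> bool" where
  "harmonic_01 \<Gamma> \<rho> \<mu> \<longleftrightarrow>
     (\<forall>i j. (\<lambda>z. cnj (\<mu> z $ i $ j)) holomorphic_on upper_half_plane) \<and>
     (\<forall>\<gamma>\<in>\<Gamma>. \<forall>z\<in>upper_half_plane.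
        (\<chi> i j. \<mu> (mob \<gamma> z) $ i $ j * cnj (deriv (mob \<gamma>) z)) = \<rho> \<gamma> ** \<mu> z ** matrix_inv (\<rho> \<gamma>))"

text \<open>phi(gamma) = integral from z0 to gamma z0 of mu dzbar (path independent; straight segment in H).\<close>
definition ES_period :: "(complex \<Rightarrow> complex^'n^'n) \<Rightarrow> complex \<Rightarrow> real^2^2 \<Rightarrow> complex^'n^'n" where
  "ES_period \<mu> z0 \<gamma> =
     (\<chi> i j. cnj (contour_integral (linepath z0 (mob \<gamma> z0)) (\<lambda>z. cnj (\<mu> z $ i $ j))))"

text \<open>dz /\ dzbar = -2 sqrt(-1) dx dy.\<close>
definition NAB_inner :: "complex set \<Rightarrow> (complex \<Rightarrow> complex^'n^'n) \<Rightarrow> (complex \<Rightarrow> complex^'n^'n) \<Rightarrow> complex" where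
  "NAB_inner F \<mu> \<nu> = \<i> * ((- 2 * \<i>) * integral F (\<lambda>z. trace (\<mu> z ** mat_adj (\<nu> z))))"

definition omega_NAB :: "complex set \<Rightarrow> (complex \<Rightarrow> complex^'n^'n) \<Rightarrow> (complex \<Rightarrow> complex^'n^'n) \<Rightarrow> real" where
  "omega_NAB F \<mu> \<nu> = - (1/2) * Im (NAB_inner F \<mu> \<nu>)"

definition goldman_form ::
  "nat \<Rightarrow> (nat \<Rightarrow> real^2^2) \<Rightarrow> (nat \<Rightarrow> real^2^2) \<Rightarrow> (real^2^2 \<Rightarrow> complex^'n^'n)
   \<Rightarrow> (real^2^2 \<Rightarrow> complex^'n^'n) \<Rightarrow> (real^2^2 \<Rightarrow> complex^'n^'n) \<Rightarrow> complex" where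
  "goldman_form g a b \<sigma> \<chi>1 \<chi>2 =
     (\<Sum>k=1..g. trace (\<chi>1 (alpha_gen a b k) ** \<sigma> (Rprod a b (k - 1)) ** \<chi>2 (a k)
                        ** matrix_inv (\<sigma> (Rprod a b (k - 1))))
              - trace (\<chi>1 (beta_gen a b k) ** \<sigma> (Rprod a b k) ** \<chi>2 (b k)
                        ** matrix_inv (\<sigma> (Rprod a b k))))"

definition unitary_cocycle :: "(real^2^2 \<Rightarrow> complex^'n^'n) \<Rightarrow> real^2^2 \<Rightarrow> complex^'n^'n" where
  "unitary_cocycle \<phi> \<gamma> = \<phi> \<gamma> - mat_adj (\<phi> \<gamma>)"

end

theory Submission
  imports Defs
begin

text \<open>
  The form \<open>\<omega> = \<mu> dzbar - \<mu>* dz\<close> is closed, equivariant and has a primitive \<open>\<Phi>\<close> on the upper half plane whose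
  values at the translates of the base point are the cocycle. By Stokes' theorem the integral of
  \<open>tr (\<omega>1 \<and> \<omega>2) = d tr (\<Phi>1 \<omega>2)\<close> over the fundamental polygon is a boundary integral, in which the contributions of two
  paired sides differ by \<open>tr (\<xi>1(\<gamma>) . increment of \<Phi>2)\<close>; their sum is the Goldman form. Moving the base point changes \<open>\<xi>2\<close> by a
  coboundary, whose pairing with a cocycle telescopes to zero.

  The sides of the polygon may fail to be rectifiable, so Stokes' theorem is applied to the closed polygon with the same
  vertices whose edges are translates of straight segments, in the form "integral over the boundary = area integral weighted with
  the winding number", which follows from the Cauchy-Pompeiu formula and Fubini. The winding numbers of the two polygons differ by a sum
  of winding numbers of loops, each occurring twice with opposite signs up to a group element; as the density is
  invariant, the two area integrals agree.
\<close>

text \<open>The straight-edged polygon may cross itself and need not bound a fundamental domain;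
  weighting the area integral with winding numbers is the form of Stokes' theorem that still applies
  to it. The cancellation of paired loops cannot be done term by term: where the derivative of an
  edge is unbounded the edge may spiral, and the winding number of the loop formed with its chord
  need not be integrable. Only the total difference of the two winding numbers is known to be
  integrable. The integrals are therefore cut off near these points by hyperbolic discs, which the
  group maps to discs of the same kind; after substitution one kernel is compared on two cutoff
  regions, and the difference tends to 0. Of the four terms of \<open>tr (\<Phi>1 \<omega>2)\<close>
  one is holomorphic and one antiholomorphic, and both integrate to 0 over the closed polygon; the
  other two are conjugate to each other, and they produce the metric.\<close>

abbreviation (input) UHP (\<open>\<H>\<close>) where "\<H> \<equiv> upper_half_plane"

section \<open>Integrability of the Cauchy kernel over a rectangle\<close>

text \<open>Lebesgue measure is determined by its values on boxes, and a box in the plane is a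
  product of two intervals. This makes Fubini available in real and imaginary parts.\<close>

lemma lborel_complex_eq:
  "(lborel :: complex measure) = distr (lborel \<Otimes>\<^sub>M lborel) borel (\<lambda>(x,y). Complex x y)"
proof (rule lborel_eqI)
  have m [measurable]: "(\<lambda>(x,y). Complex x y) \<in> borel_measurable (lborel \<Otimes>\<^sub>M lborel)"
    unfolding Complex_eq by measurable
  fix l u :: complex
  assume lu: "\<And>b. b \<in> Basis \<Longrightarrow> l \<bullet> b \<le> u \<bullet> b"
  from lu[of 1] lu[of \<i>] have le: "Re l \<le> Re u" "Im l \<le> Im u" by (auto simp: Basis_complex_def)
  have "emeasure (distr (lborel \<Otimes>\<^sub>M lborel) borel (\<lambda>(x,y). Complex x y)) (box l u)
      = emeasure (lborel \<Otimes>\<^sub>M lborel) ({Re l<..<Re u} \<times> {Im l<..<Im u})"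
    by (subst emeasure_distr) (auto simp: space_pair_measure in_box_complex_iff intro!: arg_cong2[where f=emeasure])
  also have "\<dots> = emeasure lborel {Re l<..<Re u} * emeasure lborel {Im l<..<Im u}"
    by (rule lborel.emeasure_pair_measure_Times) auto
  also have "\<dots> = ennreal (\<Prod>b\<in>Basis. (u - l) \<bullet> b)"
    using le by (simp add: Basis_complex_def ennreal_mult)
  finally show "emeasure (distr (lborel \<Otimes>\<^sub>M lborel) borel (\<lambda>(x,y). Complex x y)) (box l u) = ennreal (\<Prod>b\<in>Basis. (u - l) \<bullet> b)" .
qed simp

lemma measurable_Complex [measurable]:
  "(\<lambda>(x,y). Complex x y) \<in> borel_measurable (lborel \<Otimes>\<^sub>M lborel)"
  "(\<lambda>(x,y). Complex x y) \<in> borel_measurable (borel \<Otimes>\<^sub>M borel)"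
  unfolding Complex_eq by measurable

lemma nn_integral_lborel_complex:
  fixes f :: "complex \<Rightarrow> ennreal"
  assumes [measurable]: "f \<in> borel_measurable borel"
  shows "(\<integral>\<^sup>+w. f w \<partial>lborel) = (\<integral>\<^sup>+x. \<integral>\<^sup>+y. f (Complex x y) \<partial>lborel \<partial>lborel)"
proof -
  have "(\<integral>\<^sup>+w. f w \<partial>lborel) = (\<integral>\<^sup>+z. f (case z of (x,y) \<Rightarrow> Complex x y) \<partial>(lborel \<Otimes>\<^sub>M lborel))"
    by (subst lborel_complex_eq, subst nn_integral_distr) auto
  also have "\<dots> = (\<integral>\<^sup>+x. \<integral>\<^sup>+y. f (Complex x y) \<partial>lborel \<partial>lborel)"
    by (subst lborel.nn_integral_fst[symmetric]) auto
  finally show ?thesis .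
qed

text \<open>The singularity has order 1/2, so the primitive \<open>G\<close> stays continuous across
  \<open>a\<close>, and the fundamental theorem tolerates the single exceptional point. Each side of
  \<open>a\<close> contributes at most \<open>2 * sqrt (u - l)\<close>.\<close>

lemma nn_integral_inverse_sqrt_abs:
  fixes a l u :: real
  assumes "l \<le> a" "a \<le> u"
  shows "(\<integral>\<^sup>+x. ennreal (indicator {l..u} x * (1 / sqrt \<bar>x - a\<bar>)) \<partial>lborel) \<le> ennreal (4 * sqrt (u - l))"
proof -
  define G where "G x = 2 * sgn (x - a) * sqrt \<bar>x - a\<bar>" for x
  have Gl: "G x = - 2 * sqrt (a - x)" if "x \<le> a" for x
  proof (cases "x = a")
    case False
    then have "sgn (x - a) = -1" "\<bar>x - a\<bar> = a - x" using that by (auto simp: sgn_if)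
    then show ?thesis unfolding G_def by simp
  qed (simp add: G_def)
  have Gr: "G x = 2 * sqrt (x - a)" if "x \<ge> a" for x
  proof (cases "x = a")
    case False
    then have "sgn (x - a) = 1" "\<bar>x - a\<bar> = x - a" using that by (auto simp: sgn_if)
    then show ?thesis unfolding G_def by simp
  qed (simp add: G_def)
  have "((\<lambda>x. 1 / sqrt \<bar>x - a\<bar>) has_integral (G u - G l)) {l..u}"
  proof (rule fundamental_theorem_of_calculus_interior_strong[where S="{a}" and f=G])
    have "G = (\<lambda>x. if x \<le> a then - 2 * sqrt (a - x) else 2 * sqrt (x - a))"
      using Gl Gr by (intro ext) (metis linear less_eq_real_def not_le)
    moreover have "continuous_on {l..u} (\<lambda>x. if x \<le> a then - 2 * sqrt (a - x) else 2 * sqrt (x - a))"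
      by (rule continuous_on_cases_le) (auto intro!: continuous_intros)
    ultimately show "continuous_on {l..u} G" by simp
    fix x assume x: "x \<in> {l<..<u} - {a}"
    show "(G has_vector_derivative 1 / sqrt \<bar>x - a\<bar>) (at x)"
    proof (cases "x < a")
      case True
      have 1: "((\<lambda>x. a - x) has_real_derivative (-1)) (at x)"
        by (rule DERIV_cong[OF DERIV_diff[OF DERIV_const DERIV_ident]]) simp
      have "a - x > 0" using True by simp
      note 2 = DERIV_cmult[OF DERIV_chain2[OF DERIV_real_sqrt[OF this] 1], of "-2"]
      have "((\<lambda>x. - 2 * sqrt (a - x)) has_real_derivative 1 / sqrt (a - x)) (at x)"
        by (rule DERIV_cong[OF 2]) (simp add: inverse_eq_divide)
      then have "(G has_real_derivative 1 / sqrt (a - x)) (at x)"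
        by (rule has_field_derivative_transform_within_open[where S="{..<a}"]) (use True Gl in auto)
      then show ?thesis using True by (simp add: has_real_derivative_iff_has_vector_derivative)
    next
      case False
      then have F: "x - a > 0" using x by auto
      have 1: "((\<lambda>x. x - a) has_real_derivative 1) (at x)"
        by (rule DERIV_cong[OF DERIV_diff[OF DERIV_ident DERIV_const]]) simp
      note 2 = DERIV_cmult[OF DERIV_chain2[OF DERIV_real_sqrt[OF F] 1], of "2"]
      have "((\<lambda>x. 2 * sqrt (x - a)) has_real_derivative 1 / sqrt (x - a)) (at x)"
        by (rule DERIV_cong[OF 2]) (simp add: inverse_eq_divide)
      then have "(G has_real_derivative 1 / sqrt (x - a)) (at x)"
        by (rule has_field_derivative_transform_within_open[where S="{a<..}"]) (use F Gr in auto)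
      then show ?thesis using F by (simp add: has_real_derivative_iff_has_vector_derivative)
    qed
  qed (use assms in auto)
  then have "(\<integral>\<^sup>+x. ennreal (indicator {l..u} x * (1 / sqrt \<bar>x - a\<bar>)) \<partial>lborel) = ennreal (G u - G l)"
    by (intro nn_integral_has_integral_lebesgue) auto
  also have "G u - G l \<le> 4 * sqrt (u - l)"
  proof -
    have "sqrt (u - a) \<le> sqrt (u - l)" "sqrt (a - l) \<le> sqrt (u - l)" using assms by auto
    moreover have "G u = 2 * sqrt (u - a)" "G l = - 2 * sqrt (a - l)"
      using assms Gl Gr by auto
    ultimately show ?thesis by linarith
  qed
  finally show ?thesis by (simp add: ennreal_leI)
qed

text \<open>By the inequality of arithmetic and geometric means. The planar singularity is thereby
  dominated by a product of two integrable one-dimensional ones.\<close>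

lemma inverse_norm_le_inverse_sqrt_mult:
  fixes x y :: real
  assumes "x \<noteq> 0" "y \<noteq> 0"
  shows "1 / cmod (Complex x y) \<le> 1 / sqrt \<bar>x\<bar> * (1 / sqrt \<bar>y\<bar>)"
proof -
  have "(sqrt \<bar>x\<bar> * sqrt \<bar>y\<bar>)\<^sup>2 \<le> x\<^sup>2 + y\<^sup>2"
  proof -
    have "\<bar>x\<bar> * \<bar>y\<bar> \<le> x\<^sup>2 + y\<^sup>2"
      using sum_squares_bound[of "\<bar>x\<bar>" "\<bar>y\<bar>"] mult_nonneg_nonneg[of "\<bar>x\<bar>" "\<bar>y\<bar>"]
      by (simp add: mult.assoc del: mult_nonneg_nonneg)
    then show ?thesis by (simp add: power_mult_distrib)
  qed
  then have "sqrt \<bar>x\<bar> * sqrt \<bar>y\<bar> \<le> cmod (Complex x y)"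
    by (simp add: complex_norm real_le_rsqrt)
  moreover have "0 < sqrt \<bar>x\<bar> * sqrt \<bar>y\<bar>" using assms by simp
  ultimately have "1 / cmod (Complex x y) \<le> 1 / (sqrt \<bar>x\<bar> * sqrt \<bar>y\<bar>)"
    by (intro divide_left_mono) (auto intro!: mult_pos_pos)
  then show ?thesis by simp
qed

text \<open>The factor 16 is the product of the two one-dimensional constants 4.\<close>

definition cauchy_const :: "complex \<Rightarrow> complex \<Rightarrow> real" where
  "cauchy_const l u = 16 * sqrt (Re u - Re l) * sqrt (Im u - Im l)"

text \<open>The majorant is a product, so Tonelli applies. The bound depends on the rectangle alone;
  this uniformity is what later allows \<open>z\<close> to run along a path.\<close>

lemma nn_integral_inverse_norm_le:
  fixes l u z :: complex
  assumes z: "z \<in> cbox l u"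
  shows "(\<integral>\<^sup>+w. ennreal (indicator (cbox l u) w * (1 / cmod (w - z))) \<partial>lborel) \<le> ennreal (cauchy_const l u)"
proof -
  let ?f = "\<lambda>x. ennreal (indicator {Re l..Re u} x * (1 / sqrt \<bar>x - Re z\<bar>))"
  let ?g = "\<lambda>y. ennreal (indicator {Im l..Im u} y * (1 / sqrt \<bar>y - Im z\<bar>))"
  have le: "Re l \<le> Re z" "Re z \<le> Re u" "Im l \<le> Im z" "Im z \<le> Im u"
    using z by (auto simp: in_cbox_complex_iff)
  have "(\<integral>\<^sup>+w. ennreal (indicator (cbox l u) w * (1 / cmod (w - z))) \<partial>lborel)
    = (\<integral>\<^sup>+x. \<integral>\<^sup>+y. ennreal (indicator (cbox l u) (Complex x y) * (1 / cmod (Complex x y - z))) \<partial>lborel \<partial>lborel)"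
    by (rule nn_integral_lborel_complex) measurable
  also have "\<dots> \<le> (\<integral>\<^sup>+x. \<integral>\<^sup>+y. ?f x * ?g y \<partial>lborel \<partial>lborel)"
  proof (rule nn_integral_mono_AE)
    \<comment> \<open>On the two lines through \<open>z\<close> the majorant is 0, because division
      by 0 gives 0, and the inequality may fail; both lines are null sets.\<close>
    have "AE x in lborel. x \<noteq> Re z" by (rule AE_lborel_singleton)
    then show "AE x in lborel. (\<integral>\<^sup>+y. ennreal (indicator (cbox l u) (Complex x y) * (1 / cmod (Complex x y - z))) \<partial>lborel)
        \<le> (\<integral>\<^sup>+y. ?f x * ?g y \<partial>lborel)"
    proof eventually_elim
      case (elim x)
      show ?case
      proof (rule nn_integral_mono_AE)
        have "AE y in lborel. y \<noteq> Im z" by (rule AE_lborel_singleton)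
        then show "AE y in lborel. ennreal (indicator (cbox l u) (Complex x y) * (1 / cmod (Complex x y - z))) \<le> ?f x * ?g y"
        proof eventually_elim
          case (elim y)
          have "Complex x y - z = Complex (x - Re z) (y - Im z)" by (simp add: complex_eq_iff)
          then have "1 / cmod (Complex x y - z) \<le> 1 / sqrt \<bar>x - Re z\<bar> * (1 / sqrt \<bar>y - Im z\<bar>)"
            using inverse_norm_le_inverse_sqrt_mult[of "x - Re z" "y - Im z"] elim \<open>x \<noteq> Re z\<close> by simp
          then show ?case
            by (auto simp: indicator_def in_cbox_complex_iff ennreal_mult[symmetric] intro!: ennreal_leI)
        qed
      qed
    qed
  qed
  also have "\<dots> = (\<integral>\<^sup>+x. ?f x \<partial>lborel) * (\<integral>\<^sup>+y. ?g y \<partial>lborel)"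
    by (subst nn_integral_cmult, simp, subst nn_integral_multc) auto
  also have "\<dots> \<le> ennreal (4 * sqrt (Re u - Re l)) * ennreal (4 * sqrt (Im u - Im l))"
    by (intro mult_mono nn_integral_inverse_sqrt_abs le) auto
  also have "\<dots> = ennreal (cauchy_const l u)"
    using le by (subst ennreal_mult[symmetric]) (auto simp: cauchy_const_def)
  finally show ?thesis .
qed

section \<open>The Cauchy-Pompeiu formula on a rectangle\<close>

lemma integrable_lborel_complex_iff:
  fixes f :: "complex \<Rightarrow> complex"
  assumes "integrable lborel f"
  shows "integrable (lborel \<Otimes>\<^sub>M lborel) (\<lambda>(x,y). f (Complex x y))"
proof -
  have "integrable (distr (lborel \<Otimes>\<^sub>M lborel) borel (\<lambda>(x,y). Complex x y)) f"
    using assms lborel_complex_eq by metis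
  then have "integrable (lborel \<Otimes>\<^sub>M lborel) (\<lambda>z. f (case z of (x,y) \<Rightarrow> Complex x y))"
    by (rule integrable_distr[rotated]) measurable
  then show ?thesis by (simp add: case_prod_unfold)
qed

lemma integral_lborel_complex:
  fixes f :: "complex \<Rightarrow> complex"
  assumes f: "integrable lborel f"
  shows "(LINT w|lborel. f w) = (LINT x|lborel. LINT y|lborel. f (Complex x y))"
    and "(LINT w|lborel. f w) = (LINT y|lborel. LINT x|lborel. f (Complex x y))"
proof -
  have [measurable]: "f \<in> borel_measurable borel" using f by auto
  note i = integrable_lborel_complex_iff[OF f]
  have "(LINT w|lborel. f w) = (LINT z|(lborel \<Otimes>\<^sub>M lborel). f (case z of (x,y) \<Rightarrow> Complex x y))"
    by (subst lborel_complex_eq, subst integral_distr) auto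
  also have "(\<lambda>z. f (case z of (x,y) \<Rightarrow> Complex x y)) = (\<lambda>(x,y). f (Complex x y))"
    by (simp add: fun_eq_iff)
  finally have eq: "(LINT w|lborel. f w) = (LINT z|(lborel \<Otimes>\<^sub>M lborel). (\<lambda>(x,y). f (Complex x y)) z)" .
  show "(LINT w|lborel. f w) = (LINT x|lborel. LINT y|lborel. f (Complex x y))"
    unfolding eq using lborel_pair.integral_fst'[OF i] by simp
  show "(LINT w|lborel. f w) = (LINT y|lborel. LINT x|lborel. f (Complex x y))"
    unfolding eq using lborel_pair.integral_snd[OF i] by simp
qed

text \<open>The line at height \<open>y0\<close> is the one through the singularity. On every other
  line the inner integral is evaluated by the fundamental theorem, and the exceptional line is null
  for the outer integral.\<close>

lemma iterated_integral_partial_derivative: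
  fixes \<psi> \<psi>' :: "real \<Rightarrow> real \<Rightarrow> complex"
  assumes le: "a \<le> b"
    and meas: "(\<lambda>y. LINT x|lborel. (indicator {a..b} x * indicator {c..d} y) *\<^sub>R \<psi>' x y) \<in> borel_measurable lborel"
    and der: "\<And>x y. x \<in> {a..b} \<Longrightarrow> y \<in> {c..d} \<Longrightarrow> y \<noteq> y0 \<Longrightarrow>
      ((\<lambda>x. \<psi> x y) has_vector_derivative \<psi>' x y) (at x)"
    and cont: "\<And>y. y \<in> {c..d} \<Longrightarrow> y \<noteq> y0 \<Longrightarrow> continuous_on {a..b} (\<lambda>x. \<psi>' x y)"
    and cont_edges: "continuous_on {c..d} (\<lambda>y. \<psi> b y - \<psi> a y)"
  shows "(LINT y|lborel. LINT x|lborel. (indicator {a..b} x * indicator {c..d} y) *\<^sub>R \<psi>' x y)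
       = integral {c..d} (\<lambda>y. \<psi> b y - \<psi> a y)"
proof -
  let ?e = "\<lambda>y. \<psi> b y - \<psi> a y"
  have i: "set_integrable lborel {c..d} ?e"
    by (rule borel_integrable_atLeastAtMost'[OF cont_edges])
  have "(LINT y|lborel. LINT x|lborel. (indicator {a..b} x * indicator {c..d} y) *\<^sub>R \<psi>' x y)
      = (LINT y|lborel. indicator {c..d} y *\<^sub>R ?e y)"
  proof (rule integral_cong_AE)
    show "(\<lambda>y. indicator {c..d} y *\<^sub>R ?e y) \<in> borel_measurable lborel"
      using i unfolding set_integrable_def by auto
    show "AE y in lborel. (LINT x|lborel. (indicator {a..b} x * indicator {c..d} y) *\<^sub>R \<psi>' x y) = indicator {c..d} y *\<^sub>R ?e y"
      using AE_lborel_singleton[of y0]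
    proof eventually_elim
      case (elim y)
      show ?case
      proof (cases "y \<in> {c..d}")
        case True
        then have "(LINT x|lborel. (indicator {a..b} x * indicator {c..d} y) *\<^sub>R \<psi>' x y) = (LINT x|lborel. indicator {a..b} x *\<^sub>R \<psi>' x y)"
          by simp
        also have "\<dots> = ?e y"
          by (rule integral_FTC_atLeastAtMost)
             (use True elim le der cont in \<open>auto intro: has_vector_derivative_at_within\<close>)
        finally show ?thesis using True by simp
      qed simp
    qed
  qed (rule meas)
  also have "\<dots> = integral {c..d} ?e"
    using set_borel_integral_eq_integral(2)[OF i] by (simp add: set_lebesgue_integral_def)
  finally show ?thesis .
qed

lemma integral_box_partial_Re:
  fixes \<psi> \<psi>' :: "complex \<Rightarrow> complex"
  assumes le: "Re l \<le> Re u" and int: "integrable lborel (\<lambda>w. indicator (cbox l u) w *\<^sub>R \<psi>' w)"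
    and der: "\<And>x y. x \<in> {Re l..Re u} \<Longrightarrow> y \<in> {Im l..Im u} \<Longrightarrow> y \<noteq> y0 \<Longrightarrow>
      ((\<lambda>x. \<psi> (Complex x y)) has_vector_derivative \<psi>' (Complex x y)) (at x)"
    and cont: "\<And>y. y \<in> {Im l..Im u} \<Longrightarrow> y \<noteq> y0 \<Longrightarrow> continuous_on {Re l..Re u} (\<lambda>x. \<psi>' (Complex x y))"
    and edges: "continuous_on {Im l..Im u} (\<lambda>y. \<psi> (Complex (Re u) y) - \<psi> (Complex (Re l) y))"
  shows "(LINT w|lborel. indicator (cbox l u) w *\<^sub>R \<psi>' w)
       = integral {Im l..Im u} (\<lambda>y. \<psi> (Complex (Re u) y) - \<psi> (Complex (Re l) y))"
proof -
  have eq: "indicator (cbox l u) (Complex x y) = (indicator {Re l..Re u} x * indicator {Im l..Im u} y :: real)" for x y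
    by (auto simp: indicator_def in_cbox_complex_iff)
  show ?thesis
    unfolding integral_lborel_complex(2)[OF int] eq
    using lborel_pair.integrable_snd[OF integrable_lborel_complex_iff[OF int]]
    by (intro iterated_integral_partial_derivative[where ?y0.0=y0] le der cont edges) (auto simp: eq)
qed

lemma integral_box_partial_Im:
  fixes \<psi> \<psi>' :: "complex \<Rightarrow> complex"
  assumes le: "Im l \<le> Im u" and int: "integrable lborel (\<lambda>w. indicator (cbox l u) w *\<^sub>R \<psi>' w)"
    and der: "\<And>x y. x \<in> {Re l..Re u} \<Longrightarrow> y \<in> {Im l..Im u} \<Longrightarrow> x \<noteq> x0 \<Longrightarrow>
      ((\<lambda>y. \<psi> (Complex x y)) has_vector_derivative \<psi>' (Complex x y)) (at y)"
    and cont: "\<And>x. x \<in> {Re l..Re u} \<Longrightarrow> x \<noteq> x0 \<Longrightarrow> continuous_on {Im l..Im u} (\<lambda>y. \<psi>' (Complex x y))"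
    and edges: "continuous_on {Re l..Re u} (\<lambda>x. \<psi> (Complex x (Im u)) - \<psi> (Complex x (Im l)))"
  shows "(LINT w|lborel. indicator (cbox l u) w *\<^sub>R \<psi>' w)
       = integral {Re l..Re u} (\<lambda>x. \<psi> (Complex x (Im u)) - \<psi> (Complex x (Im l)))"
proof -
  have eq: "indicator (cbox l u) (Complex x y) = (indicator {Im l..Im u} y * indicator {Re l..Re u} x :: real)" for x y
    by (auto simp: indicator_def in_cbox_complex_iff)
  show ?thesis
    unfolding integral_lborel_complex(1)[OF int] eq
    using lborel_pair.integrable_fst[OF integrable_lborel_complex_iff[OF int]]
    by (intro iterated_integral_partial_derivative[where \<psi>="\<lambda>y x. \<psi> (Complex x y)" and \<psi>'="\<lambda>y x. \<psi>' (Complex x y)" and ?y0.0=x0] le der cont edges) (auto simp: eq)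
qed

text \<open>Multiplication by \<open>\<i>\<close> turns a horizontal segment at height
  \<open>c\<close> into a vertical one with real part \<open>-c\<close>, which reduces the claim to
  the vertical case.\<close>

lemma contour_integral_linepath_same_Im:
  assumes "Im z = c" "Im z' = c" "Re z = a" "Re z' = b" "a < b"
  shows "contour_integral (linepath z z') f = integral {a..b} (\<lambda>x. f (Complex x c))"
proof -
  have "(\<lambda>w. \<i> * w) \<circ> linepath z z' = linepath (\<i> * z) (\<i> * z')"
    by (auto simp: fun_eq_iff linepath_def scaleR_conv_of_real algebra_simps)
  then have "contour_integral (linepath (\<i> * z) (\<i> * z')) (\<lambda>w. f (w / \<i>) / \<i>)
      = contour_integral (linepath z z') (\<lambda>w. deriv (\<lambda>w. \<i> * w) w * (f (\<i> * w / \<i>) / \<i>))"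
    using contour_integral_comp_analyticW[of "\<lambda>w. \<i> * w" UNIV "linepath z z'" "\<lambda>w. f (w / \<i>) / \<i>"]
    by (simp add: analytic_intros)
  also have "\<dots> = contour_integral (linepath z z') f"
    by (simp add: field_simps)
  also have "contour_integral (linepath (\<i> * z) (\<i> * z')) (\<lambda>w. f (w / \<i>) / \<i>)
     = \<i> * integral {a..b} (\<lambda>x. f (Complex (-c) x / \<i>) / \<i>)"
    using assms by (intro contour_integral_linepath_same_Re) auto
  also have "(\<lambda>x. f (Complex (-c) x / \<i>) / \<i>) = (\<lambda>x. f (Complex x c) / \<i>)"
  proof -
    have "Complex (-c) x / \<i> = Complex x c" for x by (simp add: complex_eq_iff)
    then show ?thesis by simp
  qed
  finally show ?thesis by simp
qed

lemma contour_integral_rectpath: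
  fixes f :: "complex \<Rightarrow> complex"
  assumes "Re l < Re u" "Im l < Im u" and f: "continuous_on (path_image (rectpath l u)) f"
  shows "f contour_integrable_on rectpath l u"
    and "contour_integral (rectpath l u) f =
       contour_integral (linepath l (Complex (Re u) (Im l))) f + contour_integral (linepath (Complex (Re u) (Im l)) u) f
     + contour_integral (linepath u (Complex (Re l) (Im u))) f + contour_integral (linepath (Complex (Re l) (Im u)) l) f"
    and "contour_integral (rectpath l u) f =
     integral {Re l..Re u} (\<lambda>x. f (Complex x (Im l))) + \<i> * integral {Im l..Im u} (\<lambda>y. f (Complex (Re u) y))
     - integral {Re l..Re u} (\<lambda>x. f (Complex x (Im u))) - \<i> * integral {Im l..Im u} (\<lambda>y. f (Complex (Re l) y))"
proof -
  define a2 a4 where "a2 = Complex (Re u) (Im l)" and "a4 = Complex (Re l) (Im u)"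
  have pi: "path_image (rectpath l u) = closed_segment l a2 \<union> closed_segment a2 u \<union> closed_segment u a4 \<union> closed_segment a4 l"
    by (simp add: rectpath_def Let_def path_image_join a2_def a4_def Un_assoc)
  have c: "f contour_integrable_on linepath l a2" "f contour_integrable_on linepath a2 u"
     "f contour_integrable_on linepath u a4" "f contour_integrable_on linepath a4 l"
    by (auto intro!: contour_integrable_continuous_linepath continuous_on_subset[OF f] simp: pi)
  show "f contour_integrable_on rectpath l u"
    unfolding rectpath_def Let_def a2_def[symmetric] a4_def[symmetric]
    using c by (simp add: a2_def a4_def)
  have "contour_integral (rectpath l u) f = contour_integral (linepath l a2) f + contour_integral (linepath a2 u) f
     + contour_integral (linepath u a4) f + contour_integral (linepath a4 l) f"
    unfolding rectpath_def Let_def a2_def[symmetric] a4_def[symmetric]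
    using c by (simp add: a2_def a4_def)
  then show "contour_integral (rectpath l u) f =
       contour_integral (linepath l (Complex (Re u) (Im l))) f + contour_integral (linepath (Complex (Re u) (Im l)) u) f
     + contour_integral (linepath u (Complex (Re l) (Im u))) f + contour_integral (linepath (Complex (Re l) (Im u)) l) f"
    by (simp add: a2_def a4_def)
  note \<open>contour_integral (rectpath l u) f = contour_integral (linepath l a2) f + contour_integral (linepath a2 u) f
     + contour_integral (linepath u a4) f + contour_integral (linepath a4 l) f\<close>
  also have "contour_integral (linepath u a4) f = - contour_integral (linepath a4 u) f"
    using contour_integral_reverse_linepath[of a4 u f] continuous_on_subset[OF f, of "closed_segment a4 u"] by (simp add: pi closed_segment_commute le_supI1 le_supI2)
  also have "contour_integral (linepath a4 l) f = - contour_integral (linepath l a4) f"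
    using contour_integral_reverse_linepath[of l a4 f] continuous_on_subset[OF f, of "closed_segment l a4"] by (simp add: pi closed_segment_commute le_supI1 le_supI2)
  also have "contour_integral (linepath l a2) f = integral {Re l..Re u} (\<lambda>x. f (Complex x (Im l)))"
    by (rule contour_integral_linepath_same_Im) (use assms in \<open>auto simp: a2_def\<close>)
  also have "contour_integral (linepath a4 u) f = integral {Re l..Re u} (\<lambda>x. f (Complex x (Im u)))"
    by (rule contour_integral_linepath_same_Im) (use assms in \<open>auto simp: a4_def\<close>)
  also have "contour_integral (linepath a2 u) f = \<i> * integral {Im l..Im u} (\<lambda>y. f (Complex (Re u) y))"
    by (rule contour_integral_linepath_same_Re) (use assms in \<open>auto simp: a2_def\<close>)
  also have "contour_integral (linepath l a4) f = \<i> * integral {Im l..Im u} (\<lambda>y. f (Complex (Re l) y))"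
    by (rule contour_integral_linepath_same_Re) (use assms in \<open>auto simp: a4_def\<close>)
  finally show "contour_integral (rectpath l u) f =
     integral {Re l..Re u} (\<lambda>x. f (Complex x (Im l))) + \<i> * integral {Im l..Im u} (\<lambda>y. f (Complex (Re u) y))
     - integral {Re l..Re u} (\<lambda>x. f (Complex x (Im u))) - \<i> * integral {Im l..Im u} (\<lambda>y. f (Complex (Re l) y))"
    by simp
qed

text \<open>Subtracting \<open>P z\<close> makes the partial derivatives of the quotient \<open>(P w - P z) / (w - z)\<close> of order \<open>1 / |w - z|\<close>,
  hence integrable: Fubini applies on the whole rectangle and no disc around z has to be excised.\<close>

lemma cauchy_pompeiu_rectangle:
  fixes P Px Py :: "complex \<Rightarrow> complex"
  assumes S: "open S" "cbox l u \<subseteq> S" and z: "z \<in> box l u"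
    and der: "\<And>w. w \<in> S \<Longrightarrow> (P has_derivative (\<lambda>h. Re h *\<^sub>R Px w + Im h *\<^sub>R Py w)) (at w)"
    and Px: "continuous_on S Px" and Py: "continuous_on S Py"
  shows "integrable lborel (\<lambda>w. indicator (cbox l u) w *\<^sub>R ((Px w + \<i> * Py w) / (w - z)))"
    and "(LINT w|lborel. indicator (cbox l u) w *\<^sub>R ((Px w + \<i> * Py w) / (w - z)))
       = contour_integral (rectpath l u) (\<lambda>w. P w / (w - z)) / \<i> - 2 * pi * P z"
proof -
  have lt: "Re l < Re z" "Re z < Re u" "Im l < Im z" "Im z < Im u"
    using z by (auto simp: in_box_complex_iff)
  have zD: "z \<in> cbox l u" using z box_subset_cbox by blast
  have cP: "continuous_on S P"
    by (meson der continuous_at_imp_continuous_on has_derivative_continuous)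
  have "compact (Px ` cbox l u)" "compact (Py ` cbox l u)"
    using Px Py S(2) by (auto intro!: compact_continuous_image intro: continuous_on_subset)
  then obtain C1 C2 where C1: "\<And>w. w \<in> cbox l u \<Longrightarrow> norm (Px w) \<le> C1" and C2: "\<And>w. w \<in> cbox l u \<Longrightarrow> norm (Py w) \<le> C2"
    by (metis compact_imp_bounded bounded_iff imageI)
  define C where "C = C1 + C2"
  have C0: "C1 \<ge> 0" "C2 \<ge> 0" using C1[OF zD] C2[OF zD] norm_ge_zero order_trans by blast+
  \<comment> \<open>The mean value inequality on the convex rectangle controls the squared
    denominators: \<open>(P w - P z) / (w - z)\<^sup>2\<close> has norm at most
    \<open>C / cmod (w - z)\<close>.\<close>
  have Lip: "norm (P w - P z) \<le> C * norm (w - z)" if "w \<in> cbox l u" for w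
  proof (rule differentiable_bound[OF _ _ _ that zD, where f' = "\<lambda>w h. Re h *\<^sub>R Px w + Im h *\<^sub>R Py w"])
    show "(P has_derivative (\<lambda>h. Re h *\<^sub>R Px x + Im h *\<^sub>R Py x)) (at x within cbox l u)" if "x \<in> cbox l u" for x
      using der that S(2) by (blast intro: has_derivative_at_withinI)
    show "onorm (\<lambda>h. Re h *\<^sub>R Px x + Im h *\<^sub>R Py x) \<le> C" if x: "x \<in> cbox l u" for x
    proof (rule onorm_le)
      fix h
      have "norm (Re h *\<^sub>R Px x + Im h *\<^sub>R Py x) \<le> \<bar>Re h\<bar> * norm (Px x) + \<bar>Im h\<bar> * norm (Py x)"
        by (metis norm_scaleR norm_triangle_ineq)
      also have "\<dots> \<le> norm h * C1 + norm h * C2"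
        using C1[OF x] C2[OF x] by (intro add_mono mult_mono abs_Re_le_cmod abs_Im_le_cmod) auto
      finally show "norm (Re h *\<^sub>R Px x + Im h *\<^sub>R Py x) \<le> C * norm h" by (simp add: C_def algebra_simps)
    qed
  qed simp
  define \<psi> where "\<psi> w = (P w - P z) / (w - z)" for w
  define \<psi>x where "\<psi>x w = Px w / (w - z) - (P w - P z) / (w - z)\<^sup>2" for w
  define \<psi>y where "\<psi>y w = Py w / (w - z) - \<i> * (P w - P z) / (w - z)\<^sup>2" for w
  have c: "continuous_on (cbox l u - {z}) \<psi>x" "continuous_on (cbox l u - {z}) \<psi>y" "continuous_on (cbox l u - {z}) \<psi>"
    unfolding \<psi>_def \<psi>x_def \<psi>y_def using S(2)
    by (auto intro!: continuous_intros continuous_on_subset[OF cP] continuous_on_subset[OF Px] continuous_on_subset[OF Py])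
  have kint: "integrable lborel (\<lambda>w. 2 * C * (indicator (cbox l u) w * (1 / cmod (w - z))))"
  proof (intro integrable_mult_right integrableI_bounded)
    have "(\<integral>\<^sup>+w. ennreal (norm (indicator (cbox l u) w * (1 / cmod (w - z)))) \<partial>lborel)
        = (\<integral>\<^sup>+w. ennreal (indicator (cbox l u) w * (1 / cmod (w - z))) \<partial>lborel)"
      by (simp add: abs_mult)
    also have "\<dots> < \<infinity>"
      by (rule le_less_trans[OF nn_integral_inverse_norm_le[OF zD]]) simp
    finally show "(\<integral>\<^sup>+w. ennreal (norm (indicator (cbox l u) w * (1 / cmod (w - z)))) \<partial>lborel) < \<infinity>" .
  qed measurable
  \<comment> \<open>The condition \<open>k z = 0\<close> is met by both partial derivatives because
    division by 0 gives 0; it makes the rectangle and the punctured rectangle carry the same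
    integrand.\<close>
  have intg: "integrable lborel (\<lambda>w. indicator (cbox l u) w *\<^sub>R k w)"
    if "continuous_on (cbox l u - {z}) k" "k z = 0" "\<And>w. w \<in> cbox l u - {z} \<Longrightarrow> norm (k w) \<le> 2 * C / cmod (w - z)" for k :: "complex \<Rightarrow> complex"
  proof (rule Bochner_Integration.integrable_bound[OF kint])
    have "(\<lambda>w. indicator (cbox l u) w *\<^sub>R k w) = (\<lambda>w. indicator (cbox l u - {z}) w *\<^sub>R k w)"
      using that(2) by (auto simp: fun_eq_iff indicator_def)
    moreover have "(\<lambda>w. indicator (cbox l u - {z}) w *\<^sub>R k w) \<in> borel_measurable borel"
      by (rule borel_measurable_continuous_on_indicator[OF _ that(1)]) auto
    ultimately show "(\<lambda>w. indicator (cbox l u) w *\<^sub>R k w) \<in> borel_measurable lborel" by simp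
    show "AE w in lborel. norm (indicator (cbox l u) w *\<^sub>R k w) \<le> norm (2 * C * (indicator (cbox l u) w * (1 / cmod (w - z))))"
    proof (rule AE_I2)
      fix w
      show "norm (indicator (cbox l u) w *\<^sub>R k w) \<le> norm (2 * C * (indicator (cbox l u) w * (1 / cmod (w - z))))"
      proof (cases "w \<in> cbox l u - {z}")
        case True
        then show ?thesis using that(3)[OF True] C0 by (simp add: C_def abs_mult)
      qed (auto simp: that(2))
    qed
  qed
  have bnd: "cmod (k w / (w - z) - \<zeta> * (P w - P z) / (w - z)\<^sup>2) \<le> 2 * C / cmod (w - z)"
    if "w \<in> cbox l u - {z}" "cmod (k w) \<le> C" "cmod \<zeta> = 1" for k w \<zeta>
  proof -
    have "cmod (k w / (w - z) - \<zeta> * (P w - P z) / (w - z)\<^sup>2) \<le> cmod (k w / (w - z)) + cmod (\<zeta> * (P w - P z) / (w - z)\<^sup>2)"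
      by (rule norm_triangle_ineq4)
    also have "\<dots> \<le> C / cmod (w - z) + C / cmod (w - z)"
    proof (rule add_mono)
      show "cmod (k w / (w - z)) \<le> C / cmod (w - z)"
        using that by (simp add: norm_divide divide_right_mono)
      have "cmod (\<zeta> * (P w - P z) / (w - z)\<^sup>2) = cmod (P w - P z) / (cmod (w - z))\<^sup>2"
        using that by (simp add: norm_divide norm_mult norm_power)
      also have "\<dots> \<le> C * cmod (w - z) / (cmod (w - z))\<^sup>2"
        using Lip[of w] that by (intro divide_right_mono) auto
      also have "\<dots> = C / cmod (w - z)" using that by (simp add: power2_eq_square)
      finally show "cmod (\<zeta> * (P w - P z) / (w - z)\<^sup>2) \<le> C / cmod (w - z)" .
    qed
    finally show ?thesis by simp
  qed
  have ix: "integrable lborel (\<lambda>w. indicator (cbox l u) w *\<^sub>R \<psi>x w)"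
  proof (rule intg[OF c(1)])
    show "norm (\<psi>x w) \<le> 2 * C / cmod (w - z)" if "w \<in> cbox l u - {z}" for w
      using bnd[OF that, of Px 1] C1[of w] that C0 by (simp add: \<psi>x_def C_def)
  qed (simp add: \<psi>x_def)
  have iy: "integrable lborel (\<lambda>w. indicator (cbox l u) w *\<^sub>R \<psi>y w)"
  proof (rule intg[OF c(2)])
    show "norm (\<psi>y w) \<le> 2 * C / cmod (w - z)" if "w \<in> cbox l u - {z}" for w
      using bnd[OF that, of Py \<i>] C2[of w] that C0 by (simp add: \<psi>y_def C_def)
  qed (simp add: \<psi>y_def)
  have iy': "integrable lborel (\<lambda>w. \<i> * (indicator (cbox l u) w *\<^sub>R \<psi>y w))"
    using iy by (rule integrable_mult_right)
  \<comment> \<open>The squared terms cancel since \<open>1 + \<i> * \<i> = 0\<close>: the factor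
    \<open>1 / (w - z)\<close> is holomorphic, so this combination of partial derivatives acts on
    \<open>P\<close> only.\<close>
  have sum_eq: "indicator (cbox l u) w *\<^sub>R ((Px w + \<i> * Py w) / (w - z))
      = indicator (cbox l u) w *\<^sub>R \<psi>x w + \<i> * (indicator (cbox l u) w *\<^sub>R \<psi>y w)" for w
    by (simp add: \<psi>x_def \<psi>y_def add_divide_distrib diff_divide_distrib algebra_simps)
  show int: "integrable lborel (\<lambda>w. indicator (cbox l u) w *\<^sub>R ((Px w + \<i> * Py w) / (w - z)))"
    unfolding sum_eq using ix iy' by (rule Bochner_Integration.integrable_add)
  have alg: "((x * px + y * py) * d - q * (x + \<i> * y)) / (d * d) = x * (px / d - q / d\<^sup>2) + y * (py / d - \<i> * q / d\<^sup>2)"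
    if "d \<noteq> 0" for d x px y py q :: complex
    using that by (simp add: field_simps power2_eq_square)
  have dpsi: "(\<psi> has_derivative (\<lambda>h. Re h *\<^sub>R \<psi>x w + Im h *\<^sub>R \<psi>y w)) (at w)" if "w \<in> S" "w \<noteq> z" for w
  proof -
    have "(\<psi> has_derivative (\<lambda>h. ((Re h *\<^sub>R Px w + Im h *\<^sub>R Py w) * (w - z) - (P w - P z) * h) / ((w - z) * (w - z)))) (at w)"
      unfolding \<psi>_def using that
      by (auto intro!: derivative_eq_intros der[OF that(1)])
    moreover have "(\<lambda>h. ((Re h *\<^sub>R Px w + Im h *\<^sub>R Py w) * (w - z) - (P w - P z) * h) / ((w - z) * (w - z)))
        = (\<lambda>h. Re h *\<^sub>R \<psi>x w + Im h *\<^sub>R \<psi>y w)"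
    proof
      fix h
      have h: "h = of_real (Re h) + \<i> * of_real (Im h)" by (simp add: complex_eq)
      show "((Re h *\<^sub>R Px w + Im h *\<^sub>R Py w) * (w - z) - (P w - P z) * h) / ((w - z) * (w - z))
          = Re h *\<^sub>R \<psi>x w + Im h *\<^sub>R \<psi>y w"
        unfolding \<psi>x_def \<psi>y_def using that(2)
        using alg[of "w - z" "of_real (Re h)" "Px w" "of_real (Im h)" "Py w" "P w - P z"] h
        by (simp add: scaleR_conv_of_real)
    qed
    ultimately show ?thesis by simp
  qed
  have edge: "continuous_on A (\<lambda>y. \<psi> (Complex x y))" if "\<And>y. y \<in> A \<Longrightarrow> Complex x y \<in> cbox l u - {z}" for x A
    by (rule continuous_on_compose2[OF c(3)]) (use that in \<open>auto simp: Complex_eq intro!: continuous_intros\<close>)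
  have edge': "continuous_on A (\<lambda>x. \<psi> (Complex x y))" if "\<And>x. x \<in> A \<Longrightarrow> Complex x y \<in> cbox l u - {z}" for y A
    by (rule continuous_on_compose2[OF c(3)]) (use that in \<open>auto simp: Complex_eq intro!: continuous_intros\<close>)
  have X: "(LINT w|lborel. indicator (cbox l u) w *\<^sub>R \<psi>x w)
       = integral {Im l..Im u} (\<lambda>y. \<psi> (Complex (Re u) y) - \<psi> (Complex (Re l) y))"
  proof (rule integral_box_partial_Re[OF _ ix, where ?y0.0="Im z"])
    fix x y assume xy: "x \<in> {Re l..Re u}" "y \<in> {Im l..Im u}" "y \<noteq> Im z"
    then have w: "Complex x y \<in> S" "Complex x y \<noteq> z" using S(2) by (auto simp: in_cbox_complex_iff subset_iff)
    have "((\<lambda>x. Complex x y) has_derivative (\<lambda>h. of_real h)) (at x)"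
      unfolding Complex_eq by (auto intro!: derivative_eq_intros)
    from has_derivative_compose[OF this dpsi[OF w]]
    show "((\<lambda>x. \<psi> (Complex x y)) has_vector_derivative \<psi>x (Complex x y)) (at x)"
      by (simp add: has_vector_derivative_def)
  next
    fix y assume "y \<in> {Im l..Im u}" "y \<noteq> Im z"
    then show "continuous_on {Re l..Re u} (\<lambda>x. \<psi>x (Complex x y))"
      by (intro continuous_on_compose2[OF c(1)]) (auto simp: Complex_eq in_cbox_complex_iff intro!: continuous_intros)
  qed (use lt in \<open>auto intro!: continuous_intros edge simp: in_cbox_complex_iff\<close>)
  have Y: "(LINT w|lborel. indicator (cbox l u) w *\<^sub>R \<psi>y w)
       = integral {Re l..Re u} (\<lambda>x. \<psi> (Complex x (Im u)) - \<psi> (Complex x (Im l)))"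
  proof (rule integral_box_partial_Im[OF _ iy, where ?x0.0="Re z"])
    fix x y assume xy: "x \<in> {Re l..Re u}" "y \<in> {Im l..Im u}" "x \<noteq> Re z"
    then have w: "Complex x y \<in> S" "Complex x y \<noteq> z" using S(2) by (auto simp: in_cbox_complex_iff subset_iff)
    have "((\<lambda>y. Complex x y) has_derivative (\<lambda>h. \<i> * of_real h)) (at y)"
      unfolding Complex_eq by (auto intro!: derivative_eq_intros)
    from has_derivative_compose[OF this dpsi[OF w]]
    show "((\<lambda>y. \<psi> (Complex x y)) has_vector_derivative \<psi>y (Complex x y)) (at y)"
      by (simp add: has_vector_derivative_def)
  next
    fix x assume "x \<in> {Re l..Re u}" "x \<noteq> Re z"
    then show "continuous_on {Im l..Im u} (\<lambda>y. \<psi>y (Complex x y))"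
      by (intro continuous_on_compose2[OF c(2)]) (auto simp: Complex_eq in_cbox_complex_iff intro!: continuous_intros)
  qed (use lt in \<open>auto intro!: continuous_intros edge' simp: in_cbox_complex_iff\<close>)
  have pim: "path_image (rectpath l u) \<subseteq> cbox l u - {z}"
    using lt z path_image_rectpath_subset_cbox[of l u] path_image_rectpath_inter_box[of l u] by auto
  have i: "(\<lambda>y. \<psi> (Complex (Re u) y)) integrable_on {Im l..Im u}" "(\<lambda>y. \<psi> (Complex (Re l) y)) integrable_on {Im l..Im u}"
    "(\<lambda>x. \<psi> (Complex x (Im u))) integrable_on {Re l..Re u}" "(\<lambda>x. \<psi> (Complex x (Im l))) integrable_on {Re l..Re u}"
    using lt by (auto intro!: integrable_continuous_interval edge edge' simp: in_cbox_complex_iff)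
  have "(LINT w|lborel. indicator (cbox l u) w *\<^sub>R ((Px w + \<i> * Py w) / (w - z)))
      = (LINT w|lborel. indicator (cbox l u) w *\<^sub>R \<psi>x w) + \<i> * (LINT w|lborel. indicator (cbox l u) w *\<^sub>R \<psi>y w)"
    unfolding sum_eq Bochner_Integration.integral_add[OF ix iy'] by (simp only: integral_mult_right_zero)
  also have "\<dots> = contour_integral (rectpath l u) \<psi> / \<i>"
    unfolding X Y
    by (subst contour_integral_rectpath(3))
       (use lt pim c(3) i in \<open>auto simp: Henstock_Kurzweil_Integration.integral_diff field_simps intro: continuous_on_subset\<close>)
  \<comment> \<open>The subtracted constant \<open>P z\<close> is integrated against
    \<open>1 / (w - z)\<close>, and the rectangle has winding number 1 about
    \<open>z\<close>.\<close>
  also have "contour_integral (rectpath l u) \<psi> = contour_integral (rectpath l u) (\<lambda>w. P w / (w - z)) - 2 * pi * \<i> * P z"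
  proof -
    have zn: "z \<notin> path_image (rectpath l u)" using pim by auto
    have "((\<lambda>w. 1 / (w - z)) has_contour_integral 2 * pi * \<i> * winding_number (rectpath l u) z) (rectpath l u)"
      by (rule has_contour_integral_winding_number) (use zn in auto)
    moreover have "winding_number (rectpath l u) z = 1" by (rule winding_number_rectpath[OF z])
    ultimately have "((\<lambda>w. P z * (1 / (w - z))) has_contour_integral P z * (2 * pi * \<i>)) (rectpath l u)"
      by (intro has_contour_integral_lmul) auto
    moreover have "continuous_on (path_image (rectpath l u)) (\<lambda>w. P w / (w - z))"
      using pim zn S(2) by (auto intro!: continuous_intros continuous_on_subset[OF cP])
    then have "(\<lambda>w. P w / (w - z)) contour_integrable_on rectpath l u"
      using lt by (intro contour_integral_rectpath(1)) auto
    ultimately have "((\<lambda>w. P w / (w - z) - P z * (1 / (w - z))) has_contour_integral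
       (contour_integral (rectpath l u) (\<lambda>w. P w / (w - z)) - P z * (2 * pi * \<i>))) (rectpath l u)"
      by (intro has_contour_integral_diff has_contour_integral_integral)
    then have "(\<psi> has_contour_integral
       (contour_integral (rectpath l u) (\<lambda>w. P w / (w - z)) - P z * (2 * pi * \<i>))) (rectpath l u)"
      by (simp add: \<psi>_def[abs_def] diff_divide_distrib)
    then show ?thesis by (simp add: contour_integral_unique mult_ac)
  qed
  finally show "(LINT w|lborel. indicator (cbox l u) w *\<^sub>R ((Px w + \<i> * Py w) / (w - z)))
       = contour_integral (rectpath l u) (\<lambda>w. P w / (w - z)) / \<i> - 2 * pi * P z"
    by (simp add: algebra_simps)
qed

section \<open>Green's formula with winding numbers\<close>

text \<open>\<open>P\<close> is only continuous; holomorphy comes from the kernel, which can be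
  differentiated in \<open>z\<close> under the integral.\<close>

lemma holomorphic_on_Cauchy_integral_linepath:
  assumes P: "continuous_on (closed_segment a b) P"
  shows "(\<lambda>z. contour_integral (linepath a b) (\<lambda>w. P w / (w - z))) holomorphic_on - closed_segment a b"
proof -
  have i: "((\<lambda>w. P w / (w - z)^1) has_contour_integral contour_integral (linepath a b) (\<lambda>w. P w / (w - z))) (linepath a b)"
    if "z \<in> - path_image (linepath a b) - path_image (linepath a b)" for z
    using that by (auto intro!: has_contour_integral_integral contour_integrable_continuous_linepath continuous_intros P)
  have o: "open (- path_image (linepath a b))" by (simp add: open_Compl closed_segment)
  show ?thesis
  proof (rule holomorphic_onI)
    fix z assume "z \<in> - closed_segment a b"
    then have z: "z \<in> - path_image (linepath a b) - path_image (linepath a b)" by auto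
    have "((\<lambda>z. contour_integral (linepath a b) (\<lambda>w. P w / (w - z))) has_field_derivative
       (of_nat 1 * contour_integral (linepath a b) (\<lambda>w. P w / (w - z)^Suc 1))) (at z)"
      by (rule Cauchy_next_derivative(2)[OF _ _ i _ o _ z, where B="norm (b - a)"]) (use P in auto)
    then show "(\<lambda>z. contour_integral (linepath a b) (\<lambda>w. P w / (w - z))) field_differentiable at z within - closed_segment a b"
      using field_differentiable_at_within field_differentiable_def by blast
  qed
qed

text \<open>This function is the boundary term of the Cauchy-Pompeiu formula. Being holomorphic in
  the open rectangle, it will integrate to zero along closed polygons there.\<close>

lemma holomorphic_on_Cauchy_integral_rectpath:
  assumes lu: "Re l < Re u" "Im l < Im u" and P: "continuous_on (path_image (rectpath l u)) P"
  shows "(\<lambda>z. contour_integral (rectpath l u) (\<lambda>w. P w / (w - z))) holomorphic_on box l u"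
proof -
  define a2 a4 where "a2 = Complex (Re u) (Im l)" and "a4 = Complex (Re l) (Im u)"
  have pi: "path_image (rectpath l u) = closed_segment l a2 \<union> closed_segment a2 u \<union> closed_segment u a4 \<union> closed_segment a4 l"
    by (simp add: rectpath_def Let_def path_image_join a2_def a4_def Un_assoc)
  have d: "box l u \<inter> path_image (rectpath l u) = {}"
    using path_image_rectpath_inter_box[of l u] lu by auto
  have h: "(\<lambda>z. contour_integral (linepath p q) (\<lambda>w. P w / (w - z))) holomorphic_on box l u"
    if "closed_segment p q \<subseteq> path_image (rectpath l u)" for p q
    by (rule holomorphic_on_subset[OF holomorphic_on_Cauchy_integral_linepath])
       (use that d in \<open>auto intro: continuous_on_subset[OF P]\<close>)
  have "(\<lambda>z. contour_integral (linepath l a2) (\<lambda>w. P w / (w - z)) + contour_integral (linepath a2 u) (\<lambda>w. P w / (w - z))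
    + contour_integral (linepath u a4) (\<lambda>w. P w / (w - z)) + contour_integral (linepath a4 l) (\<lambda>w. P w / (w - z))) holomorphic_on box l u"
    by (intro holomorphic_intros h) (auto simp: pi)
  then show ?thesis
  proof (rule holomorphic_transform)
    fix z assume "z \<in> box l u"
    then have "continuous_on (path_image (rectpath l u)) (\<lambda>w. P w / (w - z))"
      using d by (auto intro!: continuous_intros P)
    from contour_integral_rectpath(2)[OF lu this]
    show "contour_integral (linepath l a2) (\<lambda>w. P w / (w - z)) + contour_integral (linepath a2 u) (\<lambda>w. P w / (w - z))
    + contour_integral (linepath u a4) (\<lambda>w. P w / (w - z)) + contour_integral (linepath a4 l) (\<lambda>w. P w / (w - z))
     = contour_integral (rectpath l u) (\<lambda>w. P w / (w - z))"
      by (simp add: a2_def a4_def)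
  qed
qed

text \<open>Off finitely many parameters the path is differentiable, and a differentiable image of a
  one-dimensional set in the plane is negligible; no bound on the derivative enters.\<close>

lemma null_sets_valid_path_image:
  fixes c :: "real \<Rightarrow> complex"
  assumes "valid_path c"
  shows "path_image c \<in> null_sets lborel"
proof -
  obtain S where S: "finite S" "c C1_differentiable_on ({0..1} - S)" and "continuous_on {0..1} c"
    using assms by (auto simp: valid_path_def piecewise_C1_differentiable_on_def)
  have "c differentiable_on ({0..1} - S)"
    using S(2) C1_differentiable_imp_continuous_on
    by (auto simp: C1_differentiable_on_eq differentiable_on_def intro: differentiable_at_withinI)
  then have "negligible (c ` ({0..1} - S))"
    by (rule negligible_differentiable_image_lowdim[rotated]) simp
  moreover have "negligible (c ` S)" using S(1) by (simp add: negligible_finite)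
  ultimately have "negligible (c ` ({0..1} - S) \<union> c ` S)" by simp
  then have "negligible (path_image c)"
    by (rule negligible_subset) (auto simp: path_image_def)
  moreover have "path_image c \<in> sets borel"
    using assms by (simp add: closed_path_image valid_path_imp_path borel_closed)
  ultimately show ?thesis
    by (simp add: negligible_iff_null_sets null_sets_completion_iff)
qed

text \<open>By Tonelli: for fixed \<open>t\<close> the integral over \<open>w\<close> is bounded by
  \<open>cauchy_const l u\<close> uniformly in \<open>t\<close>, while \<open>d\<close> and
  \<open>K\<close> are bounded. The indicators sit inside the factors so that each factor is Borel
  on the whole space. The weight \<open>d\<close> will be the derivative of \<open>c\<close>, or the
  constant 1.\<close>

lemma integrable_kernel_path:
  fixes c d :: "real \<Rightarrow> complex" and K :: "complex \<Rightarrow> complex"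
  assumes c: "continuous_on {0..1} c" "c ` {0..1} \<subseteq> cbox l u" and d: "continuous_on {0..1} d"
    and K: "continuous_on (cbox l u) K"
  shows "integrable (lborel \<Otimes>\<^sub>M lborel)
    (\<lambda>(t, w). (indicator {0..1} t *\<^sub>R d t) * (indicator (cbox l u) w *\<^sub>R K w) / ((indicator {0..1} t *\<^sub>R c t) - w))"
    (is "integrable _ ?q")
proof (rule integrableI_bounded)
  have [measurable]: "(\<lambda>t. indicator {0..1} t *\<^sub>R d t) \<in> borel_measurable borel"
    "(\<lambda>t. indicator {0..1} t *\<^sub>R c t) \<in> borel_measurable borel"
    "(\<lambda>w. indicator (cbox l u) w *\<^sub>R K w) \<in> borel_measurable borel"
    using c d K by (auto intro!: borel_measurable_continuous_on_indicator)
  show m: "?q \<in> borel_measurable (lborel \<Otimes>\<^sub>M lborel)"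
    by measurable
  then have m': "(\<lambda>z. ennreal (norm (?q z))) \<in> borel_measurable (lborel \<Otimes>\<^sub>M lborel)"
    by measurable
  obtain B where B: "\<And>t. t \<in> {0..1} \<Longrightarrow> norm (d t) \<le> B"
    using compact_continuous_image[OF d compact_Icc] by (metis compact_imp_bounded bounded_iff imageI)
  obtain M where M: "\<And>w. w \<in> cbox l u \<Longrightarrow> norm (K w) \<le> M"
    using compact_continuous_image[OF K compact_cbox] by (metis compact_imp_bounded bounded_iff imageI)
  have B0: "B \<ge> 0" using order_trans[OF norm_ge_zero B[of 0]] by simp
  have "c 0 \<in> cbox l u" using c(2) by (simp add: image_subset_iff)
  then have M0: "M \<ge> 0" using order_trans[OF norm_ge_zero M[of "c 0"]] by simp
  have "(\<integral>\<^sup>+z. ennreal (norm (?q z)) \<partial>(lborel \<Otimes>\<^sub>M lborel)) = (\<integral>\<^sup>+t. \<integral>\<^sup>+w. ennreal (norm (?q (t, w))) \<partial>lborel \<partial>lborel)"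
    by (rule lborel.nn_integral_fst[OF m', symmetric])
  also have "\<dots> \<le> (\<integral>\<^sup>+t. indicator {0..1::real} t * (ennreal (B * M) * ennreal (cauchy_const l u)) \<partial>lborel)"
  proof (rule nn_integral_mono)
    fix t :: real
    show "(\<integral>\<^sup>+w. ennreal (norm (?q (t, w))) \<partial>lborel) \<le> indicator {0..1} t * (ennreal (B * M) * ennreal (cauchy_const l u))"
    proof (cases "t \<in> {0..1}")
      case True
      have "(\<integral>\<^sup>+w. ennreal (norm (?q (t, w))) \<partial>lborel) \<le> (\<integral>\<^sup>+w. ennreal (B * M) * ennreal (indicator (cbox l u) w * (1 / cmod (w - c t))) \<partial>lborel)"
      proof (rule nn_integral_mono)
        fix w
        have "norm (?q (t, w)) \<le> B * M * (indicator (cbox l u) w * (1 / cmod (w - c t)))"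
        proof (cases "w \<in> cbox l u")
          case wD: True
          have "norm (d t) * norm (K w) \<le> B * M" using B[OF True] M[OF wD] B0 by (intro mult_mono) auto
          then show ?thesis using True wD
            by (simp add: norm_mult norm_divide norm_minus_commute divide_right_mono)
        qed simp
        then show "ennreal (norm (?q (t, w))) \<le> ennreal (B * M) * ennreal (indicator (cbox l u) w * (1 / cmod (w - c t)))"
          using B0 M0 by (subst ennreal_mult[symmetric]) (auto intro!: ennreal_leI)
      qed
      also have "\<dots> = ennreal (B * M) * (\<integral>\<^sup>+w. ennreal (indicator (cbox l u) w * (1 / cmod (w - c t))) \<partial>lborel)"
        by (rule nn_integral_cmult) measurable
      also have "\<dots> \<le> ennreal (B * M) * ennreal (cauchy_const l u)"
        using c(2) True by (intro mult_left_mono nn_integral_inverse_norm_le) auto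
      finally show ?thesis using True by simp
    qed simp
  qed
  also have "\<dots> = (\<integral>\<^sup>+t. (ennreal (B * M) * ennreal (cauchy_const l u)) * indicator {0..1::real} t \<partial>lborel)"
    by (simp add: mult.commute)
  also have "\<dots> = ennreal (B * M) * ennreal (cauchy_const l u) * emeasure lborel {0..1::real}"
    by (rule nn_integral_cmult_indicator) simp
  also have "\<dots> < \<infinity>"
    by (simp add: ennreal_mult_less_top)
  finally show "(\<integral>\<^sup>+z. ennreal (norm (?q z)) \<partial>(lborel \<Otimes>\<^sub>M lborel)) < \<infinity>" .
qed


lemma C1_path:
  assumes "c C1_differentiable_on {0..1}"
  shows "continuous_on {0..1} c" "continuous_on {0..1} (\<lambda>t. vector_derivative c (at t))" "valid_path c"
  using assms C1_differentiable_imp_continuous_on C1_differentiable_imp_piecewise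
  by (auto simp: C1_differentiable_on_eq valid_path_def)

lemma contour_integrable_C1:
  assumes c: "c C1_differentiable_on {0..1}" and f: "continuous_on (path_image c) f"
  shows "f contour_integrable_on c"
  unfolding contour_integrable_on using C1_path[OF c]
  by (intro integrable_continuous_interval continuous_intros continuous_on_compose2[OF f]) (auto simp: path_image_def)

text \<open>Integrating the Cauchy-Pompeiu formula for the points of \<open>c\<close> along
  \<open>c\<close>, with Fubini to exchange the integrals, gives Green's formula for an arc; the
  sign of \<open>2 * pi * P z\<close> changes because \<open>1 / (z - w) = - 1 / (w - z)\<close>.
  Over the sides of a closed polygon the second term sums to zero. A common null set
  \<open>N\<close> puts all sides on one domain of integration.\<close>

lemma green_path:
  fixes P Px Py :: "complex \<Rightarrow> complex"
  assumes S: "open S" "cbox l u \<subseteq> S" 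
    and der: "\<And>w. w \<in> S \<Longrightarrow> (P has_derivative (\<lambda>h. Re h *\<^sub>R Px w + Im h *\<^sub>R Py w)) (at w)"
    and Px: "continuous_on S Px" and Py: "continuous_on S Py"
    and c: "c C1_differentiable_on {0..1}" "path_image c \<subseteq> box l u"
    and N: "N \<in> null_sets lborel" "path_image c \<subseteq> N"
  shows "integrable lborel (\<lambda>w. indicator (cbox l u - N) w *\<^sub>R ((Px w + \<i> * Py w) * contour_integral c (\<lambda>z. 1 / (z - w))))"
    and "(LINT w|lborel. indicator (cbox l u - N) w *\<^sub>R ((Px w + \<i> * Py w) * contour_integral c (\<lambda>z. 1 / (z - w))))
       = 2 * pi * contour_integral c P + \<i> * contour_integral c (\<lambda>z. contour_integral (rectpath l u) (\<lambda>w. P w / (w - z)))"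
proof -
  define K where "K w = Px w + \<i> * Py w" for w
  define d where "d t = vector_derivative c (at t)" for t
  define H where "H z = contour_integral (rectpath l u) (\<lambda>w. P w / (w - z))" for z
  have ct: "c t \<in> box l u" if "t \<in> {0..1}" for t using c(2) that by (auto simp: path_image_def)
  have lu: "Re l < Re u" "Im l < Im u" using ct[of 0] by (auto simp: in_box_complex_iff)
  have cc: "continuous_on {0..1} c" and cd: "continuous_on {0..1} d" using C1_path[OF c(1)] by (auto simp: d_def[abs_def])
  have cD: "c ` {0..1} \<subseteq> cbox l u" using ct box_subset_cbox by blast
  have cP: "continuous_on S P"
    by (meson der continuous_at_imp_continuous_on has_derivative_continuous)
  have cK: "continuous_on (cbox l u) K"
    unfolding K_def using S(2) by (auto intro!: continuous_intros continuous_on_subset[OF Px] continuous_on_subset[OF Py])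
  have "path_image (rectpath l u) \<subseteq> S" using path_image_rectpath_subset_cbox[of l u] lu S(2) by auto
  then have "H holomorphic_on box l u" unfolding H_def
    using lu by (intro holomorphic_on_Cauchy_integral_rectpath) (auto intro: continuous_on_subset[OF cP])
  then have cH: "continuous_on (box l u) H" by (rule holomorphic_on_imp_continuous_on)
  define q where "q t w = (indicator {0..1} t *\<^sub>R d t) * (indicator (cbox l u) w *\<^sub>R K w) / ((indicator {0..1} t *\<^sub>R c t) - w)" for t w
  have iq: "integrable (lborel \<Otimes>\<^sub>M lborel) (\<lambda>(t, w). q t w)"
    unfolding q_def by (rule integrable_kernel_path[OF cc cD cd cK])
  have [measurable]: "N \<in> sets borel" using N(1) by auto
  have inner: "(LINT t|lborel. q t w) = K w * contour_integral c (\<lambda>z. 1 / (z - w))" if w: "w \<in> cbox l u - N" for w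
  proof -
    have wn: "c t \<noteq> w" if "t \<in> {0..1}" for t using w N(2) that unfolding path_image_def by blast
    have cont: "continuous_on {0..1} (\<lambda>t. d t / (c t - w))"
      using wn by (auto intro!: continuous_intros cc cd)
    have "(LINT t|lborel. q t w) = (LINT t|lborel. K w * (indicator {0..1} t *\<^sub>R (d t / (c t - w))))"
      using w by (intro Bochner_Integration.integral_cong) (auto simp: q_def indicator_def)
    also have "\<dots> = K w * (LINT t|lborel. (indicator {0..1} t *\<^sub>R (d t / (c t - w))))"
      by (rule integral_mult_right_zero)
    also have "(LINT t|lborel. (indicator {0..1} t *\<^sub>R (d t / (c t - w)))) = integral {0..1} (\<lambda>t. d t / (c t - w))"
      using set_borel_integral_eq_integral(2)[OF borel_integrable_atLeastAtMost'[OF cont]]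
      by (simp add: set_lebesgue_integral_def)
    also have "\<dots> = contour_integral c (\<lambda>z. 1 / (z - w))"
      by (simp add: contour_integral_integral d_def)
    finally show ?thesis .
  qed
  have eq: "indicator (cbox l u - N) w *\<^sub>R (K w * contour_integral c (\<lambda>z. 1 / (z - w))) = indicator (- N) w *\<^sub>R (LINT t|lborel. q t w)" for w
  proof (cases "w \<in> cbox l u - N")
    case False
    then show ?thesis by (auto simp: q_def indicator_def)
  qed (use inner in auto)
  have i2: "integrable lborel (\<lambda>w. LINT t|lborel. q t w)"
    by (rule lborel_pair.integrable_snd[OF iq])
  show "integrable lborel (\<lambda>w. indicator (cbox l u - N) w *\<^sub>R ((Px w + \<i> * Py w) * contour_integral c (\<lambda>z. 1 / (z - w))))"
    unfolding K_def[symmetric] eq by (rule integrable_mult_indicator[OF _ i2]) simp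
  have "(LINT w|lborel. indicator (cbox l u - N) w *\<^sub>R ((Px w + \<i> * Py w) * contour_integral c (\<lambda>z. 1 / (z - w))))
      = (LINT w|lborel. LINT t|lborel. q t w)"
    unfolding K_def[symmetric] eq
  proof (rule integral_cong_AE)
    show "AE w in lborel. indicator (- N) w *\<^sub>R (LINT t|lborel. q t w) = (LINT t|lborel. q t w)"
      using AE_not_in[OF N(1)] by eventually_elim simp
  qed (use i2 in auto)
  also have "\<dots> = (LINT t|lborel. LINT w|lborel. q t w)"
    by (rule lborel_pair.Fubini_integral[OF iq])
  also have "\<dots> = (LINT t|lborel. indicator {0..1} t *\<^sub>R ((2 * pi * P (c t) + \<i> * H (c t)) * d t))"
  proof (rule Bochner_Integration.integral_cong[OF refl])
    fix t :: real
    show "(LINT w|lborel. q t w) = indicator {0..1} t *\<^sub>R ((2 * pi * P (c t) + \<i> * H (c t)) * d t)"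
    proof (cases "t \<in> {0..1}")
      case True
      have "(LINT w|lborel. q t w) = (LINT w|lborel. (- d t) * (indicator (cbox l u) w *\<^sub>R (K w / (w - c t))))"
      proof (intro Bochner_Integration.integral_cong refl)
        fix w
        have "x * y / (p - q) = - x * (y / (q - p))" for x y p q :: complex
          by (metis minus_diff_eq minus_divide_right mult_minus_left times_divide_eq_right)
        from this[of "d t" "indicator (cbox l u) w *\<^sub>R K w" "c t" w]
        show "q t w = (- d t) * (indicator (cbox l u) w *\<^sub>R (K w / (w - c t)))"
          using True by (simp add: q_def scaleR_conv_of_real)
      qed
      also have "\<dots> = (- d t) * (LINT w|lborel. indicator (cbox l u) w *\<^sub>R (K w / (w - c t)))"
        by (rule integral_mult_right_zero)
      also have "(LINT w|lborel. indicator (cbox l u) w *\<^sub>R (K w / (w - c t))) = H (c t) / \<i> - 2 * pi * P (c t)"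
        unfolding K_def H_def by (rule cauchy_pompeiu_rectangle(2)[OF S ct[OF True] der Px Py])
      finally show ?thesis using True by (simp add: algebra_simps)
    qed (simp add: q_def)
  qed
  also have "\<dots> = integral {0..1} (\<lambda>t. (2 * pi * P (c t) + \<i> * H (c t)) * d t)"
  proof -
    have "continuous_on {0..1} (\<lambda>t. (2 * pi * P (c t) + \<i> * H (c t)) * d t)"
      using ct S(2) box_subset_cbox
      by (intro continuous_intros cd continuous_on_compose2[OF cP cc] continuous_on_compose2[OF cH cc]) blast+
    from set_borel_integral_eq_integral(2)[OF borel_integrable_atLeastAtMost'[OF this]]
    show ?thesis by (simp add: set_lebesgue_integral_def)
  qed
  also have "\<dots> = contour_integral c (\<lambda>z. 2 * pi * P z + \<i> * H z)"
    by (simp add: contour_integral_integral d_def)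
  also have "\<dots> = 2 * pi * contour_integral c P + \<i> * contour_integral c H"
  proof -
    have "P contour_integrable_on c" "H contour_integrable_on c"
      using c S(2) box_subset_cbox[of l u] by (auto intro!: contour_integrable_C1 intro: continuous_on_subset[OF cP] continuous_on_subset[OF cH])
    then show ?thesis
      by (subst contour_integral_add) (auto intro!: contour_integrable_lmul simp: contour_integral_lmul)
  qed
  finally show "(LINT w|lborel. indicator (cbox l u - N) w *\<^sub>R ((Px w + \<i> * Py w) * contour_integral c (\<lambda>z. 1 / (z - w))))
       = 2 * pi * contour_integral c P + \<i> * contour_integral c (\<lambda>z. contour_integral (rectpath l u) (\<lambda>w. P w / (w - z)))"
    unfolding H_def .
qed

section \<open>Cauchy integrals along piecewise C1 paths\<close>

text \<open>With weight 1 in place of the derivative, the kernel gives the potential of the path in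
  its parameter. It is the integrable majorant for paths whose derivative is unbounded.\<close>

lemma integrable_potential_path:
  fixes c :: "real \<Rightarrow> complex"
  assumes c: "path c" "path_image c \<subseteq> cbox l u" and N: "N \<in> null_sets lborel" "path_image c \<subseteq> N"
  shows "integrable lborel (\<lambda>w. indicator (cbox l u - N) w *\<^sub>R integral {0..1} (\<lambda>t. 1 / cmod (c t - w)))"
proof -
  define q where "q t w = (indicator {0..1} t *\<^sub>R (1::complex)) * (indicator (cbox l u) w *\<^sub>R 1) / ((indicator {0..1} t *\<^sub>R c t) - w)" for t w
  have cc: "continuous_on {0..1} c" using c(1) by (simp add: path_def)
  have iq: "integrable (lborel \<Otimes>\<^sub>M lborel) (\<lambda>(t, w). q t w)"
    unfolding q_def by (rule integrable_kernel_path[OF cc]) (use c(2) in \<open>auto simp: path_image_def\<close>)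
  have "integrable (lborel \<Otimes>\<^sub>M lborel) (\<lambda>z. norm ((\<lambda>(t, w). q t w) z))"
    using iq by (rule integrable_norm)
  then have iq': "integrable (lborel \<Otimes>\<^sub>M lborel) (\<lambda>(t, w). norm (q t w))"
    by (simp add: case_prod_unfold)
  have i2: "integrable lborel (\<lambda>w. LINT t|lborel. norm (q t w))"
    by (rule lborel_pair.integrable_snd[OF iq'])
  have [measurable]: "N \<in> sets borel" using N(1) by auto
  have eq: "indicator (cbox l u - N) w *\<^sub>R integral {0..1} (\<lambda>t. 1 / cmod (c t - w)) = indicator (- N) w *\<^sub>R (LINT t|lborel. norm (q t w))" for w
  proof (cases "w \<in> cbox l u - N")
    case True
    have wn: "c t \<noteq> w" if "t \<in> {0..1}" for t using True N(2) that unfolding path_image_def by blast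
    have cont: "continuous_on {0..1} (\<lambda>t. 1 / cmod (c t - w))"
      using wn by (auto intro!: continuous_intros cc)
    have "(LINT t|lborel. norm (q t w)) = (LINT t|lborel. indicator {0..1} t *\<^sub>R (1 / cmod (c t - w)))"
      using True by (intro Bochner_Integration.integral_cong) (auto simp: q_def indicator_def norm_divide)
    also have "\<dots> = integral {0..1} (\<lambda>t. 1 / cmod (c t - w))"
      using set_borel_integral_eq_integral(2)[OF borel_integrable_atLeastAtMost'[OF cont]]
      by (simp add: set_lebesgue_integral_def)
    finally show ?thesis using True by simp
  next
    case False
    then show ?thesis by (auto simp: q_def indicator_def)
  qed
  show ?thesis unfolding eq by (rule integrable_mult_indicator[OF _ i2]) simp
qed

text \<open>A valid path is continuous and C1 off a finite set S of parameters, but its derivative may be unbounded near S,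
  so that the path need not be rectifiable. Away from the points of \<open>c ` S\<close> the Cauchy integral still has an integrable bound,
  since near S the path can be replaced by a chord.\<close>

lemma contour_integral_inversediff_bound:
  fixes c :: "real \<Rightarrow> complex"
  assumes c: "valid_path c" and S: "finite S" "c C1_differentiable_on ({0..1} - S)" and r: "r > 0"
  obtains A where "A \<ge> 0" "\<And>w. w \<notin> path_image c \<Longrightarrow> (\<And>s. s \<in> S \<inter> {0..1} \<Longrightarrow> r \<le> norm (w - c s)) \<Longrightarrow>
     norm (contour_integral c (\<lambda>z. 1 / (z - w))) \<le> A * (1 + integral {0..1} (\<lambda>t. 1 / cmod (c t - w)))"
proof -
  define h where "h w = integral {0..1} (\<lambda>t. 1 / cmod (c t - w))" for w
  define W where "W = {w. w \<notin> path_image c \<and> (\<forall>s\<in>S \<inter> {0..1}. r \<le> norm (w - c s))}"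
  have cc: "continuous_on {0..1} c" using c valid_path_imp_path path_def by blast
  have hi: "(\<lambda>t. 1 / cmod (c t - w)) integrable_on {0..1}" if "w \<in> W" for w
    using that by (intro integrable_continuous_interval continuous_intros cc) (auto simp: W_def path_image_def)
  have h0: "h w \<ge> 0" if "w \<in> W" for w
    unfolding h_def by (rule integral_nonneg[OF hi[OF that]]) auto
  have ci: "(\<lambda>z. 1 / (z - w)) contour_integrable_on c" if "w \<in> W" for w
    using contour_integrable_inversediff[OF c] that by (auto simp: W_def)
  \<comment> \<open>The property is additive under concatenation and holds for all short
    subintervals around any given parameter; Bolzano's bisection principle then yields it on the
    whole interval.\<close>
  define P where "P a b \<longleftrightarrow> (0 \<le> a \<and> b \<le> 1 \<longrightarrow>
     (\<exists>A\<ge>0. \<forall>w\<in>W. norm (contour_integral (subpath a b c) (\<lambda>z. 1 / (z - w))) \<le> A * (1 + h w)))" for a b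
  have "P 0 1"
  proof (rule Bolzano[of 0 1 P])
    fix x y z assume xyz: "P x y" "P y z" "x \<le> y" "y \<le> z"
    show "P x z" unfolding P_def
    proof
      assume b: "0 \<le> x \<and> z \<le> 1"
      then obtain A1 A2 where A: "A1 \<ge> 0" "A2 \<ge> 0"
        "\<And>w. w \<in> W \<Longrightarrow> norm (contour_integral (subpath x y c) (\<lambda>z. 1 / (z - w))) \<le> A1 * (1 + h w)"
        "\<And>w. w \<in> W \<Longrightarrow> norm (contour_integral (subpath y z c) (\<lambda>z. 1 / (z - w))) \<le> A2 * (1 + h w)"
        using xyz unfolding P_def by (meson order_trans)
      have "norm (contour_integral (subpath x z c) (\<lambda>z. 1 / (z - w))) \<le> (A1 + A2) * (1 + h w)" if "w \<in> W" for w
      proof -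
        have "contour_integral (subpath x z c) (\<lambda>z. 1 / (z - w)) = contour_integral (subpath x y c) (\<lambda>z. 1 / (z - w)) + contour_integral (subpath y z c) (\<lambda>z. 1 / (z - w))"
          using contour_integral_subpath_combine[OF ci[OF that] c, of x y z] xyz b by simp
        then show ?thesis using A(3,4)[OF that] norm_triangle_mono by (simp add: distrib_right)
      qed
      then show "\<exists>A\<ge>0. \<forall>w\<in>W. norm (contour_integral (subpath x z c) (\<lambda>z. 1 / (z - w))) \<le> A * (1 + h w)"
        using A(1,2) by (intro exI[of _ "A1 + A2"]) auto
    qed
  next
    fix x :: real assume x: "0 \<le> x" "x \<le> 1"
    show "\<exists>d>0. \<forall>a b. a \<le> x \<and> x \<le> b \<and> b - a < d \<longrightarrow> P a b"
    proof (cases "x \<in> S")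
      case True
      obtain d where d: "d > 0" "\<And>t. t \<in> {0..1} \<Longrightarrow> dist t x < d \<Longrightarrow> dist (c t) (c x) < r/2"
        using cc x r unfolding continuous_on_iff by (metis atLeastAtMost_iff half_gt_zero)
      show ?thesis
      proof (intro exI[of _ d] conjI d(1) allI impI)
        fix a b assume ab: "a \<le> x \<and> x \<le> b \<and> b - a < d"
        \<comment> \<open>The subpath lies in the disc of radius \<open>r/2\<close> about
          \<open>c x\<close>, where the integrand is at most \<open>2 / r\<close>, and it is
          replaced by its chord, whose length is at most \<open>r\<close>. This gives the constant
          2.\<close>
        show "P a b" unfolding P_def
        proof (intro impI exI[of _ 2] conjI ballI)
          assume ab1: "0 \<le> a \<and> b \<le> 1"
          fix w assume w: "w \<in> W"
          have far: "r \<le> norm (w - c x)" using w True x by (auto simp: W_def)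
          have vs: "valid_path (subpath a b c)" using c ab ab1 by (intro valid_path_subpath) auto
          have sub: "path_image (subpath a b c) \<subseteq> ball (c x) (r/2)"
          proof -
            have "c ` {a..b} \<subseteq> ball (c x) (r/2)"
            proof
              fix y assume "y \<in> c ` {a..b}"
              then obtain t where "t \<in> {a..b}" "y = c t" by auto
              then show "y \<in> ball (c x) (r/2)" using d(2)[of t] ab ab1 by (auto simp: dist_real_def dist_commute)
            qed
            then show ?thesis using ab ab1 by (simp add: path_image_subpath)
          qed
          have nz: "z \<noteq> w" if "z \<in> ball (c x) (r/2)" for z
            using that far r by (auto simp: dist_norm norm_minus_commute)
          have hol: "(\<lambda>z. 1 / (z - w)) holomorphic_on ball (c x) (r/2)"
            using nz by (auto intro!: holomorphic_intros)
          have caca: "c a \<in> ball (c x) (r/2)" "c b \<in> ball (c x) (r/2)"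
            using d(2)[of a] d(2)[of b] ab ab1 by (auto simp: dist_real_def dist_commute)
          then have seg: "closed_segment (c a) (c b) \<subseteq> ball (c x) (r/2)"
            by (simp add: closed_segment_subset)
          obtain G where G: "\<And>z. z \<in> ball (c x) (r/2) \<Longrightarrow> (G has_field_derivative 1 / (z - w)) (at z within ball (c x) (r/2))"
            using holomorphic_convex_primitive'[OF convex_ball open_ball hol] by blast
          have "contour_integral (subpath a b c) (\<lambda>z. 1 / (z - w)) = G (c b) - G (c a)"
            using contour_integral_primitive[OF G vs sub] by (simp add: contour_integral_unique)
          also have "\<dots> = contour_integral (linepath (c a) (c b)) (\<lambda>z. 1 / (z - w))"
            using contour_integral_primitive[OF G, of "linepath (c a) (c b)"] seg by (simp add: contour_integral_unique)
          also have "norm \<dots> \<le> (2 / r) * norm (c b - c a)"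
          proof (rule contour_integral_bound_linepath)
            show "(\<lambda>z. 1 / (z - w)) contour_integrable_on linepath (c a) (c b)"
              by (rule contour_integrable_holomorphic_simple[OF hol open_ball]) (use seg in auto)
            fix z assume "z \<in> closed_segment (c a) (c b)"
            then have "dist (c x) z < r/2" using seg by auto
            then have "r/2 \<le> norm (z - w)"
              using far norm_triangle_ineq[of "w - z" "z - c x"] by (simp add: dist_norm norm_minus_commute)
            then show "norm (1 / (z - w)) \<le> 2 / r" using r frac_le[of 1 1 "r/2" "norm (z - w)"] by (simp add: norm_divide)
          qed (use r in auto)
          also have "\<dots> \<le> (2 / r) * r"
          proof (rule mult_left_mono)
            have "norm (c b - c a) \<le> dist (c x) (c b) + dist (c x) (c a)"
              by (metis dist_commute dist_norm dist_triangle)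
            then show "norm (c b - c a) \<le> r" using caca by simp
          qed (use r in auto)
          also have "\<dots> \<le> 2 * (1 + h w)" using r h0[OF w] by simp
          finally show "norm (contour_integral (subpath a b c) (\<lambda>z. 1 / (z - w))) \<le> 2 * (1 + h w)" .
        qed simp
      qed
    next
      case False
      define D where "D t = vector_derivative c (at t)" for t
      have "continuous_on ({0..1} - S) D" using S(2) by (auto simp: C1_differentiable_on_eq D_def[abs_def])
      moreover have "x \<in> {0..1} - S" using x False by simp
      ultimately obtain d1 where d1: "d1 > 0" "\<And>t. t \<in> {0..1} - S \<Longrightarrow> dist t x < d1 \<Longrightarrow> dist (D t) (D x) < 1"
        unfolding continuous_on_iff by (metis zero_less_one)
      obtain d2 where d2: "d2 > 0" "\<And>t. t \<in> S \<Longrightarrow> t \<noteq> x \<Longrightarrow> d2 \<le> dist x t"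
        using finite_set_avoid[OF S(1), of x] by blast
      define B where "B = norm (D x) + 1"
      have B: "norm (D t) \<le> B" if "t \<in> {0..1}" "dist t x < min d1 d2" for t
      proof -
        have "t \<notin> S" using d2(2)[of t] that False by (auto simp: dist_commute)
        then have "dist (D t) (D x) < 1" using d1(2)[of t] that by auto
        then show ?thesis using norm_triangle_ineq2[of "D t" "D x"] by (simp add: B_def dist_norm)
      qed
      have B0: "B \<ge> 0" by (simp add: B_def)
      show ?thesis
      proof (intro exI[of _ "min d1 d2"] conjI allI impI)
        show "0 < min d1 d2" using d1 d2 by simp
        fix a b assume ab: "a \<le> x \<and> x \<le> b \<and> b - a < min d1 d2"
        show "P a b" unfolding P_def
        proof (intro impI exI[of _ B] conjI ballI B0)
          assume ab1: "0 \<le> a \<and> b \<le> 1"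
          then have sub: "{a..b} \<subseteq> {0..1}" by auto
          fix w assume w: "w \<in> W"
          have "contour_integral (subpath a b c) (\<lambda>z. 1 / (z - w)) = integral {a..b} (\<lambda>t. 1 / (c t - w) * D t)"
            unfolding D_def by (rule contour_integral_subcontour_integral[OF ci[OF w] c]) (use ab ab1 in auto)
          also have "norm \<dots> \<le> integral {a..b} (\<lambda>t. B * (1 / cmod (c t - w)))"
          proof (rule integral_norm_bound_integral)
            show "(\<lambda>t. 1 / (c t - w) * D t) integrable_on {a..b}"
              using ci[OF w] sub unfolding contour_integrable_on D_def by (rule integrable_on_subinterval)
            show "(\<lambda>t. B * (1 / cmod (c t - w))) integrable_on {a..b}"
              using integrable_on_subinterval[OF hi[OF w] sub] by (rule integrable_on_mult_right)
            fix t assume t: "t \<in> {a..b}"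
            then have "norm (D t) \<le> B" using ab ab1 by (intro B) (auto simp: dist_real_def)
            then show "norm (1 / (c t - w) * D t) \<le> B * (1 / cmod (c t - w))"
              by (simp add: norm_mult norm_divide divide_right_mono)
          qed
          also have "\<dots> = B * integral {a..b} (\<lambda>t. 1 / cmod (c t - w))" by (rule integral_mult_right)
          also have "\<dots> \<le> B * h w"
            unfolding h_def by (intro mult_left_mono B0 integral_subset_le sub integrable_on_subinterval[OF hi[OF w] sub] hi[OF w]) auto
          also have "\<dots> \<le> B * (1 + h w)" using B0 by (simp add: mult_left_mono)
          finally show "norm (contour_integral (subpath a b c) (\<lambda>z. 1 / (z - w))) \<le> B * (1 + h w)" .
        qed
      qed
    qed
  qed simp
  then obtain A where "A \<ge> 0" "\<And>w. w \<in> W \<Longrightarrow> norm (contour_integral c (\<lambda>z. 1 / (z - w))) \<le> A * (1 + h w)"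
    unfolding P_def by (auto simp: subpath_trivial)
  then show thesis using that[of A] unfolding W_def h_def by blast
qed


text \<open>The preceding bound reduces this to the integrability of the potential of
  \<open>c\<close>, on a set \<open>V\<close> that keeps distance \<open>r\<close> from the
  exceptional points.\<close>

lemma integrable_contour_integral_inversediff:
  fixes c :: "real \<Rightarrow> complex" and K :: "complex \<Rightarrow> complex"
  assumes c: "valid_path c" "path_image c \<subseteq> cbox l u" and S: "finite S" "c C1_differentiable_on ({0..1} - S)"
    and N: "N \<in> null_sets lborel" "path_image c \<subseteq> N" and K: "continuous_on (cbox l u) K"
    and r: "r > 0" and V: "V \<in> sets borel" "\<And>w s. w \<in> V \<Longrightarrow> s \<in> S \<inter> {0..1} \<Longrightarrow> r \<le> norm (w - c s)"
  shows "integrable lborel (\<lambda>w. indicator (V \<inter> (cbox l u - N)) w *\<^sub>R (K w * contour_integral c (\<lambda>z. 1 / (z - w))))"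
proof -
  obtain A where A: "A \<ge> 0" "\<And>w. w \<notin> path_image c \<Longrightarrow> (\<And>s. s \<in> S \<inter> {0..1} \<Longrightarrow> r \<le> norm (w - c s)) \<Longrightarrow>
     norm (contour_integral c (\<lambda>z. 1 / (z - w))) \<le> A * (1 + integral {0..1} (\<lambda>t. 1 / cmod (c t - w)))"
    using contour_integral_inversediff_bound[OF c(1) S r] by blast
  obtain M where M: "\<And>w. w \<in> cbox l u \<Longrightarrow> norm (K w) \<le> M"
    using compact_continuous_image[OF K compact_cbox] by (metis compact_imp_bounded bounded_iff imageI)
  have "pathstart c \<in> cbox l u" using c(2) pathstart_in_path_image by blast
  then have M0: "M \<ge> 0" using order_trans[OF norm_ge_zero M] by blast
  have NS [measurable]: "N \<in> sets borel" "V \<in> sets borel" using N(1) V(1) by auto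
  let ?h = "\<lambda>w. integral {0..1} (\<lambda>t. 1 / cmod (c t - w))"
  have p: "path c" using c(1) by (rule valid_path_imp_path)
  have ib: "integrable lborel (\<lambda>w. indicator (cbox l u) w :: real)"
    by (simp add: integrable_indicator_iff emeasure_lborel_cbox_eq)
  have "integrable lborel (\<lambda>w. M * A * (indicator (cbox l u) w + indicator (cbox l u - N) w *\<^sub>R ?h w))"
    by (intro integrable_mult_right Bochner_Integration.integrable_add ib integrable_potential_path[OF p c(2) N])
  then show ?thesis
  proof (rule Bochner_Integration.integrable_bound)
    \<comment> \<open>Measurability comes from the winding number, which is continuous off the path
      even if the path is not closed, and is the contour integral up to the factor
      \<open>2 * pi * \<i>\<close>.\<close>
    have "continuous_on (cbox l u - path_image c) (\<lambda>w. K w * (2 * pi * \<i> * winding_number c w))"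
      by (intro continuous_intros continuous_on_subset[OF K] continuous_on_subset[OF continuous_on_winding_number[OF p]]) auto
    moreover have "cbox l u - path_image c \<in> sets borel"
      using closed_path_image[OF p] by auto
    ultimately have m: "(\<lambda>w. indicator (cbox l u - path_image c) w *\<^sub>R (K w * (2 * pi * \<i> * winding_number c w))) \<in> borel_measurable borel"
      by (intro borel_measurable_continuous_on_indicator)
    have eq: "(\<lambda>w. indicator (V \<inter> (cbox l u - N)) w *\<^sub>R (K w * contour_integral c (\<lambda>z. 1 / (z - w))))
      = (\<lambda>w. indicator (V \<inter> (cbox l u - N)) w *\<^sub>R (indicator (cbox l u - path_image c) w *\<^sub>R (K w * (2 * pi * \<i> * winding_number c w))))"
      using N(2) by (auto simp: fun_eq_iff indicator_def winding_number_valid_path[OF c(1)] subset_iff)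
    show "(\<lambda>w. indicator (V \<inter> (cbox l u - N)) w *\<^sub>R (K w * contour_integral c (\<lambda>z. 1 / (z - w)))) \<in> borel_measurable lborel"
      unfolding eq measurable_lborel2 by (rule borel_measurable_scaleR[OF _ m]) measurable
    show "AE w in lborel. norm (indicator (V \<inter> (cbox l u - N)) w *\<^sub>R (K w * contour_integral c (\<lambda>z. 1 / (z - w))))
       \<le> norm (M * A * (indicator (cbox l u) w + indicator (cbox l u - N) w *\<^sub>R ?h w))"
    proof (rule AE_I2)
      fix w
      show "norm (indicator (V \<inter> (cbox l u - N)) w *\<^sub>R (K w * contour_integral c (\<lambda>z. 1 / (z - w))))
       \<le> norm (M * A * (indicator (cbox l u) w + indicator (cbox l u - N) w *\<^sub>R ?h w))"
      proof (cases "w \<in> V \<inter> (cbox l u - N)")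
        case True
        have "norm (contour_integral c (\<lambda>z. 1 / (z - w))) \<le> A * (1 + ?h w)"
          using True N(2) V(2) by (intro A(2)) auto
        then have "norm (K w) * norm (contour_integral c (\<lambda>z. 1 / (z - w))) \<le> M * (A * (1 + ?h w))"
          using M[of w] True M0 by (intro mult_mono) auto
        then show ?thesis using True by (simp add: norm_mult mult.assoc)
      qed simp
    qed
  qed
qed

section \<open>Holomorphic substitution in area integrals\<close>

text \<open>The change of variables theorem is stated with Jacobian matrices on
  \<open>real^2\<close>; this isometry carries it to the complex plane.\<close>

definition c2v :: "complex \<Rightarrow> real^2" where "c2v z = vector [Re z, Im z]"
definition v2c :: "real^2 \<Rightarrow> complex" where "v2c x = Complex (x$1) (x$2)"

lemma c2v_nth [simp]: "c2v z $ 1 = Re z" "c2v z $ 2 = Im z"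
  by (simp_all add: c2v_def)

lemma v2c_simps [simp]: "Re (v2c x) = x$1" "Im (v2c x) = x$2"
  by (simp_all add: v2c_def)

lemma v2c_c2v [simp]: "v2c (c2v z) = z" "c2v (v2c x) = x"
  by (simp_all add: complex_eq_iff vec_eq_iff forall_2)

lemma norm_c2v [simp]: "norm (c2v z) = norm z" "norm (v2c x) = norm x"
  by (simp_all add: norm_vec_def L2_set_def sum_2 cmod_def)

lemma bounded_linear_c2v: "bounded_linear c2v"
  by (rule bounded_linear_intro[where K=1]) (auto simp: vec_eq_iff forall_2)

lemma bounded_linear_v2c: "bounded_linear v2c"
  by (rule bounded_linear_intro[where K=1]) (auto simp: complex_eq_iff)

lemma c2v_cbox: "c2v ` cbox a b = cbox (c2v a) (c2v b)" "v2c ` cbox u v = cbox (v2c u) (v2c v)"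
proof -
  have *: "c2v z \<in> cbox (c2v a) (c2v b) \<longleftrightarrow> z \<in> cbox a b" for z a b
    by (auto simp: mem_box_cart forall_2 in_cbox_complex_iff)
  show "c2v ` cbox a b = cbox (c2v a) (c2v b)" for a b
  proof (intro equalityI subsetI)
    fix x assume "x \<in> cbox (c2v a) (c2v b)"
    then show "x \<in> c2v ` cbox a b" using *[of "v2c x" a b] by (intro image_eqI[of _ _ "v2c x"]) auto
  qed (use * in auto)
  then have "v2c ` cbox (c2v (v2c u)) (c2v (v2c v)) = v2c ` c2v ` cbox (v2c u) (v2c v)" for u v
    by simp
  then show "v2c ` cbox u v = cbox (v2c u) (v2c v)"
    by (simp add: image_image)
qed

lemma content_c2v: "measure lborel (cbox (c2v a) (c2v b)) = measure lborel (cbox a b)"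
proof (cases "cbox a b = {}")
  case True
  then show ?thesis using c2v_cbox(1)[of a b] by (metis content_empty image_empty)
next
  case False
  then have ne: "cbox (c2v a) (c2v b) \<noteq> {}" using c2v_cbox(1)[of a b] by (metis image_is_empty)
  have "measure lborel (cbox (c2v a) (c2v b)) = (Re b - Re a) * (Im b - Im a)"
    using content_cbox_cart[OF ne] by (simp add: UNIV_2 mult.commute)
  moreover have "measure lborel (cbox a b) = (Re b - Re a) * (Im b - Im a)"
    using False by (simp add: content_cbox' Basis_complex_def box_ne_empty)
  ultimately show ?thesis by simp
qed

text \<open>For boxes this is \<open>has_integral_twiddle\<close>. A general set is handled by
  extending \<open>f\<close> by zero; as \<open>h\<close> preserves the norm, boxes containing a
  large ball correspond to such boxes.\<close>

lemma has_integral_isometry_aux: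
  fixes f :: "'a::euclidean_space \<Rightarrow> 'c::banach" and g :: "'b::euclidean_space \<Rightarrow> 'a" and h :: "'a \<Rightarrow> 'b"
  assumes hg: "\<And>x. h (g x) = x" and gh: "\<And>x. g (h x) = x" and contg: "\<And>x. continuous (at x) g"
    and g: "\<And>u v. \<exists>w z. g ` cbox u v = cbox w z" and h: "\<And>u v. \<exists>w z. h ` cbox u v = cbox w z"
    and r: "\<And>u v. measure lborel (g ` cbox u v) = measure lborel (cbox u v)" and n: "\<And>x. norm (h x) = norm x"
    and f: "(f has_integral i) A"
  shows "((\<lambda>x. f (g x)) has_integral i) (h ` A)"
proof (subst has_integral', intro allI impI)
  fix e :: real assume "e > 0"
  then obtain B where B: "B > 0" "\<And>a b. ball 0 B \<subseteq> cbox a b \<Longrightarrow>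
      \<exists>z. ((\<lambda>x. if x \<in> A then f x else 0) has_integral z) (cbox a b) \<and> norm (z - i) < e"
    using iffD1[OF has_integral' f] by blast
  have mem: "g x \<in> A \<longleftrightarrow> x \<in> h ` A" for x
    by (metis gh hg image_iff)
  show "\<exists>B>0. \<forall>a b. ball (0::'b) B \<subseteq> cbox a b \<longrightarrow>
       (\<exists>z. ((\<lambda>x. if x \<in> h ` A then f (g x) else 0) has_integral z) (cbox a b) \<and> norm (z - i) < e)"
  proof (intro exI[of _ B] conjI B(1) allI impI)
    fix a b assume sub: "ball (0::'b) B \<subseteq> cbox a b"
    obtain w z where wz: "g ` cbox a b = cbox w z" using g by blast
    have "ball 0 B \<subseteq> cbox w z"
    proof
      fix y assume "y \<in> ball (0::'a) B"
      then have "h y \<in> ball 0 B" using n by simp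
      then have "g (h y) \<in> g ` cbox a b" using sub by blast
      then show "y \<in> cbox w z" using gh wz by simp
    qed
    then obtain k where k: "((\<lambda>x. if x \<in> A then f x else 0) has_integral k) (cbox w z)" "norm (k - i) < e"
      using B(2) by blast
    have "((\<lambda>x. if g x \<in> A then f (g x) else 0) has_integral (1 / 1) *\<^sub>R k) (h ` cbox w z)"
      by (rule has_integral_twiddle[OF _ hg gh contg g h _ k(1)]) (use r in auto)
    moreover have "h ` cbox w z = cbox a b" unfolding wz[symmetric] image_image hg by simp
    ultimately show "\<exists>z. ((\<lambda>x. if x \<in> h ` A then f (g x) else 0) has_integral z) (cbox a b) \<and> norm (z - i) < e"
      using k(2) unfolding mem by auto
  qed
qed

lemma has_integral_c2v:
  fixes f :: "complex \<Rightarrow> 'c::banach"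
  shows "((\<lambda>x. f (v2c x)) has_integral i) (c2v ` A) \<longleftrightarrow> (f has_integral i) A"
proof
  have box1: "measure lborel (v2c ` cbox u v) = measure lborel (cbox u v)" for u v
    using content_c2v[of "v2c u" "v2c v"] by (simp add: c2v_cbox)
  have box2: "measure lborel (c2v ` cbox u v) = measure lborel (cbox u v)" for u v
    using content_c2v[of u v] by (simp add: c2v_cbox)
  have c: "continuous (at x) c2v" "continuous (at y) v2c" for x y
    using bounded_linear_c2v bounded_linear_v2c by (auto simp: linear_continuous_at)
  show "((\<lambda>x. f (v2c x)) has_integral i) (c2v ` A)" if "(f has_integral i) A"
    by (rule has_integral_isometry_aux[OF _ _ _ _ _ _ _ that]) (use box1 c c2v_cbox in auto)
  assume "((\<lambda>x. f (v2c x)) has_integral i) (c2v ` A)"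
  then have "((\<lambda>x. f (v2c (c2v x))) has_integral i) (v2c ` c2v ` A)"
    by (rule has_integral_isometry_aux[rotated -1]) (use box2 c c2v_cbox in auto)
  then show "(f has_integral i) A" by (simp add: image_image)
qed

lemma absolutely_integrable_c2v:
  fixes f :: "complex \<Rightarrow> complex"
  shows "(\<lambda>x. c2v (f (v2c x))) absolutely_integrable_on (c2v ` A) \<and> integral (c2v ` A) (\<lambda>x. c2v (f (v2c x))) = c2v b
     \<longleftrightarrow> f absolutely_integrable_on A \<and> integral A f = b"
proof -
  have lin: "((\<lambda>x. c2v (h x)) has_integral c2v i) B \<longleftrightarrow> (h has_integral i) B" for h :: "real^2 \<Rightarrow> complex" and i B
  proof
    assume "((\<lambda>x. c2v (h x)) has_integral c2v i) B"
    from has_integral_linear[OF this bounded_linear_v2c] show "(h has_integral i) B" by (simp add: o_def)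
  next
    assume "(h has_integral i) B"
    from has_integral_linear[OF this bounded_linear_c2v] show "((\<lambda>x. c2v (h x)) has_integral c2v i) B" by (simp add: o_def)
  qed
  have "(\<lambda>x. c2v (f (v2c x))) absolutely_integrable_on (c2v ` A) \<and> integral (c2v ` A) (\<lambda>x. c2v (f (v2c x))) = c2v b
    \<longleftrightarrow> ((\<lambda>x. c2v (f (v2c x))) has_integral c2v b) (c2v ` A) \<and> (\<lambda>x. norm (f (v2c x))) integrable_on (c2v ` A)"
    unfolding absolutely_integrable_on_def by (auto simp: has_integral_iff)
  also have "\<dots> \<longleftrightarrow> (f has_integral b) A \<and> (\<lambda>x. norm (f x)) integrable_on A"
    unfolding lin has_integral_c2v integrable_on_def has_integral_c2v[of "\<lambda>x. norm (f x)"] ..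
  also have "\<dots> \<longleftrightarrow> f absolutely_integrable_on A \<and> integral A f = b"
    unfolding absolutely_integrable_on_def by (auto simp: has_integral_iff)
  finally show ?thesis .
qed

text \<open>Multiplication by a complex number \<open>m\<close>, as a real linear map of the plane,
  has determinant \<open>(cmod m)\<^sup>2\<close>.\<close>

lemma absolute_integral_change_of_variables_holomorphic:
  fixes f g :: "complex \<Rightarrow> complex"
  assumes S: "open S" and g: "g holomorphic_on S" and inj: "inj_on g S"
  shows "(\<lambda>z. (cmod (deriv g z))\<^sup>2 *\<^sub>R f (g z)) absolutely_integrable_on S \<and> integral S (\<lambda>z. (cmod (deriv g z))\<^sup>2 *\<^sub>R f (g z)) = b
     \<longleftrightarrow> f absolutely_integrable_on (g ` S) \<and> integral (g ` S) f = b"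
proof -
  define G where "G x = c2v (g (v2c x))" for x
  define G' where "G' x h = c2v (deriv g (v2c x) * v2c h)" for x h
  define F where "F x = c2v (f (v2c x))" for x
  have dv: "(c2v has_derivative c2v) (at x within X)" "(v2c has_derivative v2c) (at y within Y)" for x y X Y
    using bounded_linear_c2v bounded_linear_v2c by (auto intro: bounded_linear_imp_has_derivative)
  have der: "(G has_derivative G' x) (at x within c2v ` S)" if "x \<in> c2v ` S" for x
  proof -
    have "v2c x \<in> S" using that by auto
    then have "(g has_field_derivative deriv g (v2c x)) (at (v2c x))"
      using g S holomorphic_derivI by blast
    then have "(g has_derivative (*) (deriv g (v2c x))) (at (v2c x))"
      by (simp add: has_field_derivative_def)
    from has_derivative_compose[OF has_derivative_compose[OF dv(2) this] dv(1)]
    show ?thesis unfolding G_def[abs_def] G'_def[abs_def] .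
  qed
  have leb: "c2v ` S \<in> sets lebesgue"
  proof -
    have "c2v ` S = v2c -` S" by (force simp: image_iff intro: v2c_c2v(2)[symmetric])
    moreover have "open (v2c -` S)"
      using S bounded_linear_v2c by (intro open_vimage) (auto simp: linear_continuous_on)
    ultimately show ?thesis by simp
  qed
  have injG: "inj_on G (c2v ` S)"
    using inj by (auto simp: inj_on_def G_def) (metis v2c_c2v(1))
  have det: "\<bar>det (matrix (G' x))\<bar> = (cmod (deriv g (v2c x)))\<^sup>2" for x
    unfolding cmod_power2 by (simp add: det_2 matrix_def G'_def axis_def power2_eq_square)
  have *: "(\<lambda>x. \<bar>det (matrix (G' x))\<bar> *\<^sub>R F (G x)) = (\<lambda>x. c2v ((\<lambda>z. (cmod (deriv g z))\<^sup>2 *\<^sub>R f (g z)) (v2c x)))"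
    unfolding det using bounded_linear_c2v by (simp add: F_def G_def fun_eq_iff linear_simps)
  have im: "G ` c2v ` S = c2v ` g ` S" by (simp add: G_def image_image)
  show ?thesis
    using has_absolute_integral_change_of_variables[OF leb der injG, of F "c2v b"]
      absolutely_integrable_c2v[of S "\<lambda>z. (cmod (deriv g z))\<^sup>2 *\<^sub>R f (g z)" b] absolutely_integrable_c2v[of "g ` S" f b]
    unfolding * im unfolding F_def by simp
qed

section \<open>Moebius transformations of the upper half plane\<close>

lemma matrix_inv_SL2:
  fixes g :: "real^2^2"
  assumes "det g = 1"
  shows "matrix_inv g ** g = mat 1" "g ** matrix_inv g = mat 1" "det (matrix_inv g) = 1"
proof -
  have "invertible g" using assms by (simp add: invertible_det_nz)
  then show 1: "matrix_inv g ** g = mat 1" and "g ** matrix_inv g = mat 1"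
    using someI_ex[of "\<lambda>A'. g ** A' = mat 1 \<and> A' ** g = mat 1"] unfolding invertible_def matrix_inv_def by auto
  have "det (matrix_inv g) * det g = 1"
    unfolding det_mul[symmetric] 1 by simp
  then show "det (matrix_inv g) = 1" using assms by simp
qed

lemma upper_half_plane_simps: "open \<H>" "convex \<H>" "z \<in> \<H> \<longleftrightarrow> Im z > 0"
  by (auto simp: upper_half_plane_def open_halfspace_Im_gt convex_halfspace_Im_gt)

text \<open>The automorphy factor of \<open>g\<close>; the derivative of \<open>mob g\<close> is its
  inverse square.\<close>

definition mob_den :: "real^2^2 \<Rightarrow> complex \<Rightarrow> complex" where
  "mob_den g z = of_real (g$2$1) * z + of_real (g$2$2)"

lemma mob_den_nonzero:
  assumes "det g = 1" "z \<in> \<H>"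
  shows "mob_den g z \<noteq> 0"
proof
  assume *: "mob_den g z = 0"
  then have "g$2$1 * Im z = 0" by (auto simp: mob_den_def complex_eq_iff)
  then have "g$2$1 = 0" using assms(2) by (simp add: upper_half_plane_def)
  then show False using * assms(1) by (simp add: mob_den_def det_2 complex_eq_iff)
qed

text \<open>After cross-multiplication the coefficient of \<open>z - w\<close> is the determinant.
  The identity yields the invariance of \<open>hyp_gauge\<close> and the transformation of the
  Cauchy kernel.\<close>

lemma mob_diff:
  assumes "det g = 1" "z \<in> \<H>" "w \<in> \<H>"
  shows "mob g z - mob g w = (z - w) / (mob_den g z * mob_den g w)"
proof -
  have d: "mob_den g z \<noteq> 0" "mob_den g w \<noteq> 0" using mob_den_nonzero assms by auto
  have "of_real (g$1$1) * of_real (g$2$2) - of_real (g$1$2) * of_real (g$2$1) = (1::complex)"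
    using assms(1) by (simp add: det_2 flip: of_real_mult of_real_diff)
  then have "(of_real (g$1$1) * z + of_real (g$1$2)) * mob_den g w - (of_real (g$1$1) * w + of_real (g$1$2)) * mob_den g z = z - w"
    unfolding mob_den_def by algebra
  then show ?thesis using d
    unfolding mob_def mob_den_def[symmetric] by (simp add: diff_frac_eq)
qed

lemma Im_mob:
  assumes "det g = 1" "z \<in> \<H>"
  shows "Im (mob g z) = Im z / (cmod (mob_den g z))\<^sup>2"
proof -
  have "Im (mob g z) = Im ((of_real (g$1$1) * z + of_real (g$1$2)) * cnj (mob_den g z)) / (cmod (mob_den g z))\<^sup>2"
    unfolding mob_def mob_den_def[symmetric] by (subst complex_div_cnj) simp
  also have "Im ((of_real (g$1$1) * z + of_real (g$1$2)) * cnj (mob_den g z)) = Im z * det g"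
    by (simp add: mob_den_def det_2 algebra_simps)
  finally show ?thesis using assms by simp
qed

lemma mob_upper_half_plane:
  assumes "det g = 1" "z \<in> \<H>"
  shows "mob g z \<in> \<H>"
  using Im_mob[OF assms] mob_den_nonzero[OF assms] assms(2) by (simp add: upper_half_plane_def)

lemma mob_mult:
  assumes "det g = 1" "det h = 1" "z \<in> \<H>"
  shows "mob (g ** h) z = mob g (mob h z)"
proof -
  have d: "mob_den h z \<noteq> 0" using mob_den_nonzero assms by auto
  have d': "of_real (g$2$1) * mob h z + of_real (g$2$2) \<noteq> 0"
    using mob_den_nonzero[OF assms(1) mob_upper_half_plane[OF assms(2,3)]] by (simp add: mob_den_def)
  show ?thesis
    using d d'
    unfolding mob_def[of "g ** h"] mob_def[of g] 
    by (simp add: matrix_matrix_mult_def sum_2 mob_def[of h] mob_den_def[symmetric] divide_simps)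
       (simp add: mob_den_def algebra_simps)
qed

lemma mob_mat_1 [simp]: "mob (mat 1) z = z"
  by (simp add: mob_def mat_def)

lemma mob_uminus [simp]: "mob (- g) z = mob g z"
proof -
  have "mob (- g) z = (- (of_real (g$1$1) * z + of_real (g$1$2))) / (- (of_real (g$2$1) * z + of_real (g$2$2)))"
    by (simp add: mob_def)
  then show ?thesis by (simp only: minus_divide_divide mob_def)
qed

lemma mob_inverse:
  assumes "det g = 1" "z \<in> \<H>"
  shows "mob (matrix_inv g) (mob g z) = z" "mob g (mob (matrix_inv g) z) = z"
  using mob_mult[of "matrix_inv g" g z] mob_mult[of g "matrix_inv g" z] matrix_inv_SL2[OF assms(1)] assms by auto

lemma mob_has_field_derivative:
  assumes "det g = 1" "z \<in> \<H>"
  shows "(mob g has_field_derivative 1 / (mob_den g z)\<^sup>2) (at z)"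
proof -
  have d: "mob_den g z \<noteq> 0" using mob_den_nonzero assms by auto
  have "((\<lambda>z. (of_real (g$1$1) * z + of_real (g$1$2)) / mob_den g z) has_field_derivative
     (of_real (g$1$1) * mob_den g z - (of_real (g$1$1) * z + of_real (g$1$2)) * of_real (g$2$1)) / (mob_den g z * mob_den g z)) (at z)"
    using d unfolding mob_den_def by (auto intro!: derivative_eq_intros)
  moreover have "of_real (g$1$1) * of_real (g$2$2) - of_real (g$1$2) * of_real (g$2$1) = (1::complex)"
    using assms(1) by (simp add: det_2 flip: of_real_mult of_real_diff)
  then have "of_real (g$1$1) * mob_den g z - (of_real (g$1$1) * z + of_real (g$1$2)) * of_real (g$2$1) = 1"
    unfolding mob_den_def by algebra
  ultimately show ?thesis unfolding mob_def[abs_def] mob_den_def[symmetric] by (simp add: power2_eq_square)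
qed

lemma deriv_mob: "det g = 1 \<Longrightarrow> z \<in> \<H> \<Longrightarrow> deriv (mob g) z = 1 / (mob_den g z)\<^sup>2"
  by (rule DERIV_imp_deriv[OF mob_has_field_derivative])

lemma holomorphic_mob: "det g = 1 \<Longrightarrow> mob g holomorphic_on \<H>"
  using mob_has_field_derivative upper_half_plane_simps(1) by (auto simp: holomorphic_on_open field_differentiable_def)

lemma analytic_mob: "det g = 1 \<Longrightarrow> mob g analytic_on \<H>"
  using holomorphic_mob upper_half_plane_simps(1) by (simp add: analytic_on_open)

lemma mob_image: "det g = 1 \<Longrightarrow> mob g ` \<H> = \<H>"
  using mob_upper_half_plane mob_inverse(2) matrix_inv_SL2(3) by (auto simp: image_iff) metis

lemma inj_on_mob: "det g = 1 \<Longrightarrow> inj_on (mob g) \<H>"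
  by (metis inj_onI mob_inverse(1))

lemma borel_measurable_mob [measurable]: "mob g \<in> borel_measurable borel"
  unfolding mob_def[abs_def] by measurable

text \<open>Equals \<open>2 * (cosh d - 1)\<close> for the hyperbolic distance d.\<close>

definition hyp_gauge :: "complex \<Rightarrow> complex \<Rightarrow> real" where
  "hyp_gauge z w = (cmod (z - w))\<^sup>2 / (Im z * Im w)"

lemma hyp_gauge_mob:
  assumes "det g = 1" "z \<in> \<H>" "w \<in> \<H>"
  shows "hyp_gauge (mob g z) (mob g w) = hyp_gauge z w"
  using mob_den_nonzero[OF assms(1,2)] mob_den_nonzero[OF assms(1,3)]
  by (simp add: hyp_gauge_def mob_diff[OF assms] Im_mob[OF assms(1,2)] Im_mob[OF assms(1,3)] norm_divide norm_mult
      power_divide power_mult_distrib)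

text \<open>If \<open>z\<close> has distance \<open>x\<close> from \<open>w\<close>, its height is
  at most \<open>y + x\<close>, so the gauge is at least \<open>x\<^sup>2 / ((y + x) * y)\<close>.
  This is increasing in \<open>x\<close>, and \<open>e\<close> is its value at
  \<open>x = r\<close>.\<close>

lemma hyp_gauge_small:
  assumes "w \<in> \<H>" "r > 0"
  obtains e where "e > 0" "\<And>z. z \<in> \<H> \<Longrightarrow> hyp_gauge z w < e \<Longrightarrow> cmod (z - w) < r"
proof -
  define y where "y = Im w"
  have y: "y > 0" using assms by (simp add: y_def upper_half_plane_def)
  define e where "e = r\<^sup>2 / (y * (y + r))"
  show thesis
  proof
    show "e > 0" using y assms by (simp add: e_def)
    fix z assume z: "z \<in> \<H>" "hyp_gauge z w < e"
    show "cmod (z - w) < r"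
    proof (rule ccontr)
      define x where "x = cmod (z - w)"
      assume "\<not> cmod (z - w) < r"
      then have x: "r \<le> x" by (simp add: x_def)
      have "Im z \<le> y + x" using abs_Im_le_cmod[of "z - w"] by (simp add: x_def y_def)
      moreover have "Im z > 0" using z by (simp add: upper_half_plane_def)
      ultimately have "x\<^sup>2 / ((y + x) * y) \<le> hyp_gauge z w"
        unfolding hyp_gauge_def x_def[symmetric] y_def[symmetric] using y
        by (intro divide_left_mono mult_right_mono mult_pos_pos) auto
      moreover have "e \<le> x\<^sup>2 / ((y + x) * y)"
      proof -
        have "r\<^sup>2 * (y + x) \<le> x\<^sup>2 * (y + r)"
        proof -
          have "r\<^sup>2 * y \<le> x\<^sup>2 * y" using x assms(2) y by (intro mult_right_mono power_mono) auto
          moreover have "r\<^sup>2 * x \<le> x\<^sup>2 * r"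
            using mult_left_mono[OF x, of "r * x"] x assms(2) by (simp add: power2_eq_square mult_ac)
          ultimately show ?thesis by (simp add: distrib_left)
        qed
        then show ?thesis unfolding e_def using x assms(2) y
          by (simp add: divide_simps mult_ac)
      qed
      ultimately show False using z(2) by linarith
    qed
  qed
qed

text \<open>At the two end points the two-sided derivatives may differ, as they see parameters
  outside the unit interval; these two points do not affect the integral.\<close>

lemma contour_integral_path_cong:
  assumes "\<And>t. t \<in> {0..1} \<Longrightarrow> p t = q t"
  shows "contour_integral p f = contour_integral q f"
  unfolding contour_integral_integral
proof (rule integral_spike[where S="{0,1}"])
  fix t :: real assume t: "t \<in> {0..1} - {0,1}"
  have "eventually (\<lambda>x. p x = q x) (nhds t)"
    using t assms by (intro eventually_nhds_in_open[THEN eventually_mono, of "{0<..<1}"]) auto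
  then have "vector_derivative p (at t) = vector_derivative q (at t)"
    by (intro vector_derivative_cong_eq) auto
  then show "f (q t) * vector_derivative q (at t) = f (p t) * vector_derivative p (at t)"
    using assms[of t] t by simp
qed simp

text \<open>Partial fractions for the pulled back kernel: besides the pole at the preimage of
  \<open>w\<close> there is one at the preimage of infinity, which lies outside the half plane. Its
  contribution therefore depends only on the ends of \<open>c\<close>.\<close>

lemma contour_integral_mob_inversediff:
  assumes "det g = 1" "valid_path c" "path_image c \<subseteq> \<H>" "w \<in> \<H>"
    and w: "mob (matrix_inv g) w \<notin> path_image c"
  shows "contour_integral (mob g \<circ> c) (\<lambda>z. 1 / (z - w))
      = contour_integral c (\<lambda>z. 1 / (z - mob (matrix_inv g) w)) - contour_integral c (\<lambda>z. of_real (g$2$1) / mob_den g z)"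
proof -
  define v where "v = mob (matrix_inv g) w"
  have v: "v \<in> \<H>" "mob g v = w"
    using assms mob_upper_half_plane matrix_inv_SL2(3) mob_inverse(2) by (auto simp: v_def)
  have "contour_integral (mob g \<circ> c) (\<lambda>z. 1 / (z - w)) = contour_integral c (\<lambda>z. deriv (mob g) z * (1 / (mob g z - w)))"
    by (rule contour_integral_comp_analyticW[OF analytic_mob[OF assms(1)] assms(2,3)])
  also have "\<dots> = contour_integral c (\<lambda>z. 1 / (z - v) - of_real (g$2$1) / mob_den g z)"
  proof (rule contour_integral_cong[OF refl])
    fix z assume z: "z \<in> path_image c"
    then have zH: "z \<in> \<H>" using assms by auto
    have nz: "mob_den g z \<noteq> 0" "mob_den g v \<noteq> 0" using mob_den_nonzero assms(1) zH v by auto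
    have "z \<noteq> v" using z w by (auto simp: v_def)
    have "deriv (mob g) z * (1 / (mob g z - w)) = 1 / (mob_den g z)\<^sup>2 * (1 / ((z - v) / (mob_den g z * mob_den g v)))"
      using deriv_mob[OF assms(1) zH] mob_diff[OF assms(1) zH v(1)] v(2) by simp
    also have "\<dots> = mob_den g v / (mob_den g z * (z - v))"
      using nz \<open>z \<noteq> v\<close> by (simp add: field_simps power2_eq_square)
    also have "mob_den g v = mob_den g z - of_real (g$2$1) * (z - v)"
      by (simp add: mob_den_def algebra_simps)
    also have "(mob_den g z - of_real (g$2$1) * (z - v)) / (mob_den g z * (z - v)) = 1 / (z - v) - of_real (g$2$1) / mob_den g z"
      using nz \<open>z \<noteq> v\<close> by (simp add: diff_divide_distrib)
    finally show "deriv (mob g) z * (1 / (mob g z - w)) = 1 / (z - v) - of_real (g$2$1) / mob_den g z" .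
  qed
  also have "\<dots> = contour_integral c (\<lambda>z. 1 / (z - v)) - contour_integral c (\<lambda>z. of_real (g$2$1) / mob_den g z)"
  proof (rule contour_integral_diff)
    show "(\<lambda>z. 1 / (z - v)) contour_integrable_on c"
      using contour_integrable_inversediff[OF assms(2)] w by (simp add: v_def)
    have "(\<lambda>z. of_real (g$2$1) / mob_den g z) holomorphic_on \<H>"
      using mob_den_nonzero[OF assms(1)] by (intro holomorphic_intros) (auto simp: mob_den_def intro!: holomorphic_intros)
    then show "(\<lambda>z. of_real (g$2$1) / mob_den g z) contour_integrable_on c"
      by (rule contour_integrable_holomorphic_simple[OF _ upper_half_plane_simps(1) assms(2,3)])
  qed
  finally show ?thesis by (simp add: v_def)
qed

lemma mob_path:
  assumes "det g = 1" "valid_path c" "path_image c \<subseteq> \<H>"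
  shows "valid_path (mob g \<circ> c)" "path_image (mob g \<circ> c) \<subseteq> \<H>"
  using valid_path_compose_holomorphic[OF assms(2) holomorphic_mob[OF assms(1)] upper_half_plane_simps(1) assms(3)]
    mob_upper_half_plane[OF assms(1)] assms(3) by (auto simp: path_image_compose)

section \<open>Loops and their translates\<close>

lemma lborel_set_integrable_iff_absolutely_integrable:
  fixes f :: "'a::euclidean_space \<Rightarrow> 'b::euclidean_space"
  assumes m: "(\<lambda>x. indicator S x *\<^sub>R f x) \<in> borel_measurable lborel"
  shows "integrable lborel (\<lambda>x. indicator S x *\<^sub>R f x) \<longleftrightarrow> f absolutely_integrable_on S"
    and "f absolutely_integrable_on S \<Longrightarrow> (LINT x|lborel. indicator S x *\<^sub>R f x) = integral S f"
proof -
  show "integrable lborel (\<lambda>x. indicator S x *\<^sub>R f x) \<longleftrightarrow> f absolutely_integrable_on S"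
    unfolding set_integrable_def using integrable_completion[OF m] by simp
  show "(LINT x|lborel. indicator S x *\<^sub>R f x) = integral S f" if "f absolutely_integrable_on S"
    using set_lebesgue_integral_eq_integral(2)[OF that] integral_completion[OF m] by (simp add: set_lebesgue_integral_def)
qed

lemma integral_mob_substitution:
  fixes f :: "complex \<Rightarrow> complex"
  assumes g: "det g = 1" and f [measurable]: "f \<in> borel_measurable borel"
    and int: "integrable lborel (\<lambda>z. indicator \<H> z *\<^sub>R ((cmod (deriv (mob g) z))\<^sup>2 *\<^sub>R f (mob g z)))"
  shows "integrable lborel (\<lambda>w. indicator \<H> w *\<^sub>R f w)"
    and "(LINT w|lborel. indicator \<H> w *\<^sub>R f w)
       = (LINT z|lborel. indicator \<H> z *\<^sub>R ((cmod (deriv (mob g) z))\<^sup>2 *\<^sub>R f (mob g z)))"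
proof -
  let ?H = \<H> and ?f = "\<lambda>z. (cmod (deriv (mob g) z))\<^sup>2 *\<^sub>R f (mob g z)"
  have [measurable]: "?H \<in> sets borel" by (simp add: upper_half_plane_simps(1))
  have m1: "(\<lambda>w. indicator ?H w *\<^sub>R f w) \<in> borel_measurable lborel" by measurable
  have m2: "(\<lambda>z. indicator ?H z *\<^sub>R ?f z) \<in> borel_measurable lborel" using int by simp
  have a2: "?f absolutely_integrable_on ?H"
    using lborel_set_integrable_iff_absolutely_integrable(1)[OF m2] int by simp
  have "f absolutely_integrable_on ?H \<and> integral ?H f = integral ?H ?f"
    using absolute_integral_change_of_variables_holomorphic[OF upper_half_plane_simps(1) holomorphic_mob[OF g] inj_on_mob[OF g], of f]
      a2 mob_image[OF g] by auto
  then show "integrable lborel (\<lambda>w. indicator ?H w *\<^sub>R f w)"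
    and "(LINT w|lborel. indicator ?H w *\<^sub>R f w) = (LINT z|lborel. indicator ?H z *\<^sub>R ?f z)"
    using lborel_set_integrable_iff_absolutely_integrable[OF m1] lborel_set_integrable_iff_absolutely_integrable(2)[OF m2 a2]
    by auto
qed

lemma compact_in_box_upper_half_plane:
  assumes "compact C" "C \<subseteq> \<H>"
  obtains l u where "C \<subseteq> box l u" "cbox l u \<subseteq> \<H>"
proof (cases "C = {}")
  case True
  show thesis by (rule that[of \<i> \<i>]) (auto simp: True upper_half_plane_def in_cbox_complex_iff)
next
  case False
  obtain B where B: "\<And>z. z \<in> C \<Longrightarrow> cmod z \<le> B"
    using assms(1) compact_imp_bounded bounded_iff by metis
  have "continuous_on C Im" by (intro continuous_intros)
  then obtain z0 where z0: "z0 \<in> C" "\<And>z. z \<in> C \<Longrightarrow> Im z0 \<le> Im z"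
    using continuous_attains_inf[OF assms(1) False] by blast
  have "Im z0 > 0" using z0 assms(2) by (auto simp: upper_half_plane_def)
  show thesis
  proof (rule that[of "Complex (- B - 1) (Im z0 / 2)" "Complex (B + 1) (B + 1)"])
    show "C \<subseteq> box (Complex (- B - 1) (Im z0 / 2)) (Complex (B + 1) (B + 1))"
    proof
      fix z assume z: "z \<in> C"
      show "z \<in> box (Complex (- B - 1) (Im z0 / 2)) (Complex (B + 1) (B + 1))"
        using B[OF z] z0(2)[OF z] abs_Re_le_cmod[of z] abs_Im_le_cmod[of z] \<open>Im z0 > 0\<close>
        by (simp add: in_box_complex_iff) (intro conjI; linarith)
    qed
    show "cbox (Complex (- B - 1) (Im z0 / 2)) (Complex (B + 1) (B + 1)) \<subseteq> \<H>"
      using \<open>Im z0 > 0\<close> by (auto simp: in_cbox_complex_iff upper_half_plane_def)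
  qed
qed

lemma contour_integral_holomorphic_endpoints:
  assumes "f holomorphic_on S" "open S" "convex S" "valid_path p" "path_image p \<subseteq> S" "valid_path q" "path_image q \<subseteq> S"
    "pathstart p = pathstart q" "pathfinish p = pathfinish q"
  shows "contour_integral p f = contour_integral q f"
proof -
  obtain G where G: "\<And>z. z \<in> S \<Longrightarrow> (G has_field_derivative f z) (at z within S)"
    using holomorphic_convex_primitive'[OF assms(3,2,1)] by blast
  show ?thesis
    using contour_integral_primitive[OF G assms(4,5)] contour_integral_primitive[OF G assms(6,7)] assms(8,9)
    by (simp add: contour_integral_unique)
qed

text \<open>The half plane with hyperbolic discs about the points of \<open>B\<close> removed. A
  Moebius transformation maps such a region to another one with moved centres and the same
  \<open>n\<close>, which Euclidean discs would not allow.\<close>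

definition gauge_away :: "complex set \<Rightarrow> nat \<Rightarrow> complex set" where
  "gauge_away B n = {z \<in> \<H>. \<forall>q\<in>B. inverse (Suc n) \<le> hyp_gauge z q}"

lemma gauge_away_measurable [measurable]: "finite B \<Longrightarrow> gauge_away B n \<in> sets borel"
proof -
  assume "finite B"
  have "gauge_away B n = \<H> \<inter> (\<Inter>q\<in>B. {z. inverse (Suc n) \<le> hyp_gauge z q})"
    by (auto simp: gauge_away_def)
  moreover have "{z. inverse (Suc n) \<le> hyp_gauge z q} \<in> sets borel" for q
    unfolding hyp_gauge_def by measurable
  then have "\<H> \<inter> (\<Inter>q\<in>B. {z. inverse (Suc n) \<le> hyp_gauge z q}) \<in> sets borel"
    using \<open>finite B\<close> by (cases "B = {}") (auto intro!: sets.Int sets.finite_INT simp: upper_half_plane_simps(1))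
  ultimately show ?thesis by simp
qed

lemma gauge_away_mob:
  assumes "det g = 1" "B \<subseteq> \<H>" "z \<in> \<H>"
  shows "mob g z \<in> gauge_away B n \<longleftrightarrow> z \<in> gauge_away (mob (matrix_inv g) ` B) n"
proof -
  have "hyp_gauge (mob g z) q = hyp_gauge z (mob (matrix_inv g) q)" if "q \<in> B" for q
    using hyp_gauge_mob[OF assms(1,3), of "mob (matrix_inv g) q"] mob_inverse(2)[OF assms(1), of q]
      mob_upper_half_plane matrix_inv_SL2(3)[OF assms(1)] that assms(2) by auto
  then show ?thesis using mob_upper_half_plane[OF assms(1,3)] assms(3) by (auto simp: gauge_away_def)
qed

lemma hyp_gauge_pos: "z \<in> \<H> \<Longrightarrow> q \<in> \<H> \<Longrightarrow> z \<noteq> q \<Longrightarrow> hyp_gauge z q > 0"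
  by (simp add: hyp_gauge_def upper_half_plane_def)

lemma eventually_gauge_away:
  assumes "finite B" "B \<subseteq> \<H>" "z \<in> \<H> - B"
  shows "eventually (\<lambda>n. z \<in> gauge_away B n) sequentially"
proof -
  have "eventually (\<lambda>n. inverse (Suc n) \<le> hyp_gauge z q) sequentially" if "q \<in> B" for q
  proof -
    have "hyp_gauge z q > 0" using hyp_gauge_pos assms that by auto
    then have "eventually (\<lambda>n. inverse (Suc n) < hyp_gauge z q) sequentially"
      using LIMSEQ_inverse_real_of_nat by (rule order_tendstoD(2)[rotated])
    then show ?thesis by eventually_elim simp
  qed
  then have "eventually (\<lambda>n. \<forall>q\<in>B. inverse (Suc n) \<le> hyp_gauge z q) sequentially"
    using assms(1) by (simp add: eventually_ball_finite)
  then show ?thesis using assms(3) by (auto simp: gauge_away_def)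
qed

text \<open>Small hyperbolic discs about finitely many points are disjoint, so near one centre a
  cutoff depends on that centre alone.\<close>

lemma hyp_gauge_separation:
  assumes "finite C" "C \<subseteq> \<H>"
  obtains n0 :: nat where "\<And>q q' z. q \<in> C \<Longrightarrow> q' \<in> C \<Longrightarrow> q \<noteq> q' \<Longrightarrow> z \<in> \<H> \<Longrightarrow>
     hyp_gauge z q < inverse (Suc n0) \<Longrightarrow> inverse (Suc n0) \<le> hyp_gauge z q'"
proof -
  obtain d where d: "d > 0" "\<And>q q'. q \<in> C \<Longrightarrow> q' \<in> C \<Longrightarrow> q \<noteq> q' \<Longrightarrow> d \<le> dist q q'"
  proof (cases "C = {}")
    case False
    have "\<exists>d>0. \<forall>q'\<in>C. q \<noteq> q' \<longrightarrow> d \<le> dist q q'" for q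
      using finite_set_avoid[OF assms(1), of q] by metis
    then obtain D where D: "\<And>q. D q > 0" "\<And>q q'. q' \<in> C \<Longrightarrow> q \<noteq> q' \<Longrightarrow> D q \<le> dist q q'" by metis
    show thesis
      by (rule that[of "Min (D ` C)"]) (use False assms(1) D in \<open>auto simp: Min_le_iff\<close>)
  qed (use that[of 1] in auto)
  have "\<exists>e>0. \<forall>z\<in>\<H>. hyp_gauge z q < e \<longrightarrow> cmod (z - q) < d / 2" if "q \<in> C" for q
    using hyp_gauge_small[of q "d/2"] that assms(2) d(1) by (metis half_gt_zero subsetD)
  then obtain e where e: "\<And>q. q \<in> C \<Longrightarrow> e q > 0" "\<And>q z. q \<in> C \<Longrightarrow> z \<in> \<H> \<Longrightarrow> hyp_gauge z q < e q \<Longrightarrow> cmod (z - q) < d / 2"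
    by metis
  have "eventually (\<lambda>n. inverse (Suc n) < e q) sequentially" if "q \<in> C" for q
    using LIMSEQ_inverse_real_of_nat e(1)[OF that] by (rule order_tendstoD(2))
  then have "eventually (\<lambda>n. \<forall>q\<in>C. inverse (Suc n) < e q) sequentially"
    using assms(1) by (simp add: eventually_ball_finite)
  then obtain n0 where n0: "\<forall>q\<in>C. inverse (Suc n0) < e q" by (auto simp: eventually_sequentially)
  show thesis
  proof (rule that[of n0], rule ccontr)
    fix q q' z assume q: "q \<in> C" "q' \<in> C" "q \<noteq> q'" "z \<in> \<H>" "hyp_gauge z q < inverse (Suc n0)"
      "\<not> inverse (Suc n0) \<le> hyp_gauge z q'"
    then have "cmod (z - q) < d / 2" "cmod (z - q') < d / 2"
      using e(2)[of q z] e(2)[of q' z] n0 by force+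
    then have "dist q q' < d" using dist_triangle_half_r[of z q d q'] by (simp add: dist_norm norm_minus_commute)
    then show False using d(2)[OF q(1-3)] by simp
  qed
qed


text \<open>For paths with common ends this is \<open>2 * pi * \<i>\<close> times the winding number
  of the loop formed by \<open>c'\<close> and the reverse of \<open>c\<close>. It is set to 0 on the
  paths, which are null sets, and off the half plane.\<close>

definition loop_kernel :: "(real \<Rightarrow> complex) \<Rightarrow> (real \<Rightarrow> complex) \<Rightarrow> complex \<Rightarrow> complex" where
  "loop_kernel c c' w = indicator (\<H> - (path_image c \<union> path_image c')) w *\<^sub>R
     (contour_integral c' (\<lambda>z. 1 / (z - w)) - contour_integral c (\<lambda>z. 1 / (z - w)))"

lemma borel_measurable_loop_kernel:
  assumes "valid_path c" "valid_path c'"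
  shows "loop_kernel c c' \<in> borel_measurable borel"
proof -
  let ?U = "\<H> - (path_image c \<union> path_image c')"
  have p: "path c" "path c'" using assms valid_path_imp_path by auto
  have "continuous_on ?U (\<lambda>w. 2 * pi * \<i> * (winding_number c' w - winding_number c w))"
    by (intro continuous_intros continuous_on_subset[OF continuous_on_winding_number[OF p(1)]]
        continuous_on_subset[OF continuous_on_winding_number[OF p(2)]]) auto
  moreover have "?U \<in> sets borel"
    using closed_path_image[OF p(1)] closed_path_image[OF p(2)] upper_half_plane_simps(1) by auto
  ultimately have "(\<lambda>w. indicator ?U w *\<^sub>R (2 * pi * \<i> * (winding_number c' w - winding_number c w))) \<in> borel_measurable borel"
    by (intro borel_measurable_continuous_on_indicator)
  also have "(\<lambda>w. indicator ?U w *\<^sub>R (2 * pi * \<i> * (winding_number c' w - winding_number c w))) = loop_kernel c c'"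
    by (auto simp: fun_eq_iff loop_kernel_def indicator_def winding_number_valid_path assms algebra_simps)
  finally show ?thesis .
qed

text \<open>Here \<open>c\<close> is an edge of the given polygon, \<open>c'\<close> its straight
  replacement, \<open>S\<close> contains the parameters at which \<open>c\<close> may fail to be C1,
  and \<open>K\<close> is the density.\<close>

locale side_pair =
  fixes c c' :: "real \<Rightarrow> complex" and S :: "real set" and K :: "complex \<Rightarrow> complex"
  assumes c: "valid_path c" "path_image c \<subseteq> \<H>" and S: "finite S" "c C1_differentiable_on ({0..1} - S)"
    and c': "c' C1_differentiable_on {0..1}" "path_image c' \<subseteq> \<H>"
    and ends: "pathstart c' = pathstart c" "pathfinish c' = pathfinish c"
    and K: "continuous_on \<H> K"
begin

lemma valid': "valid_path c'" using C1_path(3)[OF c'(1)] .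

lemma borel_loop_kernel [measurable]: "loop_kernel c c' \<in> borel_measurable borel"
  by (rule borel_measurable_loop_kernel[OF c(1) valid'])

text \<open>Outside a rectangle around both paths the kernel vanishes, since
  \<open>1 / (z - w)\<close> has a primitive on the rectangle and the ends agree. Inside it the
  heights are bounded below, so the hyperbolic cutoff keeps a Euclidean distance from the
  exceptional points.\<close>

lemma integrable_loop_kernel:
  assumes B: "B \<subseteq> \<H>" "finite B" "c ` (S \<inter> {0..1}) \<subseteq> B"
  shows "integrable lborel (\<lambda>z. indicator (gauge_away B n) z *\<^sub>R (K z * loop_kernel c c' z))"
proof -
  let ?N = "path_image c \<union> path_image c'"
  have p: "path c" "path c'" using c(1) valid' valid_path_imp_path by auto
  have "compact ?N" using p by (simp add: compact_Un compact_path_image)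
  then obtain l u where lu: "?N \<subseteq> box l u" "cbox l u \<subseteq> \<H>"
    using compact_in_box_upper_half_plane[of ?N] c(2) c'(2) by blast
  have sub: "path_image c \<subseteq> cbox l u" "path_image c' \<subseteq> cbox l u" using lu(1) box_subset_cbox by blast+
  have N: "?N \<in> null_sets lborel" using null_sets_valid_path_image c(1) valid' by (intro null_sets.Un) auto
  have Kc: "continuous_on (cbox l u) K" using K lu(2) continuous_on_subset by blast
  let ?V = "gauge_away B n \<inter> cbox l u"
  have V: "?V \<in> sets borel" using gauge_away_measurable[OF B(2)] by auto
  have "pathstart c \<in> box l u" using lu(1) pathstart_in_path_image by blast
  then have l0: "Im l > 0" using lu(2) by (auto simp: in_box_complex_iff upper_half_plane_def subset_iff in_cbox_complex_iff dest!: spec[of _ l])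
  \<comment> \<open>A gauge of at least \<open>1 / (n + 1)\<close>, with height at least
    \<open>Im l\<close> for \<open>w\<close> and at least \<open>m\<close> for the exceptional
    points, forces the squared distance to be at least \<open>Im l * m / (n + 1)\<close>.\<close>
  obtain r where r: "r > 0" "\<And>w s. w \<in> ?V \<Longrightarrow> s \<in> S \<inter> {0..1} \<Longrightarrow> r \<le> norm (w - c s)"
  proof (cases "S \<inter> {0..1} = {}")
    case True
    then show thesis using that[of 1] by auto
  next
    case False
    define m where "m = Min ((\<lambda>s. Im (c s)) ` (S \<inter> {0..1}))"
    have fin: "finite ((\<lambda>s. Im (c s)) ` (S \<inter> {0..1}))" using S(1) by simp
    have "Im (c s) > 0" if "s \<in> S \<inter> {0..1}" for s
    proof -
      have "c s \<in> \<H>" using B that by blast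
      then show ?thesis by (simp add: upper_half_plane_def)
    qed
    then have m0: "m > 0" using fin False by (auto simp: m_def)
    show thesis
    proof (rule that[of "sqrt (inverse (Suc n) * (Im l * m))"])
      show "sqrt (inverse (Suc n) * (Im l * m)) > 0" using l0 m0 by simp
      fix w s assume w: "w \<in> ?V" and s: "s \<in> S \<inter> {0..1}"
      have ms: "m \<le> Im (c s)" using fin s by (simp add: m_def)
      have wl: "Im l \<le> Im w" using w by (auto simp: in_cbox_complex_iff)
      have "inverse (Suc n) \<le> (norm (w - c s))\<^sup>2 / (Im w * Im (c s))"
        using w s B(3) unfolding gauge_away_def hyp_gauge_def by blast
      then have "inverse (Suc n) * (Im w * Im (c s)) \<le> (norm (w - c s))\<^sup>2"
        using wl ms l0 m0 by (simp add: pos_le_divide_eq)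
      moreover have "inverse (Suc n) * (Im l * m) \<le> inverse (Suc n) * (Im w * Im (c s))"
        using wl ms l0 m0 by (intro mult_left_mono mult_mono) auto
      ultimately have "inverse (Suc n) * (Im l * m) \<le> (norm (w - c s))\<^sup>2"
        by (rule order_trans[rotated])
      then show "sqrt (inverse (Suc n) * (Im l * m)) \<le> norm (w - c s)"
        by (intro real_le_lsqrt) auto
    qed
  qed
  have i1: "integrable lborel (\<lambda>w. indicator (?V \<inter> (cbox l u - ?N)) w *\<^sub>R (K w * contour_integral c (\<lambda>z. 1 / (z - w))))"
    by (rule integrable_contour_integral_inversediff[OF c(1) sub(1) S N _ Kc r(1) V r(2)]) auto
  have i2: "integrable lborel (\<lambda>w. indicator (?V \<inter> (cbox l u - ?N)) w *\<^sub>R (K w * contour_integral c' (\<lambda>z. 1 / (z - w))))"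
    by (rule integrable_contour_integral_inversediff[OF valid' sub(2) _ _ N _ Kc, where S="{}" and r=1]) (use c'(1) V in auto)
  have "indicator (gauge_away B n) w *\<^sub>R (K w * loop_kernel c c' w)
     = indicator (?V \<inter> (cbox l u - ?N)) w *\<^sub>R (K w * contour_integral c' (\<lambda>z. 1 / (z - w)))
       - indicator (?V \<inter> (cbox l u - ?N)) w *\<^sub>R (K w * contour_integral c (\<lambda>z. 1 / (z - w)))" for w
  proof (cases "w \<in> cbox l u")
    case True
    then show ?thesis using lu(2) by (auto simp: indicator_def loop_kernel_def right_diff_distrib)
  next
    case False
    have "(\<lambda>z. 1 / (z - w)) holomorphic_on box l u"
      using False box_subset_cbox[of l u] by (intro holomorphic_intros) auto
    then have "contour_integral c' (\<lambda>z. 1 / (z - w)) = contour_integral c (\<lambda>z. 1 / (z - w))"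
      using lu(1) c(1) valid' ends by (intro contour_integral_holomorphic_endpoints[where S="box l u"]) auto
    then show ?thesis using False by (simp add: loop_kernel_def)
  qed
  then show ?thesis using Bochner_Integration.integrable_diff[OF i2 i1] by simp
qed

text \<open>Substituting \<open>w = mob g z\<close> removes \<open>g\<close> from the kernel: the
  invariant density absorbs the Jacobian, and the cutoff about \<open>B\<close> becomes one about
  the preimages of \<open>B\<close>, which include the exceptional points of
  \<open>c\<close>.\<close>

lemma loop_kernel_substitution:
  assumes B: "B \<subseteq> \<H>" "finite B" and g: "det g = 1" "(\<lambda>s. mob g (c s)) ` (S \<inter> {0..1}) \<subseteq> B"
    and inv: "\<And>z. z \<in> \<H> \<Longrightarrow> (cmod (deriv (mob g) z))\<^sup>2 *\<^sub>R K (mob g z) = K z"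
  shows "integrable lborel (\<lambda>w. indicator (gauge_away B n) w *\<^sub>R (K w * loop_kernel c c' (mob (matrix_inv g) w)))"
    and "(LINT w|lborel. indicator (gauge_away B n) w *\<^sub>R (K w * loop_kernel c c' (mob (matrix_inv g) w)))
      = (LINT z|lborel. indicator (gauge_away (mob (matrix_inv g) ` B) n) z *\<^sub>R (K z * loop_kernel c c' z))"
proof -
  let ?H = \<H> and ?B = "mob (matrix_inv g) ` B"
  let ?f = "\<lambda>w. indicator (gauge_away B n) w *\<^sub>R (K w * loop_kernel c c' (mob (matrix_inv g) w))"
  let ?f' = "\<lambda>z. indicator (gauge_away ?B n) z *\<^sub>R (K z * loop_kernel c c' z)"
  have [measurable]: "gauge_away B n \<in> sets borel" by (rule gauge_away_measurable[OF B(2)])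
  have "continuous_on (gauge_away B n) K" using K by (rule continuous_on_subset) (auto simp: gauge_away_def)
  then have [measurable]: "(\<lambda>w. indicator (gauge_away B n) w *\<^sub>R K w) \<in> borel_measurable borel"
    by (intro borel_measurable_continuous_on_indicator) auto
  have "(\<lambda>w. (indicator (gauge_away B n) w *\<^sub>R K w) * loop_kernel c c' (mob (matrix_inv g) w)) \<in> borel_measurable borel"
    by measurable
  then have m: "?f \<in> borel_measurable borel" by simp
  have B': "?B \<subseteq> ?H" "finite ?B" using B mob_upper_half_plane matrix_inv_SL2(3)[OF g(1)] by auto
  have "c ` (S \<inter> {0..1}) \<subseteq> ?B"
  proof
    fix x assume "x \<in> c ` (S \<inter> {0..1})"
    then obtain s where s: "s \<in> S \<inter> {0..1}" "x = c s" by auto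
    then have "x \<in> ?H" using c(2) by (auto simp: path_image_def)
    then have "x = mob (matrix_inv g) (mob g (c s))" using mob_inverse(1)[OF g(1)] s by simp
    then show "x \<in> ?B" using g(2) s by blast
  qed
  from integrable_loop_kernel[OF B' this] have i: "integrable lborel ?f'" .
  have eq: "indicator ?H z *\<^sub>R ((cmod (deriv (mob g) z))\<^sup>2 *\<^sub>R ?f (mob g z)) = ?f' z" for z
  proof (cases "z \<in> ?H")
    case True
    have "indicator (gauge_away B n) (mob g z) = (indicator (gauge_away ?B n) z :: real)"
      using gauge_away_mob[OF g(1) B(1) True] by (simp add: indicator_def)
    moreover have "(cmod (deriv (mob g) z))\<^sup>2 *\<^sub>R (K (mob g z) * X) = K z * X" for X
      using inv[OF True] by (metis mult_scaleR_left)
    ultimately show ?thesis using True mob_inverse(1)[OF g(1) True]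
      by (simp add: scaleR_left_commute[of "(cmod (deriv (mob g) z))\<^sup>2"] del: scaleR_scaleR)
  qed (simp add: gauge_away_def)
  have H: "indicator ?H w *\<^sub>R ?f w = ?f w" for w by (auto simp: gauge_away_def indicator_def)
  from integral_mob_substitution[OF g(1) m] i
  show "integrable lborel ?f" "(LINT w|lborel. ?f w) = (LINT z|lborel. ?f' z)"
    unfolding eq H by auto
qed

text \<open>The loop kernel need not be integrable near the points of \<open>c ` S\<close>. Close to such a point the two cutoffs eventually agree,
  so their difference is dominated by the kernel away from all these points.\<close>

lemma loop_kernel_pair_limit:
  assumes B: "B \<subseteq> \<H>" "finite B" and B': "B' \<subseteq> \<H>" "finite B'"
    and sub: "c ` (S \<inter> {0..1}) \<subseteq> B" "c ` (S \<inter> {0..1}) \<subseteq> B'"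
  shows "(\<lambda>n. (LINT z|lborel. indicator (gauge_away B n) z *\<^sub>R (K z * loop_kernel c c' z))
      - (LINT z|lborel. indicator (gauge_away B' n) z *\<^sub>R (K z * loop_kernel c c' z))) \<longlonglongrightarrow> 0"
proof -
  let ?k = "\<lambda>z. K z * loop_kernel c c' z" and ?C = "c ` (S \<inter> {0..1})"
  let ?d = "\<lambda>n z. indicator (gauge_away B n) z *\<^sub>R ?k z - indicator (gauge_away B' n) z *\<^sub>R ?k z"
  have C: "?C \<subseteq> \<H>" "finite ?C" using sub(1) B S(1) by auto
  note iB = integrable_loop_kernel[OF B sub(1)] and iB' = integrable_loop_kernel[OF B' sub(2)]
  have id: "integrable lborel (?d n)" for n by (rule Bochner_Integration.integrable_diff[OF iB iB'])
  obtain n0 where n0: "\<And>q q' z. q \<in> B \<union> B' \<Longrightarrow> q' \<in> B \<union> B' \<Longrightarrow> q \<noteq> q' \<Longrightarrow> z \<in> \<H> \<Longrightarrow>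
     hyp_gauge z q < inverse (Suc n0) \<Longrightarrow> inverse (Suc n0) \<le> hyp_gauge z q'"
    using hyp_gauge_separation[of "B \<union> B'"] B B' by (metis finite_Un Un_least)
  have bound: "norm (?d (n + n0) z) \<le> 2 * norm (indicator (gauge_away ?C n0) z *\<^sub>R ?k z)" for n z
  proof (cases "z \<in> gauge_away ?C n0 \<or> z \<notin> \<H>")
    case True
    then show ?thesis
    proof
      assume "z \<in> gauge_away ?C n0"
      then show ?thesis by (auto simp: indicator_def norm_mult)
    qed (auto simp: gauge_away_def)
  next
    case False
    then obtain q where q: "q \<in> ?C" "hyp_gauge z q < inverse (Suc n0)" and z: "z \<in> \<H>"
      by (auto simp: gauge_away_def not_le)
    have le: "inverse (real (Suc (n + n0))) \<le> inverse (Suc n0)" by (simp add: le_imp_inverse_le)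
    \<comment> \<open>All other centres are farther away than the cutoff radius and \<open>q\<close>
      is a centre of both cutoffs, so \<open>q\<close> alone decides membership in either.\<close>
    have "inverse (Suc (n + n0)) \<le> hyp_gauge z q'" if "q' \<in> B \<union> B'" "q' \<noteq> q" for q'
      using n0[of q q' z] q sub that z le by (metis UnI1 order_trans subsetD)
    then have "z \<in> gauge_away B (n + n0) \<longleftrightarrow> z \<in> gauge_away B' (n + n0)"
      using q(1) sub z unfolding gauge_away_def by blast
    then show ?thesis by (simp add: indicator_def)
  qed
  have "(\<lambda>n. LINT z|lborel. ?d (n + n0) z) \<longlonglongrightarrow> (LINT z|(lborel :: complex measure). (0::complex))"
  proof (rule integral_dominated_convergence[where s="\<lambda>n. ?d (n + n0)" and f="\<lambda>_. 0"
        and w="\<lambda>z. 2 * norm (indicator (gauge_away ?C n0) z *\<^sub>R ?k z)"])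
    show "integrable lborel (\<lambda>z. 2 * norm (indicator (gauge_away ?C n0) z *\<^sub>R ?k z))"
      by (intro integrable_mult_right integrable_norm integrable_loop_kernel[OF C]) auto
    show "?d (n + n0) \<in> borel_measurable lborel" for n using id by auto
    have "B \<union> B' \<in> null_sets lborel"
      using B(2) B'(2) by (intro finite_imp_null_set_lborel) auto
    from AE_not_in[OF this]
    show "AE z in lborel. (\<lambda>n. ?d (n + n0) z) \<longlonglongrightarrow> 0"
    proof eventually_elim
      case (elim z)
      show ?case
      proof (cases "z \<in> \<H>")
        case True
        have "eventually (\<lambda>n. z \<in> gauge_away B n) sequentially" "eventually (\<lambda>n. z \<in> gauge_away B' n) sequentially"
          using True elim B B' by (auto intro!: eventually_gauge_away)
        then have "eventually (\<lambda>n. ?d n z = 0) sequentially"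
          by eventually_elim simp
        then have "(\<lambda>n. ?d n z) \<longlonglongrightarrow> 0" by (rule tendsto_eventually)
        then show ?thesis by (rule LIMSEQ_ignore_initial_segment)
      qed (auto simp: gauge_away_def)
    qed
    show "AE z in lborel. norm (?d (n + n0) z) \<le> 2 * norm (indicator (gauge_away ?C n0) z *\<^sub>R ?k z)" for n
      using bound by (intro AE_I2) auto
  qed simp
  then have "(\<lambda>n. LINT z|lborel. ?d n z) \<longlonglongrightarrow> 0"
    using LIMSEQ_offset[of "\<lambda>n. LINT z|lborel. ?d n z" n0 0] by simp
  then show ?thesis using Bochner_Integration.integral_diff[OF iB iB'] by simp
qed

end

section \<open>The fundamental polygon\<close>

lemma C1_differentiable_compose_holomorphic:
  fixes c :: "real \<Rightarrow> complex"
  assumes c: "c C1_differentiable_on {0..1}" "path_image c \<subseteq> S" and f: "f holomorphic_on S" "open S"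
  shows "(f \<circ> c) C1_differentiable_on {0..1}"
proof -
  have d: "c differentiable at t" if "t \<in> {0..1}" for t using c(1) that by (auto simp: C1_differentiable_on_eq)
  have fd: "f field_differentiable at (c t)" if "t \<in> {0..1}" for t
    using c(2) f that holomorphic_on_imp_differentiable_at by (auto simp: path_image_def image_subset_iff)
  have vd: "((f \<circ> c) has_vector_derivative (vector_derivative c (at t) * deriv f (c t))) (at t)" if "t \<in> {0..1}" for t
    using d[OF that] fd[OF that]
    by (intro field_vector_diff_chain_at) (auto simp: vector_derivative_works field_differentiable_derivI)
  have "continuous_on {0..1} (\<lambda>t. vector_derivative c (at t) * deriv f (c t))"
  proof -
    have "continuous_on S (deriv f)" using f holomorphic_deriv holomorphic_on_imp_continuous_on by blast
    then have "continuous_on {0..1} (\<lambda>t. deriv f (c t))"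
      by (rule continuous_on_compose2[OF _ C1_path(1)[OF c(1)]]) (use c(2) in \<open>simp add: path_image_def\<close>)
    then show ?thesis by (rule continuous_on_mult[OF C1_path(2)[OF c(1)]])
  qed
  then show ?thesis unfolding C1_differentiable_on_def
    using vd by (intro exI[of _ "\<lambda>t. vector_derivative c (at t) * deriv f (c t)"]) auto
qed

lemma C1_differentiable_linepath: "linepath a b C1_differentiable_on {0..1}"
  unfolding C1_differentiable_on_def
  by (intro exI[of _ "\<lambda>_. b - a"]) (auto intro: has_vector_derivative_linepath_within)

lemma polygon_sides_append:
  "polygon_sides w (xs @ ys) = polygon_sides w xs @ polygon_sides (foldl (\<lambda>u (x, e). u ** x) w xs) ys"
  by (induction xs arbitrary: w) auto

lemma polygon_letters_Suc:
  "polygon_letters (Suc g) a b ca cb = polygon_letters g a b ca cb @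
     [(a (Suc g), ca (Suc g)), (b (Suc g), cb (Suc g)),
      (matrix_inv (a (Suc g)), mob (matrix_inv (a (Suc g))) \<circ> reversepath (ca (Suc g))),
      (matrix_inv (b (Suc g)), mob (matrix_inv (b (Suc g))) \<circ> reversepath (cb (Suc g)))]"
  by (simp add: polygon_letters_def)

lemma foldl_polygon_letters:
  "foldl (\<lambda>u (x, e). u ** x) (mat 1) (polygon_letters g a b ca cb) = Rprod a b g"
  by (induction g) (simp_all add: polygon_letters_Suc, simp_all add: polygon_letters_def comm_def matrix_mul_assoc)

text \<open>The four sides of the k-th block of the boundary word are the translates of the edges
  \<open>a_k, b_k, a_k, b_k\<close> by the following elements; the last two are traversed backwards.\<close>

definition side_a where "side_a a b k = Rprod a b (k - 1)"
definition side_b where "side_b a b k = Rprod a b (k - 1) ** a k"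
definition side_a' where "side_a' a b k = Rprod a b (k - 1) ** a k ** b k ** matrix_inv (a k)"
definition side_b' where "side_b' a b k = side_a' a b k ** matrix_inv (b k)"

lemma side_b'_eq: "k \<ge> 1 \<Longrightarrow> side_b' a b k = Rprod a b k"
  by (cases k) (simp_all add: side_b'_def side_a'_def comm_def matrix_mul_assoc)

lemma polygon_sides_eq:
  "polygon_sides (mat 1) (polygon_letters g a b ca cb) = concat (map (\<lambda>k.
     [mob (side_a a b k) \<circ> ca k, mob (side_b a b k) \<circ> cb k,
      mob (side_b a b k ** b k) \<circ> (mob (matrix_inv (a k)) \<circ> reversepath (ca k)),
      mob (side_a' a b k) \<circ> (mob (matrix_inv (b k)) \<circ> reversepath (cb k))]) [1..<Suc g])"
proof (induction g)
  case (Suc g)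
  have *: "[1..<Suc (Suc g)] = [1..<Suc g] @ [Suc g]" by simp
  show ?case
    unfolding polygon_letters_Suc polygon_sides_append Suc.IH foldl_polygon_letters * map_append concat_append
    by (simp add: side_a_def side_b_def side_a'_def)
qed (simp add: polygon_letters_def)

text \<open>The sum is taken side by side, without joining paths, and the edges are parameters, so
  that the given and the straight polygon can be compared term by term.\<close>

definition polygon_integral where
  "polygon_integral g a b ca cb f = (\<Sum>k=1..g.
      contour_integral (mob (side_a a b k) \<circ> ca k) f + contour_integral (mob (side_b a b k) \<circ> cb k) f
    - contour_integral (mob (side_a' a b k) \<circ> ca k) f - contour_integral (mob (side_b' a b k) \<circ> cb k) f)"

text \<open>The path conditions of \<open>standard_fuchsian\<close>, isolated so that straight
  segments can be substituted for the given edges.\<close>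

definition edge_paths where
  "edge_paths g a b v0 ca cb \<longleftrightarrow> (\<forall>k\<in>{1..g}. valid_path (ca k) \<and> path_image (ca k) \<subseteq> \<H> \<and>
            pathstart (ca k) = v0 \<and> pathfinish (ca k) = mob (a k) v0 \<and>
            valid_path (cb k) \<and> path_image (cb k) \<subseteq> \<H> \<and>
            pathstart (cb k) = v0 \<and> pathfinish (cb k) = mob (b k) v0)"

locale fuchsian_polygon =
  fixes \<Gamma> :: "(real^2^2) set" and g :: nat and a b :: "nat \<Rightarrow> real^2^2" and v0 :: complex
  assumes SL: "SL2R_subgroup \<Gamma>" and gens: "\<And>k. k \<in> {1..g} \<Longrightarrow> a k \<in> \<Gamma>" "\<And>k. k \<in> {1..g} \<Longrightarrow> b k \<in> \<Gamma>"
    and rel: "Rprod a b g \<in> {mat 1, - mat 1}" and v0: "v0 \<in> \<H>"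
begin

lemma det1: "x \<in> \<Gamma> \<Longrightarrow> det x = 1"
  and mult_in: "x \<in> \<Gamma> \<Longrightarrow> y \<in> \<Gamma> \<Longrightarrow> x ** y \<in> \<Gamma>"
  and inv_in: "x \<in> \<Gamma> \<Longrightarrow> matrix_inv x \<in> \<Gamma>"
  and one_in: "mat 1 \<in> \<Gamma>"
  using SL by (auto simp: SL2R_subgroup_def)

lemma inv_cancel:
  assumes "x \<in> \<Gamma>"
  shows "matrix_inv x ** x = mat 1" "x ** matrix_inv x = mat 1" "y ** matrix_inv x ** x = y" "y ** x ** matrix_inv x = y"
  using matrix_inv_SL2[OF det1[OF assms]] by (simp_all flip: matrix_mul_assoc)

lemma Rprod_in: "k \<le> g \<Longrightarrow> Rprod a b k \<in> \<Gamma>"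
proof (induction k)
  case (Suc k)
  then show ?case using gens[of "Suc k"] by (auto simp: comm_def intro!: mult_in inv_in)
qed (simp add: one_in)

lemma side_in:
  assumes "k \<in> {1..g}"
  shows "side_a a b k \<in> \<Gamma>" "side_b a b k \<in> \<Gamma>" "side_a' a b k \<in> \<Gamma>" "side_b' a b k \<in> \<Gamma>" "side_b a b k ** b k \<in> \<Gamma>"
  using assms gens[OF assms] Rprod_in[of "k - 1"]
  by (auto simp: side_a_def side_b_def side_a'_def side_b'_def intro!: mult_in inv_in)

lemma mob_in: "x \<in> \<Gamma> \<Longrightarrow> z \<in> \<H> \<Longrightarrow> mob x z \<in> \<H>"
  using mob_upper_half_plane det1 by blast

lemma mob_mult_in: "x \<in> \<Gamma> \<Longrightarrow> y \<in> \<Gamma> \<Longrightarrow> z \<in> \<H> \<Longrightarrow> mob (x ** y) z = mob x (mob y z)"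
  using mob_mult det1 by blast

text \<open>Consecutive sides share a vertex, so a block contributes the difference of
  \<open>G\<close> between the vertices belonging to \<open>Rprod a b k\<close> and
  \<open>Rprod a b (k - 1)\<close>. The polygon closes because \<open>Rprod a b g\<close> is plus or
  minus the identity and acts trivially.\<close>

lemma polygon_integral_telescope:
  assumes f: "\<And>k x. k \<in> {1..g} \<Longrightarrow> x \<in> {side_a a b k, side_a' a b k} \<Longrightarrow> contour_integral (mob x \<circ> ca k) f = G (mob x (mob (a k) v0)) - G (mob x v0)"
    "\<And>k x. k \<in> {1..g} \<Longrightarrow> x \<in> {side_b a b k, side_b' a b k} \<Longrightarrow> contour_integral (mob x \<circ> cb k) f = G (mob x (mob (b k) v0)) - G (mob x v0)"
  shows "polygon_integral g a b ca cb f = 0"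
proof -
  have "polygon_integral g a b ca cb f = (\<Sum>k=1..g. G (mob (Rprod a b k) v0) - G (mob (Rprod a b (k - 1)) v0))"
    unfolding polygon_integral_def
  proof (rule sum.cong[OF refl])
    fix k assume k: "k \<in> {1..g}"
    note s = side_in[OF k] and ab = gens[OF k]
    have 1: "mob (side_a a b k) (mob (a k) v0) = mob (side_b a b k) v0"
      using mob_mult_in[OF s(1) ab(1) v0] by (simp add: side_a_def side_b_def)
    have 2: "mob (side_b a b k) (mob (b k) v0) = mob (side_a' a b k) (mob (a k) v0)"
      using mob_mult_in[OF s(2) ab(2) v0] mob_mult_in[OF s(3) ab(1) v0]
      by (simp add: side_a'_def side_b_def inv_cancel(3)[OF ab(1)])
    have 3: "mob (side_b' a b k) (mob (b k) v0) = mob (side_a' a b k) v0"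
      using mob_mult_in[OF s(4) ab(2) v0] by (simp add: side_b'_def inv_cancel(3)[OF ab(2)])
    show "contour_integral (mob (side_a a b k) \<circ> ca k) f + contour_integral (mob (side_b a b k) \<circ> cb k) f
    - contour_integral (mob (side_a' a b k) \<circ> ca k) f - contour_integral (mob (side_b' a b k) \<circ> cb k) f
       = G (mob (Rprod a b k) v0) - G (mob (Rprod a b (k - 1)) v0)"
      using f(1)[OF k, of "side_a a b k"] f(1)[OF k, of "side_a' a b k"] f(2)[OF k, of "side_b a b k"] f(2)[OF k, of "side_b' a b k"]
        1 2 3 side_b'_eq[of k a b] k by (simp add: side_a_def)
  qed
  also have "\<dots> = G (mob (Rprod a b g) v0) - G (mob (Rprod a b 0) v0)"
  proof (induction g)
    case (Suc n)
    then show ?case by simp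
  qed simp
  also have "\<dots> = 0" using rel by auto
  finally show ?thesis .
qed

lemma side_path:
  assumes "edge_paths g a b v0 ca cb" "k \<in> {1..g}" "x \<in> \<Gamma>"
  shows "valid_path (mob x \<circ> ca k)" "path_image (mob x \<circ> ca k) \<subseteq> \<H>"
    "valid_path (mob x \<circ> cb k)" "path_image (mob x \<circ> cb k) \<subseteq> \<H>"
    "pathstart (mob x \<circ> ca k) = mob x v0" "pathfinish (mob x \<circ> ca k) = mob x (mob (a k) v0)"
    "pathstart (mob x \<circ> cb k) = mob x v0" "pathfinish (mob x \<circ> cb k) = mob x (mob (b k) v0)"
  using assms mob_path[OF det1[OF assms(3)]] by (auto simp: edge_paths_def pathstart_compose pathfinish_compose)

definition sides_image where
  "sides_image ca cb = (\<Union>k\<in>{1..g}. path_image (mob (side_a a b k) \<circ> ca k) \<union> path_image (mob (side_b a b k) \<circ> cb k)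
      \<union> path_image (mob (side_a' a b k) \<circ> ca k) \<union> path_image (mob (side_b' a b k) \<circ> cb k))"

text \<open>A convex domain supplies one primitive for all sides. The lemma serves for kernels with
  pole outside a box, for the Cauchy-Pompeiu boundary term, and for the holomorphic parts of the
  integrand.\<close>

lemma polygon_integral_holomorphic_eq_0:
  assumes ep: "edge_paths g a b v0 ca cb" and f: "f holomorphic_on S" "open S" "convex S" and S: "sides_image ca cb \<subseteq> S"
  shows "polygon_integral g a b ca cb f = 0"
proof -
  obtain G where G: "\<And>z. z \<in> S \<Longrightarrow> (G has_field_derivative f z) (at z within S)"
    using holomorphic_convex_primitive'[OF f(3,2,1)] by blast
  have P: "contour_integral q f = G (pathfinish q) - G (pathstart q)" if "valid_path q" "path_image q \<subseteq> S" for q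
    using contour_integral_primitive[OF G that] by (simp add: contour_integral_unique)
  have sub: "path_image (mob (side_a a b k) \<circ> ca k) \<subseteq> S" "path_image (mob (side_a' a b k) \<circ> ca k) \<subseteq> S"
    "path_image (mob (side_b a b k) \<circ> cb k) \<subseteq> S" "path_image (mob (side_b' a b k) \<circ> cb k) \<subseteq> S" if "k \<in> {1..g}" for k
    using S that unfolding sides_image_def by blast+
  show ?thesis
    by (rule polygon_integral_telescope[where G=G]) (use P side_path[OF ep] side_in sub in auto)
qed

text \<open>By induction on the letters with a running prefix \<open>w\<close>: the side of the
  letter \<open>x\<close> ends at \<open>mob (w ** x) v0\<close>, where the next one starts.\<close>

lemma join_polygon_sides:
  assumes "ls \<noteq> []" "w \<in> \<Gamma>"
    "\<And>x e. (x, e) \<in> set ls \<Longrightarrow> x \<in> \<Gamma> \<and> valid_path e \<and> path_image e \<subseteq> \<H> \<and> pathstart e = v0 \<and> pathfinish e = mob x v0"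
  shows "valid_path (join_list (polygon_sides w ls)) \<and> pathstart (join_list (polygon_sides w ls)) = mob w v0
    \<and> path_image (join_list (polygon_sides w ls)) \<subseteq> (\<Union>s\<in>set (polygon_sides w ls). path_image s)
    \<and> ((\<forall>s\<in>set (polygon_sides w ls). f contour_integrable_on s) \<longrightarrow>
         f contour_integrable_on (join_list (polygon_sides w ls)) \<and>
         contour_integral (join_list (polygon_sides w ls)) f = (\<Sum>s\<leftarrow>polygon_sides w ls. contour_integral s f))"
  using assms
proof (induction ls arbitrary: w)
  case (Cons l ls)
  obtain x e where l: "l = (x, e)" by force
  have xe: "x \<in> \<Gamma>" "valid_path e" "path_image e \<subseteq> \<H>" "pathstart e = v0" "pathfinish e = mob x v0"
    using Cons.prems(3)[of x e] l by auto
  have v: "valid_path (mob w \<circ> e)" using mob_path[OF det1[OF Cons.prems(2)] xe(2,3)] by simp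
  have ps: "pathstart (mob w \<circ> e) = mob w v0" "pathfinish (mob w \<circ> e) = mob (w ** x) v0"
    using xe mob_mult_in[OF Cons.prems(2) xe(1) v0] by (auto simp: pathstart_compose pathfinish_compose)
  show ?case
  proof (cases "ls = []")
    case True
    then show ?thesis using v ps l by (simp add: o_def)
  next
    case False
    have wx: "w ** x \<in> \<Gamma>" using mult_in Cons.prems(2) xe(1) by blast
    have pr: "x \<in> \<Gamma> \<and> valid_path e \<and> path_image e \<subseteq> \<H> \<and> pathstart e = v0 \<and> pathfinish e = mob x v0"
      if "(x, e) \<in> set ls" for x e
      using Cons.prems(3)[of x e] that by simp
    define q where "q = join_list (polygon_sides (w ** x) ls)"
    have IH: "valid_path q" "pathstart q = mob (w ** x) v0" "path_image q \<subseteq> (\<Union>s\<in>set (polygon_sides (w ** x) ls). path_image s)"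
      "(\<forall>s\<in>set (polygon_sides (w ** x) ls). f contour_integrable_on s) \<Longrightarrow> f contour_integrable_on q \<and>
         contour_integral q f = (\<Sum>s\<leftarrow>polygon_sides (w ** x) ls. contour_integral s f)"
      using Cons.IH[OF False wx pr] unfolding q_def by auto
    obtain y e' ls' where ls: "ls = (y, e') # ls'" using False by (metis list.exhaust surj_pair)
    have j: "join_list (polygon_sides w (l # ls)) = (mob w \<circ> e) +++ q"
      unfolding q_def by (simp add: l ls)
    have ps': "polygon_sides w (l # ls) = (mob w \<circ> e) # polygon_sides (w ** x) ls" by (simp add: l)
    have "valid_path ((mob w \<circ> e) +++ q)" using v IH(1,2) ps(2) by (intro valid_path_join) auto
    moreover have "path_image ((mob w \<circ> e) +++ q) \<subseteq> (\<Union>s\<in>set (polygon_sides w (l # ls)). path_image s)"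
      using IH(3) path_image_join_subset[of "mob w \<circ> e" q] unfolding ps' by auto
    moreover have "f contour_integrable_on ((mob w \<circ> e) +++ q) \<and>
        contour_integral ((mob w \<circ> e) +++ q) f = (\<Sum>s\<leftarrow>polygon_sides w (l # ls). contour_integral s f)"
      if "\<forall>s\<in>set (polygon_sides w (l # ls)). f contour_integrable_on s"
    proof -
      have "f contour_integrable_on (mob w \<circ> e)" "f contour_integrable_on q"
        and eq: "contour_integral q f = (\<Sum>s\<leftarrow>polygon_sides (w ** x) ls. contour_integral s f)"
        using that IH(4) unfolding ps' by auto
      then show ?thesis using contour_integral_join[of f "mob w \<circ> e" q] contour_integrable_joinI[of f "mob w \<circ> e" q] v IH(1)
        unfolding ps' list.map sum_list.Cons eq by auto
    qed
    ultimately show ?thesis unfolding j using ps(1) by auto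
  qed
qed simp

end

lemma sum_list_concat_map4:
  "(\<Sum>s\<leftarrow>concat (map (\<lambda>k. [p k, q k, r k, t k]) xs). F s) = (\<Sum>k\<leftarrow>xs. F (p k) + F (q k) + F (r k) + F (t k))"
  for F :: "'a \<Rightarrow> complex"
  by (induction xs) (simp_all add: add.assoc)

section \<open>Winding numbers of the polygon and their dependence on the edges\<close>

context fuchsian_polygon begin

lemma sides_image:
  assumes ep: "edge_paths g a b v0 ca cb"
  shows "compact (sides_image ca cb)" "sides_image ca cb \<subseteq> \<H>" "sides_image ca cb \<in> null_sets lborel"
proof -
  have v: "valid_path (mob x \<circ> ca k)" "valid_path (mob x \<circ> cb k)" if "k \<in> {1..g}" "x \<in> \<Gamma>" for k x
    using side_path[OF ep that] by auto
  show "compact (sides_image ca cb)"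
    unfolding sides_image_def
    by (intro compact_UN compact_Un compact_path_image valid_path_imp_path v side_in) auto
  show "sides_image ca cb \<subseteq> \<H>"
    unfolding sides_image_def using side_path(2,4)[OF ep] side_in by blast
  show "sides_image ca cb \<in> null_sets lborel"
    unfolding sides_image_def
    by (intro null_sets_UN' null_sets.Un null_sets_valid_path_image v side_in countable_finite) auto
qed

text \<open>The topological information concerns the joined curve \<open>p\<close>, whereas all
  estimates are made on single sides; this formula connects the two.\<close>

lemma polygon_boundary_winding:
  assumes ep: "edge_paths g a b v0 ca cb" and g: "g \<ge> 1" and w: "w \<notin> sides_image ca cb"
  defines "p \<equiv> polygon_boundary g a b ca cb"
  shows "w \<notin> path_image p" "2 * pi * \<i> * winding_number p w = polygon_integral g a b ca cb (\<lambda>z. 1 / (z - w))"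
proof -
  let ?ls = "polygon_letters g a b ca cb" and ?f = "\<lambda>z. 1 / (z - w)"
  let ?s3 = "\<lambda>k. mob (side_b a b k ** b k) \<circ> (mob (matrix_inv (a k)) \<circ> reversepath (ca k))"
  let ?s4 = "\<lambda>k. mob (side_a' a b k) \<circ> (mob (matrix_inv (b k)) \<circ> reversepath (cb k))"
  have e: "valid_path (ca k)" "path_image (ca k) \<subseteq> \<H>" "pathstart (ca k) = v0" "pathfinish (ca k) = mob (a k) v0"
     "valid_path (cb k)" "path_image (cb k) \<subseteq> \<H>" "pathstart (cb k) = v0" "pathfinish (cb k) = mob (b k) v0"
    if "k \<in> {1..g}" for k using ep that by (auto simp: edge_paths_def)
  have letters: "x \<in> \<Gamma> \<and> valid_path e \<and> path_image e \<subseteq> \<H> \<and> pathstart e = v0 \<and> pathfinish e = mob x v0"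
    if "(x, e) \<in> set ?ls" for x e
  proof -
    have "\<exists>k\<in>{1..g}. (x, e) = (a k, ca k) \<or> (x, e) = (b k, cb k) \<or>
        (x, e) = (matrix_inv (a k), mob (matrix_inv (a k)) \<circ> reversepath (ca k)) \<or>
        (x, e) = (matrix_inv (b k), mob (matrix_inv (b k)) \<circ> reversepath (cb k))"
      using that by (force simp: polygon_letters_def)
    then obtain k where k: "k \<in> {1..g}" and cases: "(x, e) = (a k, ca k) \<or> (x, e) = (b k, cb k) \<or>
        (x, e) = (matrix_inv (a k), mob (matrix_inv (a k)) \<circ> reversepath (ca k)) \<or>
        (x, e) = (matrix_inv (b k), mob (matrix_inv (b k)) \<circ> reversepath (cb k))" by blast
    note ek = e[OF k] and ab = gens[OF k]
    have 1: "valid_path (mob (matrix_inv y) \<circ> reversepath c)" "path_image (mob (matrix_inv y) \<circ> reversepath c) \<subseteq> \<H>"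
      "pathstart (mob (matrix_inv y) \<circ> reversepath c) = v0" "pathfinish (mob (matrix_inv y) \<circ> reversepath c) = mob (matrix_inv y) v0"
      if "y \<in> \<Gamma>" "valid_path c" "path_image c \<subseteq> \<H>" "pathstart c = v0" "pathfinish c = mob y v0" for y c
      using mob_path[OF det1[OF inv_in[OF that(1)]], of "reversepath c"] that mob_inverse(1)[OF det1[OF that(1)] v0]
      by (auto simp: pathstart_compose pathfinish_compose)
    from cases show ?thesis
      using ek ab inv_in[OF ab(1)] inv_in[OF ab(2)] 1[OF ab(1) ek(1-4)] 1[OF ab(2) ek(5-8)] by auto
  qed
  have ne: "?ls \<noteq> []" using g by (auto simp: polygon_letters_def intro!: bexI[of _ 1])
  \<comment> \<open>The two descriptions of a backward side are compared on the unit interval, where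
    the edge stays in the half plane and \<open>mob\<close> is multiplicative; this suffices for
    images and contour integrals.\<close>
  have c3: "?s3 k t = reversepath (mob (side_a' a b k) \<circ> ca k) t" and c4: "?s4 k t = reversepath (mob (side_b' a b k) \<circ> cb k) t"
    if "k \<in> {1..g}" "t \<in> {0..1}" for k t
  proof -
    have z: "ca k (1 - t) \<in> \<H>" "cb k (1 - t) \<in> \<H>"
      using e(2,6)[OF that(1)] that(2) by (auto simp: path_image_def image_subset_iff)
    note s = side_in[OF that(1)] and ab = gens[OF that(1)]
    show "?s3 k t = reversepath (mob (side_a' a b k) \<circ> ca k) t"
      using mob_mult_in[OF s(5) inv_in[OF ab(1)] z(1)] by (simp add: reversepath_def side_a'_def side_b_def)
    show "?s4 k t = reversepath (mob (side_b' a b k) \<circ> cb k) t"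
      using mob_mult_in[OF s(3) inv_in[OF ab(2)] z(2)] by (simp add: reversepath_def side_b'_def)
  qed
  have im: "path_image (?s3 k) = path_image (mob (side_a' a b k) \<circ> ca k)" "path_image (?s4 k) = path_image (mob (side_b' a b k) \<circ> cb k)"
    if "k \<in> {1..g}" for k
  proof -
    have "path_image (?s3 k) = path_image (reversepath (mob (side_a' a b k) \<circ> ca k))"
      unfolding path_image_def using c3[OF that] by (intro image_cong) auto
    then show "path_image (?s3 k) = path_image (mob (side_a' a b k) \<circ> ca k)" by simp
    have "path_image (?s4 k) = path_image (reversepath (mob (side_b' a b k) \<circ> cb k))"
      unfolding path_image_def using c4[OF that] by (intro image_cong) auto
    then show "path_image (?s4 k) = path_image (mob (side_b' a b k) \<circ> cb k)" by simp
  qed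
  have set: "set (polygon_sides (mat 1) ?ls) = (\<Union>k\<in>{1..g}. {mob (side_a a b k) \<circ> ca k, mob (side_b a b k) \<circ> cb k, ?s3 k, ?s4 k})"
    unfolding polygon_sides_eq by (simp add: atLeastLessThanSuc_atLeastAtMost del: upt_Suc)
  have un: "(\<Union>s\<in>set (polygon_sides (mat 1) ?ls). path_image s) = sides_image ca cb"
    unfolding set sides_image_def using im by auto
  have val: "valid_path s" if sS: "s \<in> set (polygon_sides (mat 1) ?ls)" for s
  proof -
    obtain k where k: "k \<in> {1..g}" "s \<in> {mob (side_a a b k) \<circ> ca k, mob (side_b a b k) \<circ> cb k, ?s3 k, ?s4 k}"
      using sS unfolding set by blast
    have r: "valid_path (reversepath (ca k))" "path_image (reversepath (ca k)) \<subseteq> \<H>"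
       "valid_path (reversepath (cb k))" "path_image (reversepath (cb k)) \<subseteq> \<H>"
      using e[OF k(1)] by auto
    note s = side_in[OF k(1)] and ab = gens[OF k(1)]
    note r3 = mob_path[OF det1[OF inv_in[OF ab(1)]] r(1,2)] and r4 = mob_path[OF det1[OF inv_in[OF ab(2)]] r(3,4)]
    show ?thesis
      using k(2) side_path(1,3)[OF ep k(1)] s mob_path(1)[OF det1[OF s(5)] r3] mob_path(1)[OF det1[OF s(3)] r4] by auto
  qed
  have int: "\<forall>s\<in>set (polygon_sides (mat 1) ?ls). ?f contour_integrable_on s"
    using val w un by (auto intro!: contour_integrable_inversediff)
  note J = join_polygon_sides[OF ne one_in letters, of ?f]
  have vp: "valid_path p" unfolding p_def polygon_boundary_def using J by blast
  show wp: "w \<notin> path_image p" using J w un unfolding p_def polygon_boundary_def by blast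
  have "2 * pi * \<i> * winding_number p w = contour_integral p ?f"
    using winding_number_valid_path[OF vp wp] by simp
  also have "\<dots> = (\<Sum>s\<leftarrow>polygon_sides (mat 1) ?ls. contour_integral s ?f)"
    unfolding p_def polygon_boundary_def using J int by blast
  also have "\<dots> = (\<Sum>k\<leftarrow>[1..<Suc g]. contour_integral (mob (side_a a b k) \<circ> ca k) ?f + contour_integral (mob (side_b a b k) \<circ> cb k) ?f
      + contour_integral (?s3 k) ?f + contour_integral (?s4 k) ?f)"
    unfolding polygon_sides_eq by (rule sum_list_concat_map4)
  also have "\<dots> = (\<Sum>k=1..g. contour_integral (mob (side_a a b k) \<circ> ca k) ?f + contour_integral (mob (side_b a b k) \<circ> cb k) ?f
      + contour_integral (?s3 k) ?f + contour_integral (?s4 k) ?f)"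
    by (simp only: interv_sum_list_conv_sum_set_nat set_upt atLeastLessThanSuc_atLeastAtMost)
  also have "\<dots> = polygon_integral g a b ca cb ?f"
    unfolding polygon_integral_def
  proof (rule sum.cong[OF refl])
    fix k assume k: "k \<in> {1..g}"
    have "contour_integral (?s3 k) ?f = contour_integral (reversepath (mob (side_a' a b k) \<circ> ca k)) ?f"
      by (rule contour_integral_path_cong) (rule c3[OF k])
    then have 3: "contour_integral (?s3 k) ?f = - contour_integral (mob (side_a' a b k) \<circ> ca k) ?f"
      using side_path(1)[OF ep k side_in(3)[OF k]] by (simp add: contour_integral_reversepath)
    have "contour_integral (?s4 k) ?f = contour_integral (reversepath (mob (side_b' a b k) \<circ> cb k)) ?f"
      by (rule contour_integral_path_cong) (rule c4[OF k])
    then have 4: "contour_integral (?s4 k) ?f = - contour_integral (mob (side_b' a b k) \<circ> cb k) ?f"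
      using side_path(3)[OF ep k side_in(4)[OF k]] by (simp add: contour_integral_reversepath)
    show "contour_integral (mob (side_a a b k) \<circ> ca k) ?f + contour_integral (mob (side_b a b k) \<circ> cb k) ?f
      + contour_integral (?s3 k) ?f + contour_integral (?s4 k) ?f
      = contour_integral (mob (side_a a b k) \<circ> ca k) ?f + contour_integral (mob (side_b a b k) \<circ> cb k) ?f
      - contour_integral (mob (side_a' a b k) \<circ> ca k) ?f - contour_integral (mob (side_b' a b k) \<circ> cb k) ?f"
      unfolding 3 4 by simp
  qed
  finally show "2 * pi * \<i> * winding_number p w = polygon_integral g a b ca cb ?f" .
qed

lemma edge_paths_linepath: "edge_paths g a b v0 (\<lambda>k. linepath v0 (mob (a k) v0)) (\<lambda>k. linepath v0 (mob (b k) v0))"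
  using closed_segment_subset[OF v0 mob_in[OF gens(1) v0] upper_half_plane_simps(2)]
    closed_segment_subset[OF v0 mob_in[OF gens(2) v0] upper_half_plane_simps(2)]
  by (auto simp: edge_paths_def)

text \<open>Pulling a side back to its edge adds a term that depends on the end points alone. It
  drops out of the difference of two edges with common ends, leaving a loop kernel at the pulled
  back point.\<close>

lemma polygon_integral_diff_loop_kernel:
  assumes ec: "edge_paths g a b v0 ca cb" and el: "edge_paths g a b v0 la lb"
    and w: "w \<in> \<H>" "w \<notin> sides_image ca cb" "w \<notin> sides_image la lb"
  shows "polygon_integral g a b la lb (\<lambda>z. 1 / (z - w)) - polygon_integral g a b ca cb (\<lambda>z. 1 / (z - w))
     = (\<Sum>k=1..g. loop_kernel (ca k) (la k) (mob (matrix_inv (side_a a b k)) w)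
          + loop_kernel (cb k) (lb k) (mob (matrix_inv (side_b a b k)) w)
          - loop_kernel (ca k) (la k) (mob (matrix_inv (side_a' a b k)) w)
          - loop_kernel (cb k) (lb k) (mob (matrix_inv (side_b' a b k)) w))"
proof -
  let ?f = "\<lambda>z. 1 / (z - w)"
  have *: "contour_integral (mob x \<circ> c') ?f - contour_integral (mob x \<circ> c) ?f = loop_kernel c c' (mob (matrix_inv x) w)"
    if x: "x \<in> \<Gamma>" and c: "valid_path c" "path_image c \<subseteq> \<H>" and c': "valid_path c'" "path_image c' \<subseteq> \<H>"
      and e: "pathstart c' = pathstart c" "pathfinish c' = pathfinish c" and n: "w \<notin> path_image (mob x \<circ> c)" "w \<notin> path_image (mob x \<circ> c')" for x c c'
  proof -
    have d: "det x = 1" by (rule det1[OF x])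
    have xw: "mob x (mob (matrix_inv x) w) = w" by (rule mob_inverse(2)[OF d w(1)])
    have n': "mob (matrix_inv x) w \<notin> path_image c" "mob (matrix_inv x) w \<notin> path_image c'"
      using n xw by (force simp: path_image_compose)+
    have "(\<lambda>z. of_real (x$2$1) / mob_den x z) holomorphic_on \<H>"
      using mob_den_nonzero[OF d] by (intro holomorphic_intros) (auto simp: mob_den_def intro!: holomorphic_intros)
    then have "contour_integral c' (\<lambda>z. of_real (x$2$1) / mob_den x z) = contour_integral c (\<lambda>z. of_real (x$2$1) / mob_den x z)"
      using c c' e by (intro contour_integral_holomorphic_endpoints[where S=\<H>]) (auto simp: upper_half_plane_simps(1,2))
    then show ?thesis
      using contour_integral_mob_inversediff[OF d c w(1) n'(1)] contour_integral_mob_inversediff[OF d c' w(1) n'(2)]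
        n' mob_in[OF inv_in[OF x] w(1)] by (simp add: loop_kernel_def)
  qed
  show ?thesis unfolding polygon_integral_def sum_subtractf[symmetric]
  proof (rule sum.cong[OF refl])
    fix k assume k: "k \<in> {1..g}"
    have pa: "valid_path (ca k)" "path_image (ca k) \<subseteq> \<H>" "valid_path (la k)" "path_image (la k) \<subseteq> \<H>"
      "pathstart (la k) = pathstart (ca k)" "pathfinish (la k) = pathfinish (ca k)"
      and pb: "valid_path (cb k)" "path_image (cb k) \<subseteq> \<H>" "valid_path (lb k)" "path_image (lb k) \<subseteq> \<H>"
      "pathstart (lb k) = pathstart (cb k)" "pathfinish (lb k) = pathfinish (cb k)"
      using ec el k by (auto simp: edge_paths_def)
    have n: "w \<notin> path_image (mob (side_a a b k) \<circ> ca k)" "w \<notin> path_image (mob (side_a a b k) \<circ> la k)"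
      "w \<notin> path_image (mob (side_b a b k) \<circ> cb k)" "w \<notin> path_image (mob (side_b a b k) \<circ> lb k)"
      "w \<notin> path_image (mob (side_a' a b k) \<circ> ca k)" "w \<notin> path_image (mob (side_a' a b k) \<circ> la k)"
      "w \<notin> path_image (mob (side_b' a b k) \<circ> cb k)" "w \<notin> path_image (mob (side_b' a b k) \<circ> lb k)"
      using w(2,3) k unfolding sides_image_def by blast+
    note s = side_in[OF k]
    show "contour_integral (mob (side_a a b k) \<circ> la k) ?f + contour_integral (mob (side_b a b k) \<circ> lb k) ?f
        - contour_integral (mob (side_a' a b k) \<circ> la k) ?f - contour_integral (mob (side_b' a b k) \<circ> lb k) ?f
      - (contour_integral (mob (side_a a b k) \<circ> ca k) ?f + contour_integral (mob (side_b a b k) \<circ> cb k) ?f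
        - contour_integral (mob (side_a' a b k) \<circ> ca k) ?f - contour_integral (mob (side_b' a b k) \<circ> cb k) ?f)
      = loop_kernel (ca k) (la k) (mob (matrix_inv (side_a a b k)) w)
          + loop_kernel (cb k) (lb k) (mob (matrix_inv (side_b a b k)) w)
          - loop_kernel (ca k) (la k) (mob (matrix_inv (side_a' a b k)) w)
          - loop_kernel (cb k) (lb k) (mob (matrix_inv (side_b' a b k)) w)"
      using *[OF s(1) pa n(1,2)] *[OF s(2) pb n(3,4)] *[OF s(3) pa n(5,6)] *[OF s(4) pb n(7,8)]
      by (simp add: algebra_simps)
  qed
qed

text \<open>The loop of each edge occurs with opposite signs at two group elements. After cutting
  off about \<open>B\<close>, substitution turns both integrals into integrals of one kernel over
  regions with different centres, whose difference tends to 0. Since \<open>X\<close> is integrable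
  as a whole, dominated convergence identifies the limit with its integral.\<close>

lemma integral_winding_difference_eq_0:
  assumes ec: "edge_paths g a b v0 ca cb" and el: "edge_paths g a b v0 la lb"
    and C1: "\<And>k. k \<in> {1..g} \<Longrightarrow> la k C1_differentiable_on {0..1}" "\<And>k. k \<in> {1..g} \<Longrightarrow> lb k C1_differentiable_on {0..1}"
    and K: "continuous_on \<H> K"
    and inv: "\<And>x z. x \<in> \<Gamma> \<Longrightarrow> z \<in> \<H> \<Longrightarrow> (cmod (deriv (mob x) z))\<^sup>2 *\<^sub>R K (mob x z) = K z"
    and N: "N \<in> null_sets lborel" "sides_image ca cb \<subseteq> N" "sides_image la lb \<subseteq> N"
  defines "X \<equiv> \<lambda>w. indicator (\<H> - N) w *\<^sub>R (K w * (polygon_integral g a b la lb (\<lambda>z. 1 / (z - w))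
     - polygon_integral g a b ca cb (\<lambda>z. 1 / (z - w))))"
  assumes X: "integrable lborel X"
  shows "(LINT w|lborel. X w) = 0"
proof -
  have "\<exists>S. finite S \<and> ca k C1_differentiable_on ({0..1} - S)" "\<exists>S. finite S \<and> cb k C1_differentiable_on ({0..1} - S)"
    if "k \<in> {1..g}" for k
    using ec that by (auto simp: edge_paths_def valid_path_def piecewise_C1_differentiable_on_def)
  then obtain Sa Sb where Sa: "\<And>k. k \<in> {1..g} \<Longrightarrow> finite (Sa k) \<and> ca k C1_differentiable_on ({0..1} - Sa k)"
    and Sb: "\<And>k. k \<in> {1..g} \<Longrightarrow> finite (Sb k) \<and> cb k C1_differentiable_on ({0..1} - Sb k)"
    by metis
  \<comment> \<open>The exceptional points of all sides form one set, since \<open>X\<close> is cut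
    off as a whole before it is split into its summands.\<close>
  define B where "B = (\<Union>k\<in>{1..g}. (\<lambda>s. mob (side_a a b k) (ca k s)) ` (Sa k \<inter> {0..1}) \<union> (\<lambda>s. mob (side_a' a b k) (ca k s)) ` (Sa k \<inter> {0..1})
     \<union> (\<lambda>s. mob (side_b a b k) (cb k s)) ` (Sb k \<inter> {0..1}) \<union> (\<lambda>s. mob (side_b' a b k) (cb k s)) ` (Sb k \<inter> {0..1}))"
  have finB: "finite B" unfolding B_def using Sa Sb by auto
  have subB: "(\<lambda>s. mob (side_a a b k) (ca k s)) ` (Sa k \<inter> {0..1}) \<subseteq> B" "(\<lambda>s. mob (side_a' a b k) (ca k s)) ` (Sa k \<inter> {0..1}) \<subseteq> B"
     "(\<lambda>s. mob (side_b a b k) (cb k s)) ` (Sb k \<inter> {0..1}) \<subseteq> B" "(\<lambda>s. mob (side_b' a b k) (cb k s)) ` (Sb k \<inter> {0..1}) \<subseteq> B"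
    if "k \<in> {1..g}" for k using that unfolding B_def by blast+
  have imH: "ca k s \<in> \<H>" "cb k s \<in> \<H>" if "k \<in> {1..g}" "s \<in> {0..1}" for k s
    using ec that by (auto simp: edge_paths_def path_image_def image_subset_iff)
  have BH: "B \<subseteq> \<H>"
    unfolding B_def using imH mob_in side_in by fastforce
  have spa: "side_pair (ca k) (la k) (Sa k) K" and spb: "side_pair (cb k) (lb k) (Sb k) K" if "k \<in> {1..g}" for k
    using that ec el C1 Sa Sb K by (unfold_locales) (auto simp: edge_paths_def)
  define I where "I c c' x n = (LINT w|lborel. indicator (gauge_away B n) w *\<^sub>R (K w * loop_kernel c c' (mob (matrix_inv x) w)))" for c c' x n
  have lim: "(\<lambda>n. I c c' x n - I c c' y n) \<longlonglongrightarrow> 0"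
    if sp: "side_pair c c' S K" and x: "x \<in> \<Gamma>" "(\<lambda>s. mob x (c s)) ` (S \<inter> {0..1}) \<subseteq> B" and y: "y \<in> \<Gamma>" "(\<lambda>s. mob y (c s)) ` (S \<inter> {0..1}) \<subseteq> B" for c c' S x y
  proof -
    interpret side_pair c c' S K by (rule sp)
    have sub: "c ` (S \<inter> {0..1}) \<subseteq> mob (matrix_inv x) ` B" if "x \<in> \<Gamma>" "(\<lambda>s. mob x (c s)) ` (S \<inter> {0..1}) \<subseteq> B" for x
    proof
      fix q assume "q \<in> c ` (S \<inter> {0..1})"
      then obtain s where s: "s \<in> S \<inter> {0..1}" "q = c s" by auto
      then have "q \<in> \<H>" using c(2) by (auto simp: path_image_def)
      then have "q = mob (matrix_inv x) (mob x (c s))" using mob_inverse(1)[OF det1[OF that(1)]] s by simp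
      then show "q \<in> mob (matrix_inv x) ` B" using that(2) s by blast
    qed
    have BB: "mob (matrix_inv x) ` B \<subseteq> \<H>" "finite (mob (matrix_inv x) ` B)" if "x \<in> \<Gamma>" for x
      using BH finB mob_in[OF inv_in[OF that]] by auto
    have eq: "I c c' x n = (LINT z|lborel. indicator (gauge_away (mob (matrix_inv x) ` B) n) z *\<^sub>R (K z * loop_kernel c c' z))"
      if "x \<in> \<Gamma>" "(\<lambda>s. mob x (c s)) ` (S \<inter> {0..1}) \<subseteq> B" for x n
      unfolding I_def by (rule loop_kernel_substitution(2)[OF BH finB det1[OF that(1)] that(2) inv[OF that(1)]])
    show ?thesis unfolding eq[OF x] eq[OF y]
      by (rule loop_kernel_pair_limit[OF BB[OF x(1)] BB[OF y(1)] sub[OF x] sub[OF y]])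
  qed
  have int: "integrable lborel (\<lambda>w. indicator (gauge_away B n) w *\<^sub>R (K w * loop_kernel c c' (mob (matrix_inv x) w)))"
    if sp: "side_pair c c' S K" and x: "x \<in> \<Gamma>" "(\<lambda>s. mob x (c s)) ` (S \<inter> {0..1}) \<subseteq> B" for c c' S x n
    by (rule side_pair.loop_kernel_substitution(1)[OF sp BH finB det1[OF x(1)] x(2) inv[OF x(1)]])
  have eqn: "(LINT w|lborel. indicator (gauge_away B n) w *\<^sub>R X w)
     = (\<Sum>k=1..g. (I (ca k) (la k) (side_a a b k) n - I (ca k) (la k) (side_a' a b k) n)
                + (I (cb k) (lb k) (side_b a b k) n - I (cb k) (lb k) (side_b' a b k) n))" for n
  proof -
    let ?t = "\<lambda>c c' x w. indicator (gauge_away B n) w *\<^sub>R (K w * loop_kernel c c' (mob (matrix_inv x) w))"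
    let ?T = "\<lambda>k w. (?t (ca k) (la k) (side_a a b k) w - ?t (ca k) (la k) (side_a' a b k) w)
                + (?t (cb k) (lb k) (side_b a b k) w - ?t (cb k) (lb k) (side_b' a b k) w)"
    have ii: "integrable lborel (?t (ca k) (la k) (side_a a b k))" "integrable lborel (?t (ca k) (la k) (side_a' a b k))"
       "integrable lborel (?t (cb k) (lb k) (side_b a b k))" "integrable lborel (?t (cb k) (lb k) (side_b' a b k))" if k: "k \<in> {1..g}" for k
      using int[OF spa[OF k]] int[OF spb[OF k]] side_in[OF k] subB[OF k] by auto
    have iT: "integrable lborel (?T k)" if k: "k \<in> {1..g}" for k
      using ii[OF k] by (intro Bochner_Integration.integrable_add Bochner_Integration.integrable_diff)
    have "(LINT w|lborel. indicator (gauge_away B n) w *\<^sub>R X w) = (LINT w|lborel. (\<Sum>k=1..g. ?T k w))"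
    proof (rule integral_cong_AE)
      show "(\<lambda>w. indicator (gauge_away B n) w *\<^sub>R X w) \<in> borel_measurable lborel"
        using X gauge_away_measurable[OF finB] by (intro borel_measurable_scaleR borel_measurable_indicator) auto
      show "(\<lambda>w. (\<Sum>k=1..g. ?T k w)) \<in> borel_measurable lborel"
        using iT by (intro borel_measurable_sum) auto
      show "AE w in lborel. indicator (gauge_away B n) w *\<^sub>R X w = (\<Sum>k=1..g. ?T k w)"
        using AE_not_in[OF N(1)]
      proof eventually_elim
        case (elim w)
        show ?case
        proof (cases "w \<in> gauge_away B n")
          case True
          then have wH: "w \<in> \<H>" by (simp add: gauge_away_def)
          have wn: "w \<notin> sides_image ca cb" "w \<notin> sides_image la lb" using elim N by auto
          show ?thesis using True wH elim
            unfolding X_def polygon_integral_diff_loop_kernel[OF ec el wH wn]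
            by (simp add: sum_distrib_left algebra_simps)
        qed simp
      qed
    qed
    also have "\<dots> = (\<Sum>k=1..g. LINT w|lborel. ?T k w)"
      by (rule Bochner_Integration.integral_sum) (rule iT)
    also have "\<dots> = (\<Sum>k=1..g. (I (ca k) (la k) (side_a a b k) n - I (ca k) (la k) (side_a' a b k) n)
                + (I (cb k) (lb k) (side_b a b k) n - I (cb k) (lb k) (side_b' a b k) n))"
    proof (rule sum.cong[OF refl])
      fix k assume k: "k \<in> {1..g}"
      show "(LINT w|lborel. ?T k w) = (I (ca k) (la k) (side_a a b k) n - I (ca k) (la k) (side_a' a b k) n)
                + (I (cb k) (lb k) (side_b a b k) n - I (cb k) (lb k) (side_b' a b k) n)"
        unfolding I_def using ii[OF k]
        by (simp only: Bochner_Integration.integral_add Bochner_Integration.integral_diff Bochner_Integration.integrable_diff)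
    qed
    finally show ?thesis .
  qed
  have "(\<lambda>n. LINT w|lborel. indicator (gauge_away B n) w *\<^sub>R X w) \<longlonglongrightarrow> (\<Sum>k=1..g. (0 + 0))"
    unfolding eqn by (intro tendsto_sum tendsto_add lim[OF spa] lim[OF spb] side_in subB)
  moreover have "(\<lambda>n. LINT w|lborel. indicator (gauge_away B n) w *\<^sub>R X w) \<longlonglongrightarrow> (LINT w|lborel. X w)"
  proof (rule integral_dominated_convergence[where w="\<lambda>w. norm (X w)"])
    show "X \<in> borel_measurable lborel" using X by simp
    show "(\<lambda>w. indicator (gauge_away B n) w *\<^sub>R X w) \<in> borel_measurable lborel" for n
      using X gauge_away_measurable[OF finB] by (intro borel_measurable_scaleR borel_measurable_indicator) auto
    show "integrable lborel (\<lambda>w. norm (X w))" using X by simp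
    have "B \<in> null_sets lborel" using finB by (rule finite_imp_null_set_lborel)
    from AE_not_in[OF this]
    show "AE w in lborel. (\<lambda>n. indicator (gauge_away B n) w *\<^sub>R X w) \<longlonglongrightarrow> X w"
    proof eventually_elim
      case (elim w)
      show ?case
      proof (cases "w \<in> \<H>")
        case True
        then have "eventually (\<lambda>n. w \<in> gauge_away B n) sequentially"
          using eventually_gauge_away[OF finB BH] elim by blast
        then have "eventually (\<lambda>n. indicator (gauge_away B n) w *\<^sub>R X w = X w) sequentially"
          by eventually_elim simp
        then show ?thesis by (rule tendsto_eventually)
      qed (simp add: X_def)
    qed
    show "AE w in lborel. norm (indicator (gauge_away B n) w *\<^sub>R X w) \<le> norm (X w)" for n
      by (intro AE_I2) (simp add: indicator_def)
  qed
  ultimately show ?thesis using LIMSEQ_unique by force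
qed

end

section \<open>Green's formula for the fundamental polygon\<close>

context fuchsian_polygon begin

text \<open>Green's formula evaluates the integral of \<open>K\<close> weighted by the straight
  polygon. Invariance carries this value over to the given polygon, whose winding number is 1 inside
  and 0 outside. The ratio of \<open>2 * pi\<close> in Green's formula to
  \<open>2 * pi * \<i>\<close> in the winding number leaves the divisor \<open>\<i>\<close>.\<close>

lemma polygon_area:
  assumes ec: "edge_paths g a b v0 ca cb" and g: "g \<ge> 1"
  defines "p \<equiv> polygon_boundary g a b ca cb"
    and "la \<equiv> \<lambda>k. linepath v0 (mob (a k) v0)" and "lb \<equiv> \<lambda>k. linepath v0 (mob (b k) v0)"
  assumes p: "valid_path p" "pathfinish p = pathstart p" and F: "F = path_image p \<union> inside (path_image p)"
    and wn: "\<And>w. w \<in> inside (path_image p) \<Longrightarrow> winding_number p w = 1"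
    and der: "\<And>w. w \<in> \<H> \<Longrightarrow> (P has_derivative (\<lambda>h. Re h *\<^sub>R Px w + Im h *\<^sub>R Py w)) (at w)"
    and Px: "continuous_on \<H> Px" and Py: "continuous_on \<H> Py"
    and K: "\<And>w. K w = Px w + \<i> * Py w"
    and inv: "\<And>x z. x \<in> \<Gamma> \<Longrightarrow> z \<in> \<H> \<Longrightarrow> (cmod (deriv (mob x) z))\<^sup>2 *\<^sub>R K (mob x z) = K z"
  shows "(K has_integral (polygon_integral g a b la lb P / \<i>)) F"
proof -
  let ?H = \<H>
  have el: "edge_paths g a b v0 la lb" unfolding la_def lb_def by (rule edge_paths_linepath)
  define N where "N = sides_image ca cb \<union> sides_image la lb"
  have N: "compact N" "N \<subseteq> ?H" "N \<in> null_sets lborel"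
    unfolding N_def using sides_image[OF ec] sides_image[OF el] by (auto intro: compact_Un)
  have pN: "path_image p \<subseteq> N"
    using polygon_boundary_winding(1)[OF ec g] unfolding p_def N_def by blast
  obtain l u where lu: "N \<subseteq> box l u" "cbox l u \<subseteq> ?H"
    using compact_in_box_upper_half_plane[OF N(1,2)] by blast
  have [measurable]: "N \<in> sets borel" using N(3) by auto
  have Kc: "continuous_on ?H K" unfolding K by (intro continuous_intros Px Py)
  have KD: "continuous_on (cbox l u) K" using Kc lu(2) continuous_on_subset by blast
  define Q where "Q z = contour_integral (rectpath l u) (\<lambda>w. P w / (w - z))" for z
  have cP: "continuous_on ?H P"
    by (meson der continuous_at_imp_continuous_on has_derivative_continuous)
  have sub: "path_image (mob (side_a a b k) \<circ> la k) \<subseteq> N" "path_image (mob (side_b a b k) \<circ> lb k) \<subseteq> N"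
    "path_image (mob (side_a' a b k) \<circ> la k) \<subseteq> N" "path_image (mob (side_b' a b k) \<circ> lb k) \<subseteq> N"
    "path_image (mob (side_a a b k) \<circ> ca k) \<subseteq> N" "path_image (mob (side_b a b k) \<circ> cb k) \<subseteq> N"
    "path_image (mob (side_a' a b k) \<circ> ca k) \<subseteq> N" "path_image (mob (side_b' a b k) \<circ> cb k) \<subseteq> N"
    if "k \<in> {1..g}" for k
    using that unfolding N_def sides_image_def by blast+
  have "Q holomorphic_on box l u"
  proof (cases "box l u = {}")
    case False
    then have lu': "Re l < Re u" "Im l < Im u" by (auto simp: in_box_complex_iff)
    then show ?thesis unfolding Q_def using path_image_rectpath_subset_cbox[of l u] lu(2)
      by (intro holomorphic_on_Cauchy_integral_rectpath) (auto intro: continuous_on_subset[OF cP])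
  qed (simp add: holomorphic_on_def)
  \<comment> \<open>The Cauchy-Pompeiu boundary term is holomorphic on a box containing all sides,
    so it does not contribute to the closed polygon.\<close>
  then have PQ: "polygon_integral g a b la lb Q = 0"
    using lu(1) by (intro polygon_integral_holomorphic_eq_0[OF el, of Q "box l u"]) (auto simp: open_box convex_box(2) N_def)
  have C1: "la k C1_differentiable_on {0..1}" "lb k C1_differentiable_on {0..1}" for k
    by (simp_all add: la_def lb_def C1_differentiable_linepath)
  have C1m: "(mob x \<circ> la k) C1_differentiable_on {0..1}" "(mob x \<circ> lb k) C1_differentiable_on {0..1}" if "x \<in> \<Gamma>" "k \<in> {1..g}" for x k
    using el that C1 C1_differentiable_compose_holomorphic[OF _ _ holomorphic_mob[OF det1[OF that(1)]] upper_half_plane_simps(1)]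
    by (auto simp: edge_paths_def)
  define j where "j q w = indicator (cbox l u - N) w *\<^sub>R (K w * contour_integral q (\<lambda>z. 1 / (z - w)))" for q w
  have green: "integrable lborel (j q)" "(LINT w|lborel. j q w) = 2 * pi * contour_integral q P + \<i> * contour_integral q Q"
    if "q C1_differentiable_on {0..1}" "path_image q \<subseteq> N" for q
  proof -
    have "path_image q \<subseteq> box l u" using that lu(1) by blast
    note G = green_path[OF upper_half_plane_simps(1) lu(2) der Px Py that(1) this N(3) that(2)]
    show "integrable lborel (j q)" "(LINT w|lborel. j q w) = 2 * pi * contour_integral q P + \<i> * contour_integral q Q"
      using G unfolding j_def Q_def K by auto
  qed
  define Jl where "Jl w = indicator (cbox l u - N) w *\<^sub>R (K w * polygon_integral g a b la lb (\<lambda>z. 1 / (z - w)))" for w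
  have Jl: "Jl = (\<lambda>w. \<Sum>k=1..g. j (mob (side_a a b k) \<circ> la k) w + j (mob (side_b a b k) \<circ> lb k) w
      - j (mob (side_a' a b k) \<circ> la k) w - j (mob (side_b' a b k) \<circ> lb k) w)"
    unfolding Jl_def j_def polygon_integral_def by (simp add: fun_eq_iff sum_distrib_left scaleR_sum_right algebra_simps)
  note gr = green[OF C1m(1)[OF side_in(1)] sub(1)] green[OF C1m(2)[OF side_in(2)] sub(2)]
     green[OF C1m(1)[OF side_in(3)] sub(3)] green[OF C1m(2)[OF side_in(4)] sub(4)]
  have iT: "integrable lborel (\<lambda>w. j (mob (side_a a b k) \<circ> la k) w + j (mob (side_b a b k) \<circ> lb k) w
      - j (mob (side_a' a b k) \<circ> la k) w - j (mob (side_b' a b k) \<circ> lb k) w)" if "k \<in> {1..g}" for k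
    using gr[of k] that by (intro Bochner_Integration.integrable_add Bochner_Integration.integrable_diff) auto
  have iJl: "integrable lborel Jl" unfolding Jl by (rule Bochner_Integration.integrable_sum) (rule iT)
  have "(LINT w|lborel. Jl w) = (\<Sum>k=1..g. 2 * pi * (contour_integral (mob (side_a a b k) \<circ> la k) P + contour_integral (mob (side_b a b k) \<circ> lb k) P
      - contour_integral (mob (side_a' a b k) \<circ> la k) P - contour_integral (mob (side_b' a b k) \<circ> lb k) P)
     + \<i> * (contour_integral (mob (side_a a b k) \<circ> la k) Q + contour_integral (mob (side_b a b k) \<circ> lb k) Q
      - contour_integral (mob (side_a' a b k) \<circ> la k) Q - contour_integral (mob (side_b' a b k) \<circ> lb k) Q))"
    unfolding Jl
  proof (subst Bochner_Integration.integral_sum[OF iT], assumption, rule sum.cong[OF refl])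
    fix k assume k: "k \<in> {1..g}"
    note i = gr(1,3,5,7)[OF k k k] and e = gr(2,4,6,8)[OF k k k]
    have "(LINT w|lborel. j (mob (side_a a b k) \<circ> la k) w + j (mob (side_b a b k) \<circ> lb k) w
      - j (mob (side_a' a b k) \<circ> la k) w - j (mob (side_b' a b k) \<circ> lb k) w)
      = (LINT w|lborel. j (mob (side_a a b k) \<circ> la k) w) + (LINT w|lborel. j (mob (side_b a b k) \<circ> lb k) w)
      - (LINT w|lborel. j (mob (side_a' a b k) \<circ> la k) w) - (LINT w|lborel. j (mob (side_b' a b k) \<circ> lb k) w)"
      using i by (simp only: Bochner_Integration.integral_add Bochner_Integration.integral_diff
          Bochner_Integration.integrable_add Bochner_Integration.integrable_diff)
    then show "(LINT w|lborel. j (mob (side_a a b k) \<circ> la k) w + j (mob (side_b a b k) \<circ> lb k) w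
      - j (mob (side_a' a b k) \<circ> la k) w - j (mob (side_b' a b k) \<circ> lb k) w)
      = 2 * pi * (contour_integral (mob (side_a a b k) \<circ> la k) P + contour_integral (mob (side_b a b k) \<circ> lb k) P
      - contour_integral (mob (side_a' a b k) \<circ> la k) P - contour_integral (mob (side_b' a b k) \<circ> lb k) P)
     + \<i> * (contour_integral (mob (side_a a b k) \<circ> la k) Q + contour_integral (mob (side_b a b k) \<circ> lb k) Q
      - contour_integral (mob (side_a' a b k) \<circ> la k) Q - contour_integral (mob (side_b' a b k) \<circ> lb k) Q)"
      unfolding e by (simp add: algebra_simps)
  qed
  also have "\<dots> = 2 * pi * polygon_integral g a b la lb P + \<i> * polygon_integral g a b la lb Q"
    unfolding polygon_integral_def sum.distrib sum_distrib_left ..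
  finally have LJl: "(LINT w|lborel. Jl w) = 2 * pi * polygon_integral g a b la lb P" using PQ by simp
  let ?I = "inside (path_image p)"
  have pcl: "closed (path_image p)" using closed_path_image[OF valid_path_imp_path[OF p(1)]] .
  have Iop: "open ?I" by (rule open_inside[OF pcl])
  have Isub: "?I \<subseteq> cbox l u"
  proof -
    have "path_image p \<subseteq> cbox l u" using pN lu(1) box_subset_cbox[of l u] by blast
    then have "- cbox l u \<subseteq> outside (path_image p)" by (intro outside_subset_convex convex_box(1))
    then show ?thesis using inside_Int_outside[of "path_image p"] by blast
  qed
  have "integrable lborel (\<lambda>w. indicator (cbox l u) w *\<^sub>R K w)"
    by (rule borel_integrable_compact[OF compact_cbox KD])
  then have "integrable lborel (\<lambda>w. indicator (?I - N) w *\<^sub>R (indicator (cbox l u) w *\<^sub>R K w))"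
    by (rule integrable_mult_indicator[rotated]) (use Iop in auto)
  also have "(\<lambda>w. indicator (?I - N) w *\<^sub>R (indicator (cbox l u) w *\<^sub>R K w)) = (\<lambda>w. indicator (?I - N) w *\<^sub>R K w)"
    using Isub by (auto simp: indicator_def fun_eq_iff)
  finally have iI: "integrable lborel (\<lambda>w. indicator (?I - N) w *\<^sub>R K w)" .
  \<comment> \<open>Off \<open>N\<close> in the half plane this is \<open>2 * pi * \<i>\<close>
    times \<open>K\<close> times the difference of the winding numbers of the two polygons.\<close>
  define X where "X w = indicator (?H - N) w *\<^sub>R (K w * (polygon_integral g a b la lb (\<lambda>z. 1 / (z - w))
     - polygon_integral g a b ca cb (\<lambda>z. 1 / (z - w))))" for w
  have Xeq: "X w = Jl w - 2 * pi * \<i> * (indicator (?I - N) w *\<^sub>R K w)" for w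
  proof (cases "w \<in> cbox l u - N")
    case True
    then have wn': "w \<notin> sides_image ca cb" by (auto simp: N_def)
    note W = polygon_boundary_winding[OF ec g wn', folded p_def]
    have "polygon_integral g a b ca cb (\<lambda>z. 1 / (z - w)) = 2 * pi * \<i> * (if w \<in> ?I then 1 else 0)"
    proof (cases "w \<in> ?I")
      case False
      then have "w \<in> outside (path_image p)" using W(1) inside_Un_outside[of "path_image p"] by blast
      then have "winding_number p w = 0"
        using winding_number_zero_in_outside[OF valid_path_imp_path[OF p(1)] p(2)] by blast
      then show ?thesis using W(2) False by simp
    qed (use W(2) wn in simp)
    then show ?thesis using True lu(2) by (auto simp: X_def Jl_def right_diff_distrib)
  next
    case False
    show ?thesis
    proof (cases "w \<in> N")
      case True
      then show ?thesis by (simp add: X_def Jl_def)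
    next
      case nN: False
      then have w: "w \<notin> cbox l u" using False by auto
      have "(\<lambda>z. 1 / (z - w)) holomorphic_on box l u"
        using w box_subset_cbox[of l u] by (intro holomorphic_intros) auto
      then have "polygon_integral g a b la lb (\<lambda>z. 1 / (z - w)) = 0" "polygon_integral g a b ca cb (\<lambda>z. 1 / (z - w)) = 0"
        using lu(1) by (auto intro!: polygon_integral_holomorphic_eq_0[OF el, of _ "box l u"] polygon_integral_holomorphic_eq_0[OF ec, of _ "box l u"]
            simp: open_box convex_box(2) N_def)
      then show ?thesis using w Isub by (auto simp: X_def Jl_def indicator_def)
    qed
  qed
  \<comment> \<open>Both parts are integrable, one by Green's formula for the straight polygon and
    the other because \<open>K\<close> is bounded on the box, although the loops of single edges may
    fail to be.\<close>
  have iX: "integrable lborel X"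
    unfolding Xeq[abs_def] using iJl iI by (intro Bochner_Integration.integrable_diff integrable_mult_right)
  have "(LINT w|lborel. X w) = 0"
    unfolding X_def using N(3) Kc inv C1 iX[unfolded X_def[abs_def]]
    by (intro integral_winding_difference_eq_0[OF ec el]) (auto simp: N_def)
  moreover have "(LINT w|lborel. X w) = (LINT w|lborel. Jl w) - 2 * pi * \<i> * (LINT w|lborel. indicator (?I - N) w *\<^sub>R K w)"
    unfolding Xeq by (subst Bochner_Integration.integral_diff[OF iJl]) (use iI in \<open>auto simp del: mult_scaleR_right\<close>)
  ultimately have "polygon_integral g a b la lb P = \<i> * (LINT w|lborel. indicator (?I - N) w *\<^sub>R K w)"
    unfolding LJl by simp
  then have val: "(LINT w|lborel. indicator (?I - N) w *\<^sub>R K w) = polygon_integral g a b la lb P / \<i>"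
    by simp
  have "((\<lambda>w. indicator (?I - N) w *\<^sub>R K w) has_integral (polygon_integral g a b la lb P / \<i>)) UNIV"
    using has_integral_integral_lborel[OF iI] unfolding val .
  then have hi: "(K has_integral (polygon_integral g a b la lb P / \<i>)) (?I - N)"
    unfolding indicator_scaleR_eq_if has_integral_restrict_UNIV .
  have negN: "negligible N"
    using N(3) by (simp add: negligible_iff_null_sets null_sets_completionI)
  show ?thesis
  proof (rule iffD1[OF has_integral_spike_set_eq hi])
    show "negligible {x \<in> (?I - N) - F. K x \<noteq> 0}" by (rule negligible_subset[OF negN]) (auto simp: F)
    show "negligible {x \<in> F - (?I - N). K x \<noteq> 0}" by (rule negligible_subset[OF negN]) (use pN in \<open>auto simp: F\<close>)
  qed
qed

end

section \<open>Cocycles and the Goldman form\<close>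

lemma matrix_inv_eqI:
  fixes A :: "'a::field^'n^'n"
  assumes "A ** B = mat 1"
  shows "matrix_inv A = B" "matrix_inv A ** A = mat 1" "A ** matrix_inv A = mat 1"
proof -
  have BA: "B ** A = mat 1" using assms matrix_left_right_inverse by blast
  then have "A ** matrix_inv A = mat 1 \<and> matrix_inv A ** A = mat 1"
    unfolding matrix_inv_def using assms by (intro someI[of "\<lambda>A'. A ** A' = mat 1 \<and> A' ** A = mat 1" B]) auto
  then show 1: "matrix_inv A ** A = mat 1" "A ** matrix_inv A = mat 1" by auto
  have "matrix_inv A = matrix_inv A ** (A ** B)" using assms by simp
  also have "\<dots> = B" using 1(1) by (simp add: matrix_mul_assoc)
  finally show "matrix_inv A = B" .
qed

lemma mat_adj_nth: "mat_adj A $ i $ j = cnj (A $ j $ i)"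
  by (simp add: mat_adj_def transpose_def)

lemma mat_adj_simps: "mat_adj (A ** B) = mat_adj B ** mat_adj A" "mat_adj (mat_adj A) = A"
  "mat_adj (A + B) = mat_adj A + mat_adj B" "mat_adj (A - B) = mat_adj A - mat_adj B"
  by (auto simp: vec_eq_iff mat_adj_nth matrix_matrix_mult_def mult.commute)

lemma trace_mat_adj: "trace (mat_adj A) = cnj (trace A)"
  by (simp add: trace_def mat_adj_nth)

lemma trace_mult_eq: "trace (A ** B) = (\<Sum>i\<in>UNIV. \<Sum>j\<in>UNIV. A $ i $ j * B $ j $ i)"
  for A B :: "'a::comm_semiring_1^'n^'n"
  by (simp add: trace_def matrix_matrix_mult_def)

lemma matrix_mult_diff: "A ** (B - C) = A ** B - A ** C" "(B - C) ** A = B ** A - C ** A"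
  for A B C :: "'a::comm_ring_1^'n^'n"
  by (auto simp: vec_eq_iff matrix_matrix_mult_def right_diff_distrib left_diff_distrib sum_subtractf)

lemma matrix_mult_add: "A ** (B + C) = A ** B + A ** C" "(B + C) ** A = B ** A + C ** A"
  for A B C :: "'a::comm_ring_1^'n^'n"
  by (auto simp: vec_eq_iff matrix_matrix_mult_def distrib_left distrib_right sum.distrib)

locale fuchsian_rep = fuchsian_polygon \<Gamma> g a b v0
  for \<Gamma> g a b v0 +
  fixes \<rho> :: "real^2^2 \<Rightarrow> complex^'n^'n"
  assumes unitary: "unitary_rep \<Gamma> \<rho>"
begin

lemma rho_mult: "x \<in> \<Gamma> \<Longrightarrow> y \<in> \<Gamma> \<Longrightarrow> \<rho> (x ** y) = \<rho> x ** \<rho> y"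
  and rho_unitary: "x \<in> \<Gamma> \<Longrightarrow> \<rho> x ** mat_adj (\<rho> x) = mat 1"
  using unitary by (auto simp: unitary_rep_def)

lemma rho_inv:
  assumes "x \<in> \<Gamma>"
  shows "matrix_inv (\<rho> x) = mat_adj (\<rho> x)" "matrix_inv (\<rho> x) ** \<rho> x = mat 1" "\<rho> x ** matrix_inv (\<rho> x) = mat 1"
  using matrix_inv_eqI[OF rho_unitary[OF assms]] by auto

lemma rho_one: "\<rho> (mat 1) = mat 1"
proof -
  have "\<rho> (mat 1) ** \<rho> (mat 1) = \<rho> (mat 1)" using rho_mult[OF one_in one_in] by simp
  then have "\<rho> (mat 1) ** (\<rho> (mat 1) ** matrix_inv (\<rho> (mat 1))) = \<rho> (mat 1) ** matrix_inv (\<rho> (mat 1))"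
    by (simp add: matrix_mul_assoc)
  then show ?thesis using rho_inv(3)[OF one_in] by simp
qed

definition Ad :: "real^2^2 \<Rightarrow> complex^'n^'n \<Rightarrow> complex^'n^'n" where
  "Ad x X = \<rho> x ** X ** matrix_inv (\<rho> x)"

lemma Ad_mult: "x \<in> \<Gamma> \<Longrightarrow> y \<in> \<Gamma> \<Longrightarrow> Ad (x ** y) X = Ad x (Ad y X)"
proof -
  assume xy: "x \<in> \<Gamma>" "y \<in> \<Gamma>"
  have "(\<rho> x ** \<rho> y) ** (matrix_inv (\<rho> y) ** matrix_inv (\<rho> x)) = \<rho> x ** (\<rho> y ** matrix_inv (\<rho> y)) ** matrix_inv (\<rho> x)"
    by (simp only: matrix_mul_assoc)
  also have "\<dots> = mat 1" using rho_inv(3) xy by simp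
  finally have "matrix_inv (\<rho> (x ** y)) = matrix_inv (\<rho> y) ** matrix_inv (\<rho> x)"
    unfolding rho_mult[OF xy] by (rule matrix_inv_eqI)
  then show ?thesis unfolding Ad_def rho_mult[OF xy] by (simp only: matrix_mul_assoc)
qed

lemma Ad_one: "Ad (mat 1) X = X"
  using rho_inv(3)[OF one_in] by (simp add: Ad_def rho_one)

lemma Ad_inv: "x \<in> \<Gamma> \<Longrightarrow> Ad (matrix_inv x) (Ad x X) = X" "x \<in> \<Gamma> \<Longrightarrow> Ad x (Ad (matrix_inv x) X) = X"
  using Ad_mult[of "matrix_inv x" x X] Ad_mult[of x "matrix_inv x" X] inv_in inv_cancel by (auto simp: Ad_one)

lemma Ad_add: "Ad x (X + Y) = Ad x X + Ad x Y" "Ad x (X - Y) = Ad x X - Ad x Y"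
  by (simp_all add: Ad_def matrix_mult_add matrix_mult_diff)

lemma mat_adj_Ad: "x \<in> \<Gamma> \<Longrightarrow> mat_adj (Ad x X) = Ad x (mat_adj X)"
  by (simp add: Ad_def mat_adj_simps rho_inv(1) matrix_mul_assoc)

lemma trace_Ad: "x \<in> \<Gamma> \<Longrightarrow> trace (Ad x X) = trace X"
  unfolding Ad_def by (subst trace_mul_sym) (simp add: matrix_mul_assoc rho_inv(2))

lemma Ad_matrix_mult: "x \<in> \<Gamma> \<Longrightarrow> Ad x X ** Ad x Y = Ad x (X ** Y)"
proof -
  assume x: "x \<in> \<Gamma>"
  have "Ad x X ** Ad x Y = \<rho> x ** X ** (matrix_inv (\<rho> x) ** \<rho> x) ** Y ** matrix_inv (\<rho> x)"
    unfolding Ad_def by (simp only: matrix_mul_assoc)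
  then show ?thesis using rho_inv(2)[OF x] by (simp add: Ad_def matrix_mul_assoc)
qed

lemma trace_mult_Ad: "x \<in> \<Gamma> \<Longrightarrow> trace (X ** Ad x Y) = trace (Ad (matrix_inv x) X ** Y)"
  using trace_Ad[of "matrix_inv x" "X ** Ad x Y"] Ad_matrix_mult[of "matrix_inv x" X "Ad x Y"] inv_in Ad_inv(1) by simp

text \<open>Crossed homomorphisms for the adjoint action. Group elements are matrices, and the
  relation of the generators holds up to sign, so the value at \<open>- mat 1\<close> is prescribed
  as well.\<close>

definition cocycle :: "(real^2^2 \<Rightarrow> complex^'n^'n) \<Rightarrow> bool" where
  "cocycle \<xi> \<longleftrightarrow> (\<forall>x\<in>\<Gamma>. \<forall>y\<in>\<Gamma>. \<xi> (x ** y) = \<xi> x + Ad x (\<xi> y)) \<and> \<xi> (mat 1) = 0 \<and> \<xi> (- mat 1) = 0"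

lemma cocycle_Ad: "cocycle \<xi> \<Longrightarrow> x \<in> \<Gamma> \<Longrightarrow> y \<in> \<Gamma> \<Longrightarrow> Ad x (\<xi> y) = \<xi> (x ** y) - \<xi> x"
  by (simp add: cocycle_def)

lemma cocycle_inv: "cocycle \<xi> \<Longrightarrow> x \<in> \<Gamma> \<Longrightarrow> Ad (matrix_inv x) (\<xi> x) = - \<xi> (matrix_inv x)"
  using cocycle_Ad[of \<xi> "matrix_inv x" x] inv_in inv_cancel(1)[of x] by (simp add: cocycle_def)

text \<open>The shape in which the boundary integral delivers the pairing: the differences of
  \<open>\<xi>\<close> are the jumps of the first primitive between paired sides, pulled back to the
  edge, and \<open>A k\<close>, \<open>B k\<close> stand for increments of the second primitive
  along the edges.\<close>

definition side_form ::
  "(real^2^2 \<Rightarrow> complex^'n^'n) \<Rightarrow> (nat \<Rightarrow> complex^'n^'n) \<Rightarrow> (nat \<Rightarrow> complex^'n^'n) \<Rightarrow> complex" where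
  "side_form \<xi> A B = (\<Sum>k=1..g.
      trace ((\<xi> (matrix_inv (side_a' a b k)) - \<xi> (matrix_inv (side_a a b k))) ** A k)
    + trace ((\<xi> (matrix_inv (side_b' a b k)) - \<xi> (matrix_inv (side_b a b k))) ** B k))"

lemma matrix_inv_mult: "x \<in> \<Gamma> \<Longrightarrow> y \<in> \<Gamma> \<Longrightarrow> matrix_inv (x ** y) = matrix_inv y ** matrix_inv x"
proof -
  assume xy: "x \<in> \<Gamma>" "y \<in> \<Gamma>"
  have "(x ** y) ** (matrix_inv y ** matrix_inv x) = x ** (y ** matrix_inv y) ** matrix_inv x"
    by (simp only: matrix_mul_assoc)
  also have "\<dots> = mat 1" using inv_cancel xy by simp
  finally show ?thesis by (rule matrix_inv_eqI)
qed

text \<open>Invariance of the trace moves the conjugation to the first factor, where the cocycle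
  identity resolves it. The elements \<open>alpha_gen\<close> and \<open>beta_gen\<close> are made
  for this: multiplied on the left by the inverse of \<open>Rprod a b (k - 1)\<close> or
  \<open>Rprod a b k\<close>, they become the inverses of \<open>side_a'\<close> and
  \<open>side_b\<close>.\<close>

lemma goldman_form_eq_side_form:
  assumes \<xi>: "cocycle \<xi>"
  shows "goldman_form g a b \<rho> \<xi> \<eta> = side_form \<xi> (\<lambda>k. \<eta> (a k)) (\<lambda>k. \<eta> (b k))"
  unfolding goldman_form_def side_form_def
proof (rule sum.cong[OF refl])
  fix k assume k: "k \<in> {1..g}"
  note s = side_in[OF k] and ab = gens[OF k]
  have Rk: "Rprod a b k = side_b' a b k" using side_b'_eq[of k a b] k by simp
  have 1: "matrix_inv (side_a a b k) ** alpha_gen a b k = matrix_inv (side_a' a b k)"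
  proof -
    have "side_a' a b k = side_b' a b k ** b k" by (simp add: side_b'_def inv_cancel(3)[OF ab(2)])
    then have "matrix_inv (side_a' a b k) = matrix_inv (b k) ** matrix_inv (side_b' a b k)"
      using matrix_inv_mult[OF s(4) ab(2)] by simp
    moreover have "matrix_inv (side_a a b k) ** alpha_gen a b k = (matrix_inv (side_a a b k) ** side_a a b k) ** matrix_inv (b k) ** matrix_inv (side_b' a b k)"
      unfolding alpha_gen_def Rk by (simp only: matrix_mul_assoc side_a_def)
    ultimately show ?thesis using inv_cancel(1)[OF s(1)] by (simp add: matrix_mul_assoc)
  qed
  have 2: "matrix_inv (side_b' a b k) ** beta_gen a b k = matrix_inv (side_b a b k)"
  proof -
    have "side_b a b k = side_a a b k ** a k" by (simp add: side_b_def side_a_def)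
    then have "matrix_inv (side_b a b k) = matrix_inv (a k) ** matrix_inv (side_a a b k)"
      using matrix_inv_mult[OF s(1) ab(1)] by simp
    moreover have "matrix_inv (side_b' a b k) ** beta_gen a b k = (matrix_inv (side_b' a b k) ** side_b' a b k) ** matrix_inv (a k) ** matrix_inv (side_a a b k)"
      unfolding beta_gen_def Rk by (simp only: matrix_mul_assoc side_a_def)
    ultimately show ?thesis using inv_cancel(1)[OF s(4)] by (simp add: matrix_mul_assoc)
  qed
  have al: "alpha_gen a b k \<in> \<Gamma>" "beta_gen a b k \<in> \<Gamma>"
    using s ab unfolding alpha_gen_def beta_gen_def Rk side_a_def[symmetric] by (auto intro!: mult_in inv_in)
  have "trace (\<xi> (alpha_gen a b k) ** Ad (side_a a b k) (\<eta> (a k))) = trace ((\<xi> (matrix_inv (side_a' a b k)) - \<xi> (matrix_inv (side_a a b k))) ** \<eta> (a k))"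
    unfolding trace_mult_Ad[OF s(1)] cocycle_Ad[OF \<xi> inv_in[OF s(1)] al(1)] 1 ..
  moreover have "trace (\<xi> (beta_gen a b k) ** Ad (side_b' a b k) (\<eta> (b k))) = trace ((\<xi> (matrix_inv (side_b a b k)) - \<xi> (matrix_inv (side_b' a b k))) ** \<eta> (b k))"
    unfolding trace_mult_Ad[OF s(4)] cocycle_Ad[OF \<xi> inv_in[OF s(4)] al(2)] 2 ..
  ultimately show "trace (\<xi> (alpha_gen a b k) ** \<rho> (Rprod a b (k - 1)) ** \<eta> (a k) ** matrix_inv (\<rho> (Rprod a b (k - 1))))
      - trace (\<xi> (beta_gen a b k) ** \<rho> (Rprod a b k) ** \<eta> (b k) ** matrix_inv (\<rho> (Rprod a b k)))
    = trace ((\<xi> (matrix_inv (side_a' a b k)) - \<xi> (matrix_inv (side_a a b k))) ** \<eta> (a k))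
    + trace ((\<xi> (matrix_inv (side_b' a b k)) - \<xi> (matrix_inv (side_b a b k))) ** \<eta> (b k))"
    unfolding Ad_def Rk side_a_def by (simp add: matrix_mul_assoc matrix_mult_diff trace_sub)
qed

text \<open>The pairing of a cocycle with a coboundary telescopes along the boundary word.\<close>

lemma side_form_coboundary:
  assumes \<xi>: "cocycle \<xi>"
  shows "side_form \<xi> (\<lambda>k. A k + (Ad (a k) C - C)) (\<lambda>k. B k + (Ad (b k) C - C)) = side_form \<xi> A B"
proof -
  let ?c = "\<lambda>x. \<xi> (matrix_inv x)"
  \<comment> \<open>Moving \<open>Ad\<close> to the first factor turns each summand into values of
    \<open>\<xi>\<close> at the inverses of elements leading to vertices; within a block the
    intermediate vertices cancel.\<close>
  have tele: "trace ((?c (side_a' a b k) - ?c (side_a a b k)) ** (Ad (a k) C - C)) + trace ((?c (side_b' a b k) - ?c (side_b a b k)) ** (Ad (b k) C - C))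
     = trace (?c (Rprod a b (k - 1)) ** C) - trace (?c (Rprod a b k) ** C)" if k: "k \<in> {1..g}" for k
  proof -
    note s = side_in[OF k] and ab = gens[OF k]
    have Rk: "Rprod a b k = side_b' a b k" using side_b'_eq[of k a b] k by simp
    have m: "Ad (matrix_inv y) (?c x) = ?c (x ** y) - ?c y" if "x \<in> \<Gamma>" "y \<in> \<Gamma>" for x y
      using cocycle_Ad[OF \<xi> inv_in[OF that(2)] inv_in[OF that(1)]] matrix_inv_mult[OF that] by simp
    have p: "side_a' a b k ** a k = side_b a b k ** b k" "side_a a b k ** a k = side_b a b k" "side_b' a b k ** b k = side_a' a b k"
      by (simp_all add: side_a'_def side_b_def side_a_def side_b'_def inv_cancel(3)[OF ab(1)] inv_cancel(3)[OF ab(2)])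
    have "trace ((?c (side_a' a b k) - ?c (side_a a b k)) ** Ad (a k) C) = trace ((?c (side_b a b k ** b k) - ?c (side_b a b k)) ** C)"
      unfolding trace_mult_Ad[OF ab(1)] Ad_add m[OF s(3) ab(1)] m[OF s(1) ab(1)] p by simp
    moreover have "trace ((?c (side_b' a b k) - ?c (side_b a b k)) ** Ad (b k) C) = trace ((?c (side_a' a b k) - ?c (side_b a b k ** b k)) ** C)"
      unfolding trace_mult_Ad[OF ab(2)] Ad_add m[OF s(4) ab(2)] m[OF s(2) ab(2)] p by simp
    ultimately show ?thesis
      unfolding Rk side_a_def[symmetric] by (simp add: matrix_mult_diff trace_sub)
  qed
  have "side_form \<xi> (\<lambda>k. A k + (Ad (a k) C - C)) (\<lambda>k. B k + (Ad (b k) C - C)) = side_form \<xi> A B +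
     (\<Sum>k=1..g. trace ((?c (side_a' a b k) - ?c (side_a a b k)) ** (Ad (a k) C - C)) + trace ((?c (side_b' a b k) - ?c (side_b a b k)) ** (Ad (b k) C - C)))"
    unfolding side_form_def sum.distrib[symmetric] 
    by (intro sum.cong refl) (simp only: matrix_mult_add(1) trace_add ac_simps)
  also have "(\<Sum>k=1..g. trace ((?c (side_a' a b k) - ?c (side_a a b k)) ** (Ad (a k) C - C)) + trace ((?c (side_b' a b k) - ?c (side_b a b k)) ** (Ad (b k) C - C)))
     = (\<Sum>k=1..g. trace (?c (Rprod a b (k - 1)) ** C) - trace (?c (Rprod a b k) ** C))"
    by (rule sum.cong[OF refl tele])
  also have "\<dots> = trace (?c (Rprod a b 0) ** C) - trace (?c (Rprod a b g) ** C)"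
    by (induction g) simp_all
  \<comment> \<open>The two remaining elements are the identity and plus or minus the identity,
    where the cocycle vanishes.\<close>
  also have "\<dots> = 0"
  proof -
    have "matrix_inv (mat 1 :: real^2^2) = mat 1" by (rule matrix_inv_eqI) simp
    moreover have "matrix_inv (- mat 1 :: real^2^2) = - mat 1"
      by (rule matrix_inv_eqI) (simp add: vec_eq_iff matrix_matrix_mult_def mat_def sum_2 forall_2)
    ultimately show ?thesis using rel \<xi> by (auto simp: cocycle_def)
  qed
  finally show ?thesis by simp
qed

end

section \<open>Primitives of harmonic forms\<close>

text \<open>The condition is \<open>dN = \<mu> dzbar\<close> with \<open>N z0 = 0\<close>. The
  entries are conjugated because \<open>\<mu>\<close> is antiholomorphic, so that complex
  derivatives can be used.\<close>

definition conj_primitive :: "(complex \<Rightarrow> complex^'n^'n) \<Rightarrow> complex \<Rightarrow> (complex \<Rightarrow> complex^'n^'n) \<Rightarrow> bool" where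
  "conj_primitive \<mu> z0 N \<longleftrightarrow> N z0 = 0 \<and> (\<forall>z\<in>\<H>. \<forall>i j.
     ((\<lambda>z. cnj (N z $ i $ j)) has_field_derivative cnj (\<mu> z $ i $ j)) (at z))"

lemma conj_primitive_exists:
  fixes \<mu> :: "complex \<Rightarrow> complex^'n^'n"
  assumes "\<And>i j. (\<lambda>z. cnj (\<mu> z $ i $ j)) holomorphic_on \<H>"
  obtains N where "conj_primitive \<mu> z0 N"
proof -
  have "\<exists>G. \<forall>z\<in>\<H>. (G has_field_derivative cnj (\<mu> z $ i $ j)) (at z)" for i j
    using holomorphic_convex_primitive'[OF upper_half_plane_simps(2,1) assms[of i j]] upper_half_plane_simps(1)
    by (metis at_within_open)
  then obtain G where G: "\<And>i j z. z \<in> \<H> \<Longrightarrow> (G i j has_field_derivative cnj (\<mu> z $ i $ j)) (at z)"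
    by metis
  show thesis
  proof (rule that[of "\<lambda>z. \<chi> i j. cnj (G i j z - G i j z0)"])
    show "conj_primitive \<mu> z0 (\<lambda>z. \<chi> i j. cnj (G i j z - G i j z0))"
      unfolding conj_primitive_def using G by (auto simp: vec_eq_iff intro!: derivative_eq_intros)
  qed
qed

definition skew :: "complex^'n^'n \<Rightarrow> complex^'n^'n" where "skew A = A - mat_adj A"

lemma skew_add: "skew (A + B) = skew A + skew B" "skew (A - B) = skew A - skew B"
  by (auto simp: skew_def mat_adj_simps)

context fuchsian_rep begin

lemma harmonic_transform:
  assumes "harmonic_01 \<Gamma> \<rho> \<mu>" "x \<in> \<Gamma>" "z \<in> \<H>"
  shows "(\<chi> i j. \<mu> (mob x z) $ i $ j * cnj (deriv (mob x) z)) = Ad x (\<mu> z)"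
  using assms by (simp add: harmonic_01_def Ad_def)

text \<open>The transformation law of \<open>\<mu>\<close> gives \<open>N (mob x z)\<close> and
  \<open>Ad x (N z)\<close> the same derivative, so they differ by a constant, which is read off at
  \<open>z0\<close>, where \<open>N\<close> vanishes.\<close>

lemma conj_primitive_equivariant:
  assumes \<mu>: "harmonic_01 \<Gamma> \<rho> \<mu>" and N: "conj_primitive \<mu> z0 N" and x: "x \<in> \<Gamma>" and z0: "z0 \<in> \<H>" and z: "z \<in> \<H>"
  shows "N (mob x z) = Ad x (N z) + N (mob x z0)"
proof -
  have dN: "((\<lambda>z. cnj (N z $ i $ j)) has_field_derivative cnj (\<mu> z $ i $ j)) (at z)" if "z \<in> \<H>" for z i j
    using N that by (auto simp: conj_primitive_def)
  have "(N (mob x z) - Ad x (N z)) $ i $ j = (N (mob x z0) - Ad x (N z0)) $ i $ j" for i j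
  proof -
    let ?D = "\<lambda>z. cnj ((N (mob x z) - Ad x (N z)) $ i $ j)"
    have "?D z = ?D z0"
    proof -
      have "(?D has_field_derivative 0) (at w)" if w: "w \<in> \<H>" for w
      proof -
        have 1: "((\<lambda>z. cnj (N (mob x z) $ i $ j)) has_field_derivative cnj (\<mu> (mob x w) $ i $ j) * deriv (mob x) w) (at w)"
          using DERIV_chain2[OF dN[OF mob_in[OF x w]] mob_has_field_derivative[OF det1[OF x] w]] deriv_mob[OF det1[OF x] w] by simp
        have 2: "((\<lambda>z. cnj (Ad x (N z) $ i $ j)) has_field_derivative cnj (Ad x (\<mu> w) $ i $ j)) (at w)"
          unfolding Ad_def matrix_matrix_mult_def vec_lambda_beta cnj_sum complex_cnj_mult
          by (intro DERIV_sum DERIV_cmult DERIV_cmult_right dN[OF w])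
        have "cnj (Ad x (\<mu> w) $ i $ j) = cnj (\<mu> (mob x w) $ i $ j) * deriv (mob x) w"
          using harmonic_transform[OF \<mu> x w] by (metis (no_types, lifting) complex_cnj_cnj complex_cnj_mult vec_lambda_beta)
        then show ?thesis using DERIV_diff[OF 1 2] by simp
      qed
      then obtain k where "\<And>w. w \<in> \<H> \<Longrightarrow> ?D w = k"
        using has_field_derivative_zero_constant[OF upper_half_plane_simps(2), of ?D]
        by (metis (no_types, lifting) has_field_derivative_at_within)
      from this[OF z] this[OF z0] show ?thesis by (rule trans[OF _ sym])
    qed
    then show ?thesis by (simp only: complex_cnj_cancel_iff)
  qed
  then have "N (mob x z) - Ad x (N z) = N (mob x z0) - Ad x (N z0)" by (simp add: vec_eq_iff)
  moreover have "Ad x (N z0) = 0" using N by (simp add: conj_primitive_def Ad_def)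
  ultimately show ?thesis by (simp add: algebra_simps)
qed

lemma skew_Ad: "x \<in> \<Gamma> \<Longrightarrow> skew (Ad x X) = Ad x (skew X)"
  by (simp add: skew_def mat_adj_Ad Ad_add)

lemma neg_one_in: "- mat 1 \<in> \<Gamma>"
  using SL one_in by (auto simp: SL2R_subgroup_def)

lemma unitary_cocycle_ES_period:
  assumes \<mu>: "harmonic_01 \<Gamma> \<rho> \<mu>" and N: "conj_primitive \<mu> z0 N" and x: "x \<in> \<Gamma>" and z0: "z0 \<in> \<H>"
  shows "unitary_cocycle (ES_period \<mu> z0) x = skew (N (mob x z0))"
proof -
  have "ES_period \<mu> z0 x = N (mob x z0)"
  proof -
    have seg: "closed_segment z0 (mob x z0) \<subseteq> \<H>"
      using closed_segment_subset[OF z0 mob_in[OF x z0] upper_half_plane_simps(2)] .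
    have "contour_integral (linepath z0 (mob x z0)) (\<lambda>z. cnj (\<mu> z $ i $ j)) = cnj (N (mob x z0) $ i $ j) - cnj (N z0 $ i $ j)" for i j
    proof -
      have d: "((\<lambda>z. cnj (N z $ i $ j)) has_field_derivative cnj (\<mu> w $ i $ j)) (at w within \<H>)" if "w \<in> \<H>" for w
        using N that by (auto simp: conj_primitive_def intro: has_field_derivative_at_within)
      have "((\<lambda>z. cnj (\<mu> z $ i $ j)) has_contour_integral (cnj (N (mob x z0) $ i $ j) - cnj (N z0 $ i $ j))) (linepath z0 (mob x z0))"
        using contour_integral_primitive[OF d, of "linepath z0 (mob x z0)"] seg by simp
      then show ?thesis by (rule contour_integral_unique)
    qed
    then show ?thesis using N by (simp add: ES_period_def vec_eq_iff conj_primitive_def)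
  qed
  then show ?thesis by (simp add: unitary_cocycle_def skew_def)
qed

text \<open>Equivariance of the primitive at the point \<open>mob y z0\<close> is the cocycle
  identity; \<open>skew\<close> commutes with \<open>Ad\<close> because \<open>\<rho>\<close> is
  unitary.\<close>

lemma cocycle_ES_period:
  assumes \<mu>: "harmonic_01 \<Gamma> \<rho> \<mu>" and N: "conj_primitive \<mu> z0 N" and z0: "z0 \<in> \<H>"
  shows "cocycle (unitary_cocycle (ES_period \<mu> z0))"
proof -
  note u = unitary_cocycle_ES_period[OF \<mu> N _ z0]
  have "skew (N z0) = 0" using N by (simp add: conj_primitive_def skew_def vec_eq_iff mat_adj_nth)
  then have "unitary_cocycle (ES_period \<mu> z0) (mat 1) = 0" "unitary_cocycle (ES_period \<mu> z0) (- mat 1) = 0"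
    using u[OF one_in] u[OF neg_one_in] by auto
  moreover have "unitary_cocycle (ES_period \<mu> z0) (x ** y) = unitary_cocycle (ES_period \<mu> z0) x + Ad x (unitary_cocycle (ES_period \<mu> z0) y)"
    if "x \<in> \<Gamma>" "y \<in> \<Gamma>" for x y
    using conj_primitive_equivariant[OF \<mu> N that(1) z0 mob_in[OF that(2) z0]] that
    by (simp add: u mult_in mob_mult_in[OF that z0] skew_add skew_Ad add.commute)
  ultimately show ?thesis by (simp add: cocycle_def)
qed

end

section \<open>The cup product of two harmonic forms as a boundary integral\<close>

locale harmonic_pair = fuchsian_rep \<Gamma> g a b v0 \<rho>
  for \<Gamma> g a b v0 and \<rho> :: "real^2^2 \<Rightarrow> complex^'n^'n" +
  fixes \<mu>1 \<mu>2 N1 N2 :: "complex \<Rightarrow> complex^'n^'n" and z0 :: complex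
  assumes z0: "z0 \<in> \<H>" and \<mu>1: "harmonic_01 \<Gamma> \<rho> \<mu>1" and \<mu>2: "harmonic_01 \<Gamma> \<rho> \<mu>2"
    and N1: "conj_primitive \<mu>1 z0 N1" and N2: "conj_primitive \<mu>2 z0 N2"
begin

abbreviation "\<xi>1 \<equiv> unitary_cocycle (ES_period \<mu>1 z0)"
abbreviation "\<xi>2 \<equiv> unitary_cocycle (ES_period \<mu>2 z0)"

lemma derN: "z \<in> \<H> \<Longrightarrow> ((\<lambda>z. cnj (N1 z $ i $ j)) has_field_derivative cnj (\<mu>1 z $ i $ j)) (at z)"
  "z \<in> \<H> \<Longrightarrow> ((\<lambda>z. cnj (N2 z $ i $ j)) has_field_derivative cnj (\<mu>2 z $ i $ j)) (at z)"
  using N1 N2 by (auto simp: conj_primitive_def)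

lemma holN: "(\<lambda>z. cnj (N1 z $ i $ j)) holomorphic_on \<H>" "(\<lambda>z. cnj (N2 z $ i $ j)) holomorphic_on \<H>"
  "(\<lambda>z. cnj (\<mu>1 z $ i $ j)) holomorphic_on \<H>" "(\<lambda>z. cnj (\<mu>2 z $ i $ j)) holomorphic_on \<H>"
  using \<mu>1 \<mu>2 derN unfolding harmonic_01_def holomorphic_on_open[OF upper_half_plane_simps(1)] by blast+

lemma contN: "continuous_on \<H> (\<lambda>z. N1 z $ i $ j)" "continuous_on \<H> (\<lambda>z. \<mu>2 z $ i $ j)"
  using continuous_on_cnj[OF holomorphic_on_imp_continuous_on[OF holN(1)]]
    continuous_on_cnj[OF holomorphic_on_imp_continuous_on[OF holN(4)]] by simp_all

text \<open>With \<open>\<Phi> = skew N\<close> and \<open>d\<Phi>2 = \<mu>2 dzbar - \<mu>2* dz\<close>, the functional \<open>cup_integral\<close> is the integral of \<open>tr (\<Phi>1 d\<Phi>2)\<close>.\<close>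

definition dz_coeff where "dz_coeff z = trace (skew (N1 z) ** mat_adj (\<mu>2 z))"
definition cnj_dzbar_coeff where "cnj_dzbar_coeff z = cnj (trace (skew (N1 z) ** \<mu>2 z))"
definition cup_integral where "cup_integral c = cnj (contour_integral c cnj_dzbar_coeff) - contour_integral c dz_coeff"

lemma cont_coeff: "continuous_on \<H> dz_coeff" "continuous_on \<H> cnj_dzbar_coeff"
  unfolding dz_coeff_def cnj_dzbar_coeff_def trace_mult_eq skew_def mat_adj_nth vector_minus_component
  by (intro continuous_intros contN)+

text \<open>For a constant matrix \<open>Y\<close> the form \<open>tr (Y d\<Phi>2)\<close> is exact.
  Contour integrals are taken against dz, so its dzbar part appears through the conjugate
  coefficient.\<close>

lemma trace_primitive:
  assumes "valid_path c" "path_image c \<subseteq> \<H>"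
  shows "((\<lambda>z. trace (Y ** mat_adj (\<mu>2 z))) has_contour_integral (trace (Y ** mat_adj (N2 (pathfinish c) - N2 (pathstart c))))) c"
    and "((\<lambda>z. cnj (trace (Y ** \<mu>2 z))) has_contour_integral (cnj (trace (Y ** (N2 (pathfinish c) - N2 (pathstart c)))))) c"
proof -
  have 1: "((\<lambda>z. trace (Y ** mat_adj (N2 z))) has_field_derivative trace (Y ** mat_adj (\<mu>2 z))) (at z within \<H>)"
    if "z \<in> \<H>" for z
    unfolding trace_mult_eq mat_adj_nth
    by (intro has_field_derivative_at_within[OF DERIV_sum] DERIV_sum DERIV_cmult derN(2)[OF that])
  have 2: "((\<lambda>z. cnj (trace (Y ** N2 z))) has_field_derivative cnj (trace (Y ** \<mu>2 z))) (at z within \<H>)"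
    if "z \<in> \<H>" for z
    unfolding trace_mult_eq cnj_sum complex_cnj_mult
    by (intro has_field_derivative_at_within[OF DERIV_sum] DERIV_sum DERIV_cmult derN(2)[OF that])
  show "((\<lambda>z. trace (Y ** mat_adj (\<mu>2 z))) has_contour_integral (trace (Y ** mat_adj (N2 (pathfinish c) - N2 (pathstart c))))) c"
    using contour_integral_primitive[OF 1 assms] by (simp add: mat_adj_simps matrix_mult_diff trace_sub)
  show "((\<lambda>z. cnj (trace (Y ** \<mu>2 z))) has_contour_integral (cnj (trace (Y ** (N2 (pathfinish c) - N2 (pathstart c)))))) c"
    using contour_integral_primitive[OF 2 assms] by (simp add: matrix_mult_diff trace_sub)
qed

text \<open>Under \<open>mob x\<close> the first primitive becomes
  \<open>Ad x (skew (N1 z)) + \<xi>1 x\<close>, and the second form is conjugated by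
  \<open>Ad x\<close>. Invariance of the trace returns the original integral from the first summand;
  the constant \<open>\<xi>1 x\<close> contributes an exact form, and \<open>cocycle_inv\<close>
  brings in the inverse and the sign.\<close>

lemma cup_integral_mob:
  assumes c: "c C1_differentiable_on {0..1}" "path_image c \<subseteq> \<H>" and x: "x \<in> \<Gamma>"
  shows "cup_integral (mob x \<circ> c) = cup_integral c - trace (\<xi>1 (matrix_inv x) ** (skew (N2 (pathfinish c)) - skew (N2 (pathstart c))))"
proof -
  have vc: "valid_path c" by (rule C1_path(3)[OF c(1)])
  define Y where "Y = - \<xi>1 (matrix_inv x)"
  have Y: "trace (\<xi>1 x ** Ad x Z) = trace (Y ** Z)" for Z
    unfolding trace_mult_Ad[OF x] cocycle_inv[OF cocycle_ES_period[OF \<mu>1 N1 z0] x] Y_def ..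
  have S: "skew (N1 (mob x z)) = Ad x (skew (N1 z)) + \<xi>1 x" if "z \<in> \<H>" for z
    using conj_primitive_equivariant[OF \<mu>1 N1 x z0 that] unitary_cocycle_ES_period[OF \<mu>1 N1 x z0]
    by (simp add: skew_add skew_Ad[OF x])
  have m: "(\<chi> i j. \<mu>2 (mob x z) $ i $ j * cnj (deriv (mob x) z)) = Ad x (\<mu>2 z)" if "z \<in> \<H>" for z
    by (rule harmonic_transform[OF \<mu>2 x that])
  have e1: "deriv (mob x) z * dz_coeff (mob x z) = dz_coeff z + trace (Y ** mat_adj (\<mu>2 z))" if z: "z \<in> \<H>" for z
  proof -
    have "deriv (mob x) z * dz_coeff (mob x z) = trace (skew (N1 (mob x z)) ** mat_adj (\<chi> i j. \<mu>2 (mob x z) $ i $ j * cnj (deriv (mob x) z)))"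
      by (simp add: dz_coeff_def trace_mult_eq mat_adj_nth sum_distrib_left mult_ac)
    also have "\<dots> = trace (Ad x (skew (N1 z) ** mat_adj (\<mu>2 z))) + trace (\<xi>1 x ** Ad x (mat_adj (\<mu>2 z)))"
      unfolding m[OF z] mat_adj_Ad[OF x] S[OF z] matrix_mult_add(2) Ad_matrix_mult[OF x] trace_add ..
    finally show ?thesis unfolding Y trace_Ad[OF x] dz_coeff_def .
  qed
  have e2: "deriv (mob x) z * cnj_dzbar_coeff (mob x z) = cnj_dzbar_coeff z + cnj (trace (Y ** \<mu>2 z))" if z: "z \<in> \<H>" for z
  proof -
    have "deriv (mob x) z * cnj_dzbar_coeff (mob x z) = cnj (trace (skew (N1 (mob x z)) ** (\<chi> i j. \<mu>2 (mob x z) $ i $ j * cnj (deriv (mob x) z))))"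
      by (simp add: cnj_dzbar_coeff_def trace_mult_eq sum_distrib_left mult_ac)
    also have "\<dots> = cnj (trace (Ad x (skew (N1 z) ** \<mu>2 z)) + trace (\<xi>1 x ** Ad x (\<mu>2 z)))"
      unfolding m[OF z] S[OF z] matrix_mult_add(2) Ad_matrix_mult[OF x] trace_add ..
    finally show ?thesis unfolding Y trace_Ad[OF x] cnj_dzbar_coeff_def by simp
  qed
  have i: "dz_coeff contour_integrable_on c" "cnj_dzbar_coeff contour_integrable_on c"
    using cont_coeff c by (auto intro!: contour_integrable_C1 intro: continuous_on_subset)
  note t = trace_primitive[OF vc c(2), of Y]
  have "contour_integral (mob x \<circ> c) dz_coeff = contour_integral c (\<lambda>z. deriv (mob x) z * dz_coeff (mob x z))"
    by (rule contour_integral_comp_analyticW[OF analytic_mob[OF det1[OF x]] vc c(2)])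
  also have "\<dots> = contour_integral c (\<lambda>z. dz_coeff z + trace (Y ** mat_adj (\<mu>2 z)))"
    by (rule contour_integral_cong) (use e1 c(2) in auto)
  also have "\<dots> = contour_integral c dz_coeff + trace (Y ** mat_adj (N2 (pathfinish c) - N2 (pathstart c)))"
    by (rule contour_integral_unique[OF has_contour_integral_add[OF has_contour_integral_integral[OF i(1)] t(1)]])
  finally have A: "contour_integral (mob x \<circ> c) dz_coeff = contour_integral c dz_coeff + trace (Y ** mat_adj (N2 (pathfinish c) - N2 (pathstart c)))" .
  have "contour_integral (mob x \<circ> c) cnj_dzbar_coeff = contour_integral c (\<lambda>z. deriv (mob x) z * cnj_dzbar_coeff (mob x z))"
    by (rule contour_integral_comp_analyticW[OF analytic_mob[OF det1[OF x]] vc c(2)])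
  also have "\<dots> = contour_integral c (\<lambda>z. cnj_dzbar_coeff z + cnj (trace (Y ** \<mu>2 z)))"
    by (rule contour_integral_cong) (use e2 c(2) in auto)
  also have "\<dots> = contour_integral c cnj_dzbar_coeff + cnj (trace (Y ** (N2 (pathfinish c) - N2 (pathstart c))))"
    by (rule contour_integral_unique[OF has_contour_integral_add[OF has_contour_integral_integral[OF i(2)] t(2)]])
  finally have B: "contour_integral (mob x \<circ> c) cnj_dzbar_coeff = contour_integral c cnj_dzbar_coeff + cnj (trace (Y ** (N2 (pathfinish c) - N2 (pathstart c))))" .
  have "cup_integral (mob x \<circ> c) = cup_integral c + trace (Y ** (skew (N2 (pathfinish c)) - skew (N2 (pathstart c))))"
    unfolding cup_integral_def A B skew_add(2)[symmetric] unfolding skew_def by (simp add: matrix_mult_diff trace_sub)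
  also have "trace (Y ** Z) = - trace (\<xi>1 (matrix_inv x) ** Z)" for Z
    by (simp add: Y_def trace_mult_eq sum_negf)
  finally show ?thesis by (simp only: diff_conv_add_uminus)
qed

end

context harmonic_pair begin

abbreviation "la \<equiv> \<lambda>k. linepath v0 (mob (a k) v0)"
abbreviation "lb \<equiv> \<lambda>k. linepath v0 (mob (b k) v0)"

lemma line_side:
  assumes "k \<in> {1..g}" "x \<in> \<Gamma>"
  shows "(mob x \<circ> la k) C1_differentiable_on {0..1}" "(mob x \<circ> lb k) C1_differentiable_on {0..1}"
    "path_image (mob x \<circ> la k) \<subseteq> \<H>" "path_image (mob x \<circ> lb k) \<subseteq> \<H>"
  using side_path[OF edge_paths_linepath assms] edge_paths_linepath assms(1)
    C1_differentiable_compose_holomorphic[OF C1_differentiable_linepath _ holomorphic_mob[OF det1[OF assms(2)]] upper_half_plane_simps(1)]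
  unfolding edge_paths_def by blast+

lemma contour_integrable_side:
  assumes "continuous_on \<H> f" "k \<in> {1..g}" "x \<in> \<Gamma>"
  shows "f contour_integrable_on (mob x \<circ> la k)" "f contour_integrable_on (mob x \<circ> lb k)"
  using line_side[OF assms(2,3)] by (auto intro!: contour_integrable_C1 continuous_on_subset[OF assms(1)])

lemma polygon_integral_diff:
  assumes "continuous_on \<H> f" "continuous_on \<H> h"
  shows "polygon_integral g a b la lb (\<lambda>z. f z - h z) = polygon_integral g a b la lb f - polygon_integral g a b la lb h"
  unfolding polygon_integral_def sum_subtractf[symmetric]
proof (rule sum.cong[OF refl])
  fix k assume k: "k \<in> {1..g}"
  note i = contour_integrable_side[OF assms(1) k] contour_integrable_side[OF assms(2) k]
  have d: "contour_integral (mob x \<circ> la k) (\<lambda>z. f z - h z) = contour_integral (mob x \<circ> la k) f - contour_integral (mob x \<circ> la k) h"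
    "contour_integral (mob x \<circ> lb k) (\<lambda>z. f z - h z) = contour_integral (mob x \<circ> lb k) f - contour_integral (mob x \<circ> lb k) h" if "x \<in> \<Gamma>" for x
    using i[OF that] by (simp_all only: contour_integral_diff)
  show "contour_integral (mob (side_a a b k) \<circ> la k) (\<lambda>z. f z - h z) + contour_integral (mob (side_b a b k) \<circ> lb k) (\<lambda>z. f z - h z)
      - contour_integral (mob (side_a' a b k) \<circ> la k) (\<lambda>z. f z - h z) - contour_integral (mob (side_b' a b k) \<circ> lb k) (\<lambda>z. f z - h z)
    = (contour_integral (mob (side_a a b k) \<circ> la k) f + contour_integral (mob (side_b a b k) \<circ> lb k) f
      - contour_integral (mob (side_a' a b k) \<circ> la k) f - contour_integral (mob (side_b' a b k) \<circ> lb k) f)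
    - (contour_integral (mob (side_a a b k) \<circ> la k) h + contour_integral (mob (side_b a b k) \<circ> lb k) h
      - contour_integral (mob (side_a' a b k) \<circ> la k) h - contour_integral (mob (side_b' a b k) \<circ> lb k) h)"
    unfolding d(1)[OF side_in(1)[OF k]] d(1)[OF side_in(3)[OF k]] d(2)[OF side_in(2)[OF k]] d(2)[OF side_in(4)[OF k]]
    by (simp only: algebra_simps)
qed

text \<open>Integrals over untranslated edges cancel between paired sides, leaving
  \<open>side_form\<close> with increments of \<open>skew N2\<close> from the vertex
  \<open>v0\<close>. These are periods based at \<open>v0\<close> instead of \<open>z0\<close>, so
  they differ from \<open>\<xi>2\<close> by the coboundary of \<open>skew (N2 v0)\<close>.\<close>

lemma goldman_form_eq_polygon_integral:
  "goldman_form g a b \<rho> \<xi>1 \<xi>2 = cnj (polygon_integral g a b la lb cnj_dzbar_coeff) - polygon_integral g a b la lb dz_coeff"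
proof -
  note coc = cocycle_ES_period[OF \<mu>1 N1 z0]
  have shift: "skew (N2 (mob x v0)) - skew (N2 v0) = \<xi>2 x + (Ad x (skew (N2 v0)) - skew (N2 v0))" if "x \<in> \<Gamma>" for x
    using conj_primitive_equivariant[OF \<mu>2 N2 that z0 v0] unitary_cocycle_ES_period[OF \<mu>2 N2 that z0]
    by (simp add: skew_add skew_Ad[OF that])
  have "cnj (polygon_integral g a b la lb cnj_dzbar_coeff) - polygon_integral g a b la lb dz_coeff
      = (\<Sum>k=1..g. cup_integral (mob (side_a a b k) \<circ> la k) + cup_integral (mob (side_b a b k) \<circ> lb k)
          - cup_integral (mob (side_a' a b k) \<circ> la k) - cup_integral (mob (side_b' a b k) \<circ> lb k))"
    unfolding polygon_integral_def cup_integral_def cnj_sum sum_subtractf[symmetric]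
    by (intro sum.cong refl) (simp only: complex_cnj_add complex_cnj_diff algebra_simps)
  also have "\<dots> = side_form \<xi>1 (\<lambda>k. \<xi>2 (a k) + (Ad (a k) (skew (N2 v0)) - skew (N2 v0))) (\<lambda>k. \<xi>2 (b k) + (Ad (b k) (skew (N2 v0)) - skew (N2 v0)))"
    unfolding side_form_def
  proof (rule sum.cong[OF refl])
    fix k assume k: "k \<in> {1..g}"
    note s = side_in[OF k] and ab = gens[OF k]
    have sub: "path_image (la k) \<subseteq> \<H>" "path_image (lb k) \<subseteq> \<H>"
      using edge_paths_linepath k unfolding edge_paths_def by blast+
    have A: "cup_integral (mob x \<circ> la k) = cup_integral (la k) - trace (\<xi>1 (matrix_inv x) ** (\<xi>2 (a k) + (Ad (a k) (skew (N2 v0)) - skew (N2 v0))))" if "x \<in> \<Gamma>" for x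
      using cup_integral_mob[OF C1_differentiable_linepath sub(1) that] unfolding pathstart_linepath pathfinish_linepath shift[OF ab(1)] .
    have B: "cup_integral (mob x \<circ> lb k) = cup_integral (lb k) - trace (\<xi>1 (matrix_inv x) ** (\<xi>2 (b k) + (Ad (b k) (skew (N2 v0)) - skew (N2 v0))))" if "x \<in> \<Gamma>" for x
      using cup_integral_mob[OF C1_differentiable_linepath sub(2) that] unfolding pathstart_linepath pathfinish_linepath shift[OF ab(2)] .
    show "cup_integral (mob (side_a a b k) \<circ> la k) + cup_integral (mob (side_b a b k) \<circ> lb k) - cup_integral (mob (side_a' a b k) \<circ> la k) - cup_integral (mob (side_b' a b k) \<circ> lb k)
      = trace ((\<xi>1 (matrix_inv (side_a' a b k)) - \<xi>1 (matrix_inv (side_a a b k))) ** (\<xi>2 (a k) + (Ad (a k) (skew (N2 v0)) - skew (N2 v0))))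
      + trace ((\<xi>1 (matrix_inv (side_b' a b k)) - \<xi>1 (matrix_inv (side_b a b k))) ** (\<xi>2 (b k) + (Ad (b k) (skew (N2 v0)) - skew (N2 v0))))"
      unfolding A[OF s(1)] A[OF s(3)] B[OF s(2)] B[OF s(4)] matrix_mult_diff(2) trace_sub by (simp only: algebra_simps)
  qed
  also have "\<dots> = side_form \<xi>1 (\<lambda>k. \<xi>2 (a k)) (\<lambda>k. \<xi>2 (b k))"
    by (rule side_form_coboundary[OF coc])
  also have "\<dots> = goldman_form g a b \<rho> \<xi>1 \<xi>2"
    by (rule goldman_form_eq_side_form[OF coc, symmetric])
  finally show ?thesis ..
qed

text \<open>The product of an antiholomorphic and a holomorphic factor. Its derivative in zbar is
  the integrand of the metric, \<open>trace (\<mu>1 z ** mat_adj (\<mu>2 z))\<close>.\<close>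

definition mixed_coeff where "mixed_coeff z = trace (N1 z ** mat_adj (\<mu>2 z))"

text \<open>Expanding \<open>skew (N1 z)\<close> leaves, besides the mixed term, the holomorphic
  functions \<open>h1\<close> and \<open>h2\<close>, whose integrals over the closed polygon vanish.
  The mixed terms of the two coefficients agree up to sign by conjugation and cyclicity of the
  trace.\<close>

lemma polygon_integral_coeff:
  "polygon_integral g a b la lb dz_coeff = polygon_integral g a b la lb mixed_coeff"
  "polygon_integral g a b la lb cnj_dzbar_coeff = - polygon_integral g a b la lb mixed_coeff"
proof -
  define h1 where "h1 z = trace (mat_adj (N1 z) ** mat_adj (\<mu>2 z))" for z
  define h2 where "h2 z = cnj (trace (N1 z ** \<mu>2 z))" for z
  have hol: "h1 holomorphic_on \<H>" "h2 holomorphic_on \<H>"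
    unfolding h1_def h2_def trace_mult_eq mat_adj_nth cnj_sum complex_cnj_mult by (intro holomorphic_intros holN)+
  have cQ: "continuous_on \<H> mixed_coeff"
    unfolding mixed_coeff_def trace_mult_eq mat_adj_nth by (intro continuous_intros contN)
  have z: "polygon_integral g a b la lb h = 0" if "h holomorphic_on \<H>" for h
    using sides_image(2)[OF edge_paths_linepath]
    by (intro polygon_integral_holomorphic_eq_0[OF edge_paths_linepath that]) (auto simp: upper_half_plane_simps(1,2))
  have "dz_coeff = (\<lambda>z. mixed_coeff z - h1 z)"
    by (simp add: fun_eq_iff dz_coeff_def mixed_coeff_def h1_def skew_def matrix_mult_diff trace_sub)
  then show "polygon_integral g a b la lb dz_coeff = polygon_integral g a b la lb mixed_coeff"
    using polygon_integral_diff[OF cQ holomorphic_on_imp_continuous_on[OF hol(1)]] z[OF hol(1)] by simp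
  have "cnj (trace (mat_adj (N1 z) ** \<mu>2 z)) = mixed_coeff z" for z
    unfolding trace_mat_adj[symmetric] mat_adj_simps mixed_coeff_def by (rule trace_mul_sym)
  then have "cnj_dzbar_coeff = (\<lambda>z. h2 z - mixed_coeff z)"
    by (simp add: fun_eq_iff cnj_dzbar_coeff_def h2_def skew_def matrix_mult_diff trace_sub)
  then show "polygon_integral g a b la lb cnj_dzbar_coeff = - polygon_integral g a b la lb mixed_coeff"
    using polygon_integral_diff[OF holomorphic_on_imp_continuous_on[OF hol(2)] cQ] z[OF hol(2)] by simp
qed

text \<open>This is \<open>polygon_area\<close> for \<open>P = mixed_coeff\<close>. As
  \<open>Px + \<i> * Py\<close> is twice the zbar derivative, halving puts the 2 into the
  denominator. The density is invariant since \<open>\<mu>1\<close> contributes the conjugate of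
  \<open>deriv (mob x) z\<close> and the adjoint of \<open>\<mu>2\<close> the derivative itself,
  whose product is the Jacobian.\<close>

lemma area_trace:
  assumes ec: "edge_paths g a b v0 ca cb" and g: "g \<ge> 1"
  defines "p \<equiv> polygon_boundary g a b ca cb"
  assumes p: "valid_path p" "pathfinish p = pathstart p" and F: "F = path_image p \<union> inside (path_image p)"
    and wn: "\<And>w. w \<in> inside (path_image p) \<Longrightarrow> winding_number p w = 1"
  shows "((\<lambda>z. trace (\<mu>1 z ** mat_adj (\<mu>2 z))) has_integral (polygon_integral g a b la lb mixed_coeff / (2 * \<i>))) F"
proof -
  define m where "m i j z = cnj (\<mu>2 z $ i $ j)" for i j z
  define Px where "Px z = (\<Sum>i\<in>UNIV. \<Sum>j\<in>UNIV. \<mu>1 z $ i $ j * m i j z + N1 z $ i $ j * deriv (m i j) z)" for z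
  \<comment> \<open>The antiholomorphic factor \<open>N1\<close> brings \<open>- \<i>\<close> and
    the holomorphic factor \<open>m\<close> brings \<open>\<i>\<close> in the imaginary
    direction.\<close>
  define Py where "Py z = (\<Sum>i\<in>UNIV. \<Sum>j\<in>UNIV. - \<i> * \<mu>1 z $ i $ j * m i j z + N1 z $ i $ j * (\<i> * deriv (m i j) z))" for z
  have hm: "m i j holomorphic_on \<H>" for i j using holN(4) by (simp add: m_def[abs_def])
  have dm: "(m i j has_field_derivative deriv (m i j) z) (at z)" if "z \<in> \<H>" for i j z
    using holomorphic_derivI[OF hm upper_half_plane_simps(1) that] .
  have cm: "continuous_on \<H> (m i j)" "continuous_on \<H> (deriv (m i j))" for i j
    using holomorphic_on_imp_continuous_on[OF hm] holomorphic_on_imp_continuous_on[OF holomorphic_deriv[OF hm upper_half_plane_simps(1)]] by auto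
  have cmu: "continuous_on \<H> (\<lambda>z. \<mu>1 z $ i $ j)" for i j
    using continuous_on_cnj[OF holomorphic_on_imp_continuous_on[OF holN(3)]] by simp
  have cPx: "continuous_on \<H> Px" and cPy: "continuous_on \<H> Py"
    unfolding Px_def Py_def by (intro continuous_intros cm cmu contN)+
  have KK: "Px z + \<i> * Py z = 2 * trace (\<mu>1 z ** mat_adj (\<mu>2 z))" for z
    unfolding Px_def Py_def trace_mult_eq mat_adj_nth m_def
    by (simp add: sum_distrib_left sum.distrib[symmetric] algebra_simps)
  have Qd: "(mixed_coeff has_derivative (\<lambda>h. Re h *\<^sub>R Px z + Im h *\<^sub>R Py z)) (at z)" if z: "z \<in> \<H>" for z
  proof -
    have "((\<lambda>z. N1 z $ i $ j) has_derivative (\<lambda>h. cnj (cnj (\<mu>1 z $ i $ j) * h))) (at z)" for i j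
      using has_derivative_cnj[OF has_field_derivative_imp_has_derivative[OF derN(1)[OF z]], of i j] by simp
    note d1 = this
    have d2: "(m i j has_derivative (\<lambda>h. deriv (m i j) z * h)) (at z)" for i j
      using has_field_derivative_imp_has_derivative[OF dm[OF z]] .
    have "(mixed_coeff has_derivative (\<lambda>h. \<Sum>i\<in>UNIV. \<Sum>j\<in>UNIV. N1 z $ i $ j * (deriv (m i j) z * h) + cnj (cnj (\<mu>1 z $ i $ j) * h) * m i j z)) (at z)"
      unfolding mixed_coeff_def[abs_def] trace_mult_eq mat_adj_nth m_def[symmetric]
      by (intro has_derivative_sum has_derivative_mult d1 d2)
    moreover have "(\<Sum>i\<in>UNIV. \<Sum>j\<in>UNIV. N1 z $ i $ j * (deriv (m i j) z * h) + cnj (cnj (\<mu>1 z $ i $ j) * h) * m i j z)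
       = Re h *\<^sub>R Px z + Im h *\<^sub>R Py z" for h
    proof -
      have e: "n * (d * h) + cnj (cnj u * h) * v = Re h *\<^sub>R (u * v + n * d) + Im h *\<^sub>R (- \<i> * u * v + n * (\<i> * d))" for n d u v
      proof -
        have "h = of_real (Re h) + \<i> * of_real (Im h)" by (simp add: complex_eq)
        then have "n * (d * h) + cnj (cnj u * h) * v
           = n * (d * (of_real (Re h) + \<i> * of_real (Im h))) + u * (of_real (Re h) - \<i> * of_real (Im h)) * v"
          by (metis complex_cnj_add complex_cnj_cnj complex_cnj_complex_of_real complex_cnj_i complex_cnj_mult diff_conv_add_uminus mult_minus_left)
        then show ?thesis by (simp add: scaleR_conv_of_real algebra_simps)
      qed
      show ?thesis unfolding e Px_def Py_def by (simp only: scaleR_sum_right sum.distrib[symmetric])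
    qed
    ultimately show ?thesis by simp
  qed
  have inv: "(cmod (deriv (mob x) z))\<^sup>2 *\<^sub>R (Px (mob x z) + \<i> * Py (mob x z)) = Px z + \<i> * Py z" if x: "x \<in> \<Gamma>" and z: "z \<in> \<H>" for x z
  proof -
    let ?d = "deriv (mob x) z"
    have n: "of_real ((cmod ?d)\<^sup>2) = cnj ?d * ?d" by (metis complex_norm_square mult.commute)
    have "(cmod ?d)\<^sup>2 *\<^sub>R trace (\<mu>1 (mob x z) ** mat_adj (\<mu>2 (mob x z)))
       = trace ((\<chi> i j. \<mu>1 (mob x z) $ i $ j * cnj ?d) ** mat_adj (\<chi> i j. \<mu>2 (mob x z) $ i $ j * cnj ?d))"
      unfolding scaleR_conv_of_real n by (simp add: trace_mult_eq mat_adj_nth sum_distrib_left mult_ac)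
    also have "\<dots> = trace (\<mu>1 z ** mat_adj (\<mu>2 z))"
      unfolding harmonic_transform[OF \<mu>1 x z] harmonic_transform[OF \<mu>2 x z] mat_adj_Ad[OF x] Ad_matrix_mult[OF x] trace_Ad[OF x] ..
    finally show ?thesis unfolding KK by (simp add: scaleR_conv_of_real)
  qed
  have "((\<lambda>z. Px z + \<i> * Py z) has_integral (polygon_integral g a b la lb mixed_coeff / \<i>)) F"
    by (rule polygon_area[OF ec g p[unfolded p_def] F[unfolded p_def] wn[unfolded p_def] Qd cPx cPy refl inv])
  then have "((\<lambda>z. (1/2) * (2 * trace (\<mu>1 z ** mat_adj (\<mu>2 z)))) has_integral ((1/2) * (polygon_integral g a b la lb mixed_coeff / \<i>))) F"
    unfolding KK by (rule has_integral_mult_right)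
  then show ?thesis by simp
qed

text \<open>With \<open>A\<close> the area integral, \<open>R = 2 * \<i> * A\<close> makes the
  Goldman form \<open>- cnj R - R = 4 * Im A\<close>. On the other side
  \<open>NAB_inner F \<mu>1 \<mu>2 = 2 * A\<close>, hence
  \<open>omega_NAB F \<mu>1 \<mu>2 = - Im A\<close>; exchanging the arguments conjugates
  \<open>A\<close>.\<close>

lemma goldman_form_eq:
  assumes ec: "edge_paths g a b v0 ca cb" and g: "g \<ge> 1"
  defines "p \<equiv> polygon_boundary g a b ca cb"
  assumes p: "valid_path p" "pathfinish p = pathstart p" and F: "F = path_image p \<union> inside (path_image p)"
    and wn: "\<And>w. w \<in> inside (path_image p) \<Longrightarrow> winding_number p w = 1"
  shows "goldman_form g a b \<rho> \<xi>1 \<xi>2 = - \<i> * (NAB_inner F \<mu>1 \<mu>2 - NAB_inner F \<mu>2 \<mu>1)"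
    and "goldman_form g a b \<rho> \<xi>1 \<xi>2 = complex_of_real (- 4 * omega_NAB F \<mu>1 \<mu>2)"
proof -
  define A where "A = integral F (\<lambda>z. trace (\<mu>1 z ** mat_adj (\<mu>2 z)))"
  define R where "R = polygon_integral g a b la lb mixed_coeff"
  note hi = area_trace[OF ec g p[unfolded p_def] F[unfolded p_def] wn[unfolded p_def], folded R_def]
  have R: "R = 2 * \<i> * A" using integral_unique[OF hi] by (simp add: A_def)
  have "trace (\<mu>2 z ** mat_adj (\<mu>1 z)) = cnj (trace (\<mu>1 z ** mat_adj (\<mu>2 z)))" for z
    unfolding trace_mat_adj[symmetric] mat_adj_simps ..
  then have A': "integral F (\<lambda>z. trace (\<mu>2 z ** mat_adj (\<mu>1 z))) = cnj A"
    unfolding A_def by (simp add: integral_cnj)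
  have G: "goldman_form g a b \<rho> \<xi>1 \<xi>2 = - cnj R - R"
    unfolding goldman_form_eq_polygon_integral polygon_integral_coeff R_def by simp
  have NAB: "NAB_inner F \<mu>1 \<mu>2 = 2 * A" "NAB_inner F \<mu>2 \<mu>1 = 2 * cnj A"
    unfolding NAB_inner_def A' A_def[symmetric] by simp_all
  show "goldman_form g a b \<rho> \<xi>1 \<xi>2 = - \<i> * (NAB_inner F \<mu>1 \<mu>2 - NAB_inner F \<mu>2 \<mu>1)"
    unfolding G NAB R by (simp add: algebra_simps)
  show "goldman_form g a b \<rho> \<xi>1 \<xi>2 = complex_of_real (- 4 * omega_NAB F \<mu>1 \<mu>2)"
    unfolding G R omega_NAB_def NAB by (simp add: complex_eq_iff)
qed

end

theorem theorem2:
  fixes \<Gamma> :: "(real^2^2) set" and g :: nat and a b :: "nat \<Rightarrow> real^2^2" and F :: "complex set"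
    and \<rho> :: "real^2^2 \<Rightarrow> complex^'n^'n" and \<mu>1 \<mu>2 :: "complex \<Rightarrow> complex^'n^'n" and z0 :: complex
  assumes "g > 1"
    and "standard_fuchsian \<Gamma> g a b F"
    and "unitary_rep \<Gamma> \<rho>" and "irreducible_rep \<Gamma> \<rho>"
    and "z0 \<in> upper_half_plane"
    and "harmonic_01 \<Gamma> \<rho> \<mu>1" and "harmonic_01 \<Gamma> \<rho> \<mu>2"
  shows "goldman_form g a b \<rho> (unitary_cocycle (ES_period \<mu>1 z0)) (unitary_cocycle (ES_period \<mu>2 z0))
           = - \<i> * (NAB_inner F \<mu>1 \<mu>2 - NAB_inner F \<mu>2 \<mu>1)
       \<and> goldman_form g a b \<rho> (unitary_cocycle (ES_period \<mu>1 z0)) (unitary_cocycle (ES_period \<mu>2 z0))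
           = complex_of_real (- 4 * omega_NAB F \<mu>1 \<mu>2)"
proof -
  obtain v0 ca cb where v0: "v0 \<in> \<H>" and ec: "edge_paths g a b v0 ca cb"
    and p: "valid_path (polygon_boundary g a b ca cb)"
      "pathfinish (polygon_boundary g a b ca cb) = pathstart (polygon_boundary g a b ca cb)"
      "F = path_image (polygon_boundary g a b ca cb) \<union> inside (path_image (polygon_boundary g a b ca cb))"
      "\<And>w. w \<in> inside (path_image (polygon_boundary g a b ca cb)) \<Longrightarrow> winding_number (polygon_boundary g a b ca cb) w = 1"
    using assms(2) unfolding standard_fuchsian_def Let_def edge_paths_def by blast
  obtain N1 where N1: "conj_primitive \<mu>1 z0 N1"
    using conj_primitive_exists[of \<mu>1] assms(6) by (auto simp: harmonic_01_def)
  obtain N2 where N2: "conj_primitive \<mu>2 z0 N2"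
    using conj_primitive_exists[of \<mu>2] assms(7) by (auto simp: harmonic_01_def)
  \<comment> \<open>The periods are based at \<open>z0\<close>, the polygon at its vertex
    \<open>v0\<close>; the primitives are normalized at \<open>z0\<close>.\<close>
  interpret harmonic_pair \<Gamma> g a b v0 \<rho> \<mu>1 \<mu>2 N1 N2 z0
    using assms v0 N1 N2 by unfold_locales (auto simp: standard_fuchsian_def)
  have "g \<ge> 1" using assms(1) by simp
  from goldman_form_eq[OF ec this p] show ?thesis by (rule conjI)
qed

end
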